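(* Let $P$ and $Q$ be probability distributions on $\mathcal{H}$ with $\mathbb{E}_{X\sim P}[k(X,X)^2]<\infty$ and $\mathbb{E}_{Y\sim Q}[k(Y,Y)^2]<\infty$. Let $X_1,\dots,X_n$ be i.i.d. from $P$ and $Y_1,\dots,Y_m$ i.i.d. from $Q$, the two samples being independent of each other, and let $n,m\to\infty$ in such a way that $n/(n+m)\to\rho$ with $0<\rho<1$. Suppose $P=Q$. Then $$(n+m)\,\widehat{T}^2_{n,m}\ \xrightarrow{\mathcal{D}}\ \frac{1}{\rho(1-\rho)}\sum_{\ell=1}^{\infty}\lambda_\ell Z_\ell^2 ,$$ where $Z_1,Z_2,\dots$ are i.i.d. $N(0,1)$ and $\{\lambda_\ell\}_{\ell\ge 1}$ are the eigenvalues (counted with multiplicity) of the covariance operator $V_{X\sim P}[(k(\cdot,X)-\mu_k(P))^{\otimes 2}]$.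
   Context: $\mathcal{H}$ is a separable Hilbert space equipped with a $\sigma$-algebra $\mathcal{A}$, and $k:\mathcal{H}\times\mathcal{H}\to\mathbb{R}$ is a characteristic positive definite kernel with reproducing kernel Hilbert space $H(k)$ (characteristic: $\mu_k(P)=\mu_k(Q)$ implies $P=Q$, with $\mu_k$ as below). For $h,h'\in H(k)$, $h\otimes h'$ is the operator $x\mapsto\langle h',x\rangle_{H(k)}h$ on $H(k)$, $h^{\otimes 2}=h\otimes h$, and $H(k)^{\otimes 2}=H(k)\otimes H(k)$ is the Hilbert tensor product (Hilbert--Schmidt operators on $H(k)$ with the Hilbert--Schmidt inner product). Tensor products of elements of $H(k)^{\otimes 2}$ are defined in the same way. Expectations of Hilbert-space-valued variables are Bochner integrals. For a distribution $P$: $\mu_k(P)=\mathbb{E}_{X\sim P}[k(\cdot,X)]\in H(k)$ and $\Sigma_k(P)=\mathbb{E}_{X\sim P}[(k(\cdot,X)-\mu_k(P))^{\otimes 2}]\in H(k)^{\otimes 2}$. The covariance operator $V_{X\sim P}[(k(\cdot,X)-\mu_k(P))^{\otimes 2}]=\mathbb{E}_{X\sim P}[\{(k(\cdot,X)-\mu_k(P))^{\otimes 2}-\Sigma_k(P)\}^{\otimes 2}]$ acts on $H(k)^{\otimes 2}$. Test statistic: $\widehat{T}^2_{n,m}=\|\Sigma_k(\widehat{P})-\Sigma_k(\widehat{Q})\|^2_{H(k)^{\otimes 2}}$, where $\mu_k(\widehat{P})=\frac1n\sum_{i=1}^n k(\cdot,X_i)$, $\Sigma_k(\widehat{P})=\frac1n\sum_{i=1}^n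 (k(\cdot,X_i)-\mu_k(\widehat{P}))^{\otimes 2}$, $\mu_k(\widehat{Q})=\frac1m\sum_{j=1}^m k(\cdot,Y_j)$, $\Sigma_k(\widehat{Q})=\frac1m\sum_{j=1}^m (k(\cdot,Y_j)-\mu_k(\widehat{Q}))^{\otimes 2}$. The symbol $\xrightarrow{\mathcal{D}}$ denotes convergence in distribution. *)

theory Defs
  imports "HOL-Probability.Probability"
begin

definition orthonormal :: "'a::real_inner set \<Rightarrow> bool" where
  "orthonormal B \<longleftrightarrow> (\<forall>x\<in>B. \<forall>y\<in>B. x \<bullet> y = (if x = y then 1 else 0))"

definition orthonormal_basis :: "'a::real_inner set \<Rightarrow> bool" where
  "orthonormal_basis B \<longleftrightarrow> orthonormal B \<and> closure (span B) = UNIV"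

lemma orthonormal_subset: "orthonormal B \<Longrightarrow> F \<subseteq> B \<Longrightarrow> orthonormal F"
  unfolding orthonormal_def by blast

lemma orthonormal_norm_sum:
  assumes "orthonormal F" "finite F"
  shows "(norm (\<Sum>e\<in>F. a e *\<^sub>R e))\<^sup>2 = (\<Sum>e\<in>F. (a e)\<^sup>2)"
proof -
  have "(norm (\<Sum>e\<in>F. a e *\<^sub>R e))\<^sup>2 = (\<Sum>e\<in>F. \<Sum>d\<in>F. a e * (a d * (e \<bullet> d)))"
    by (simp add: power2_norm_eq_inner inner_sum_left inner_sum_right sum_distrib_left inner_commute mult.left_commute)
  also have "\<dots> = (\<Sum>e\<in>F. \<Sum>d\<in>F. if d = e then a e * a e else 0)"
    using assms(1) by (intro sum.cong refl) (auto simp: orthonormal_def)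
  also have "\<dots> = (\<Sum>e\<in>F. (a e)\<^sup>2)"
    using assms(2) by (simp add: power2_eq_square)
  finally show ?thesis .
qed

lemma bessel_finite:
  assumes "orthonormal F" "finite F"
  shows "(\<Sum>e\<in>F. (x \<bullet> e)\<^sup>2) \<le> (norm x)\<^sup>2"
proof -
  let ?s = "\<Sum>e\<in>F. (x \<bullet> e) *\<^sub>R e"
  have 1: "x \<bullet> ?s = (\<Sum>e\<in>F. (x \<bullet> e)\<^sup>2)"
    by (simp add: inner_sum_right power2_eq_square)
  have "0 \<le> (norm (x - ?s))\<^sup>2" by simp
  also have "\<dots> = (norm x)\<^sup>2 - 2 * (x \<bullet> ?s) + (norm ?s)\<^sup>2"
    by (simp add: power2_norm_eq_inner inner_diff_left inner_diff_right inner_commute)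
  finally show ?thesis using 1 orthonormal_norm_sum[OF assms, of "\<lambda>e. x \<bullet> e"] by simp
qed

lemma bessel_summable:
  assumes "orthonormal B"
  shows "(\<lambda>e. (x \<bullet> e)\<^sup>2) summable_on B"
proof (rule nonneg_bdd_above_summable_on)
  show "bdd_above (sum (\<lambda>e. (x \<bullet> e)\<^sup>2) ` {F. F \<subseteq> B \<and> finite F})"
    using bessel_finite orthonormal_subset[OF assms] by (intro bdd_aboveI[of _ "(norm x)\<^sup>2"]) auto
qed simp

lemma orthonormal_summable:
  fixes B :: "'a::{real_inner,banach} set"
  assumes "orthonormal B" and sm: "(\<lambda>e. (a e)\<^sup>2) summable_on B"
  shows "(\<lambda>e. a e *\<^sub>R e) summable_on B"
proof -
  let ?f = "\<lambda>e. a e *\<^sub>R e"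
  let ?F = "finite_subsets_at_top B"
  have "cauchy_filter (filtermap (sum ?f) ?F)"
    unfolding cauchy_filter_metric_filtermap
  proof (intro allI impI)
    fix \<epsilon> :: real assume "\<epsilon> > 0"
    define S where "S = infsum (\<lambda>e. (a e)\<^sup>2) B"
    have lim: "(sum (\<lambda>e. (a e)\<^sup>2) \<longlongrightarrow> S) ?F"
      using infsum_tendsto[OF sm] S_def by simp
    have "eventually (\<lambda>G. sum (\<lambda>e. (a e)\<^sup>2) G > S - \<epsilon>\<^sup>2/4) ?F"
      using order_tendstoD(1)[OF lim, of "S - \<epsilon>\<^sup>2/4"] \<open>\<epsilon> > 0\<close> by simp
    then obtain G where G: "finite G" "G \<subseteq> B"
      and GG: "\<And>H. finite H \<Longrightarrow> G \<subseteq> H \<Longrightarrow> H \<subseteq> B \<Longrightarrow> sum (\<lambda>e. (a e)\<^sup>2) H > S - \<epsilon>\<^sup>2/4"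
      unfolding eventually_finite_subsets_at_top by meson
    have small: "norm (sum ?f H - sum ?f G) < \<epsilon>/2" if H: "finite H" "G \<subseteq> H" "H \<subseteq> B" for H
    proof -
      have eq: "sum ?f H - sum ?f G = sum ?f (H - G)"
        using H by (simp add: sum_diff)
      have "(norm (sum ?f (H - G)))\<^sup>2 = sum (\<lambda>e. (a e)\<^sup>2) (H - G)"
        using H by (intro orthonormal_norm_sum orthonormal_subset[OF assms(1)]) auto
      also have "\<dots> = sum (\<lambda>e. (a e)\<^sup>2) H - sum (\<lambda>e. (a e)\<^sup>2) G"
        using H by (simp add: sum_diff)
      also have "\<dots> < \<epsilon>\<^sup>2/4"
      proof -
        have "sum (\<lambda>e. (a e)\<^sup>2) H \<le> S" unfolding S_def
          by (rule finite_sum_le_infsum[OF sm]) (use H in auto)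
        then show ?thesis using GG[of G] G by simp
      qed
      also have "\<dots> = (\<epsilon>/2)\<^sup>2" by (simp add: power2_eq_square)
      finally show ?thesis using eq \<open>\<epsilon> > 0\<close> by (metis half_gt_zero_iff less_imp_le power2_less_imp_less)
    qed
    show "\<exists>P. eventually P ?F \<and> (\<forall>x y. P x \<and> P y \<longrightarrow> dist (sum ?f x) (sum ?f y) < \<epsilon>)"
    proof (intro exI conjI allI impI)
      show "eventually (\<lambda>H. finite H \<and> G \<subseteq> H \<and> H \<subseteq> B) ?F"
        using G by (auto simp: eventually_finite_subsets_at_top)
      fix x y assume "(finite x \<and> G \<subseteq> x \<and> x \<subseteq> B) \<and> (finite y \<and> G \<subseteq> y \<and> y \<subseteq> B)"
      then have "dist (sum ?f x) (sum ?f G) < \<epsilon>/2" "dist (sum ?f y) (sum ?f G) < \<epsilon>/2"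
        using small by (auto simp: dist_norm)
      then show "dist (sum ?f x) (sum ?f y) < \<epsilon>"
        by (rule dist_triangle_half_l)
    qed
  qed
  moreover note complete_UNIV[where 'a='a]
  ultimately obtain s where "(sum ?f \<longlongrightarrow> s) ?F"
    using complete_uniform[where S=UNIV] by (force simp: filterlim_def)
  then show ?thesis
    using has_sum_def summable_on_def by blast
qed

lemma orthonormal_coeff:
  assumes "orthonormal B" "((\<lambda>e. a e *\<^sub>R e) has_sum s) B" "d \<in> B"
  shows "s \<bullet> d = a d"
proof -
  have "((\<lambda>e. (a e *\<^sub>R e) \<bullet> d) has_sum (s \<bullet> d)) B"
    by (rule has_sum_bounded_linear[OF bounded_linear_inner_left assms(2)])
  moreover have "((\<lambda>e. (a e *\<^sub>R e) \<bullet> d) has_sum a d) B"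
    using assms(1,3) by (intro has_sum_finite_neutralI[of "{d}"]) (auto simp: orthonormal_def)
  ultimately show ?thesis by (rule has_sum_unique)
qed

lemma has_sum_in_closure_span:
  assumes "((\<lambda>e. a e *\<^sub>R e) has_sum s) B"
  shows "s \<in> closure (span B)"
proof (rule Lim_in_closed_set[OF closed_closure _ finite_subsets_at_top_neq_bot])
  show "(sum (\<lambda>e. a e *\<^sub>R e) \<longlongrightarrow> s) (finite_subsets_at_top B)"
    using assms by (simp add: has_sum_def)
  show "\<forall>\<^sub>F F in finite_subsets_at_top B. (\<Sum>e\<in>F. a e *\<^sub>R e) \<in> closure (span B)"
    by (rule eventually_finite_subsets_at_top_weakI)
       (intro subsetD[OF closure_subset] span_sum span_mul span_base, blast)
qed

lemma orthogonal_closure_span: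
  assumes "\<And>e. e \<in> B \<Longrightarrow> x \<bullet> e = 0" "y \<in> closure (span B)"
  shows "x \<bullet> y = 0"
proof -
  have "closed {y. x \<bullet> y = 0}"
    by (intro closed_Collect_eq continuous_intros)
  moreover have "subspace {y. x \<bullet> y = 0}"
    by (auto simp: subspace_def inner_add_right)
  then have "span B \<subseteq> {y. x \<bullet> y = 0}"
    using assms(1) by (intro span_minimal) auto
  ultimately show ?thesis using assms(2) closure_minimal by blast
qed

lemma orthonormal_residual:
  fixes B :: "'a::{real_inner,banach} set"
  assumes "orthonormal B"
  obtains s where "((\<lambda>e. (x \<bullet> e) *\<^sub>R e) has_sum s) B" "\<And>e. e \<in> B \<Longrightarrow> (x - s) \<bullet> e = 0"
proof -
  obtain s where s: "((\<lambda>e. (x \<bullet> e) *\<^sub>R e) has_sum s) B"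
    using orthonormal_summable[OF assms bessel_summable[OF assms, of x]] summable_on_def by blast
  show thesis
    using orthonormal_coeff[OF assms s] by (intro that[OF s]) (simp add: inner_diff_left)
qed

lemma orthonormal_basis_expansion:
  fixes B :: "'a::{real_inner,banach} set"
  assumes "orthonormal_basis B"
  shows "((\<lambda>e. (x \<bullet> e) *\<^sub>R e) has_sum x) B"
proof -
  have on: "orthonormal B" and cl: "closure (span B) = UNIV"
    using assms by (auto simp: orthonormal_basis_def)
  obtain s where s: "((\<lambda>e. (x \<bullet> e) *\<^sub>R e) has_sum s) B"
    and r: "\<And>e. e \<in> B \<Longrightarrow> (x - s) \<bullet> e = 0"
    using orthonormal_residual[OF on] by blast
  have "(x - s) \<bullet> (x - s) = 0"
    by (rule orthogonal_closure_span[OF r]) (auto simp: cl)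
  then show ?thesis using s by simp
qed

lemma parseval:
  fixes B :: "'a::{real_inner,banach} set"
  assumes "orthonormal_basis B"
  shows "((\<lambda>e. (x \<bullet> e)\<^sup>2) has_sum (norm x)\<^sup>2) B"
  using has_sum_bounded_linear[OF bounded_linear_inner_right[of x] orthonormal_basis_expansion[OF assms, of x]]
  unfolding power2_norm_eq_inner unfolding power2_eq_square inner_scaleR_right .

lemma orthonormal_basis_exists: "\<exists>B::'a::{real_inner,banach} set. orthonormal_basis B"
proof -
  have "\<exists>M\<in>Collect orthonormal. \<forall>X\<in>Collect orthonormal. M \<subseteq> X \<longrightarrow> X = (M::'a set)"
  proof (rule subset_Zorn')
    fix C :: "'a set set" assume C: "subset.chain (Collect orthonormal) C"
    have "x \<bullet> y = (if x = y then 1 else 0)" if xy: "x \<in> X" "X \<in> C" "y \<in> Y" "Y \<in> C" for x y X Y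
    proof -
      have "X \<subseteq> Y \<or> Y \<subseteq> X" "orthonormal X" "orthonormal Y"
        using C xy by (auto simp: subset_chain_def)
      then show ?thesis using xy by (auto simp: orthonormal_def)
    qed
    then show "\<Union> C \<in> Collect orthonormal"
      unfolding orthonormal_def by blast
  qed
  then obtain B :: "'a set" where on: "orthonormal B"
    and max: "\<And>X. orthonormal X \<Longrightarrow> B \<subseteq> X \<Longrightarrow> X = B"
    by blast
  have "x \<in> closure (span B)" for x
  proof -
    obtain s where s: "((\<lambda>e. (x \<bullet> e) *\<^sub>R e) has_sum s) B"
      and r: "\<And>e. e \<in> B \<Longrightarrow> (x - s) \<bullet> e = 0"
      using orthonormal_residual[OF on] by blast
    have "x = s"
    proof (rule ccontr)
      assume "x \<noteq> s"
      define u where "u = (x - s) /\<^sub>R norm (x - s)"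
      have u: "u \<bullet> u = 1" using \<open>x \<noteq> s\<close>
        by (simp add: u_def dot_square_norm power2_eq_square)
      have ue: "u \<bullet> e = 0" if "e \<in> B" for e using r[OF that] by (simp add: u_def)
      then have "orthonormal (insert u B)"
        using on u by (auto simp: orthonormal_def inner_commute)
      then have "u \<in> B" using max by blast
      then show False using ue u by fastforce
    qed
    then show ?thesis using has_sum_in_closure_span[OF s] by simp
  qed
  then show ?thesis using on by (auto simp: orthonormal_basis_def)
qed

definition hilbert_schmidt :: "('a::{real_inner,banach} \<Rightarrow>\<^sub>L 'a) \<Rightarrow> bool" where
  "hilbert_schmidt A \<longleftrightarrow>
    (\<exists>B. orthonormal_basis B \<and> (\<lambda>e. (norm (blinfun_apply A e))\<^sup>2) summable_on B)"

lemma blinfun_expansion: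
  fixes B :: "'a::{real_inner,banach} set" and A :: "'a \<Rightarrow>\<^sub>L 'b::real_normed_vector"
  assumes "orthonormal_basis B"
  shows "((\<lambda>e. (x \<bullet> e) *\<^sub>R A e) has_sum A x) B"
  using has_sum_bounded_linear[OF blinfun.bounded_linear_right orthonormal_basis_expansion[OF assms], of A x]
  by (simp add: blinfun.scaleR_right)

lemma hilbert_schmidt_basis:
  fixes A :: "'a::{real_inner,banach} \<Rightarrow>\<^sub>L 'a"
  assumes B: "orthonormal_basis B" and B': "orthonormal_basis B'"
    and S: "((\<lambda>e. (norm (A e))\<^sup>2) has_sum S) B"
  shows "((\<lambda>e. (norm (A e))\<^sup>2) has_sum S) B'"
proof -
  have on: "orthonormal B" using B by (simp add: orthonormal_basis_def)
  have "\<exists>r. \<forall>x. A x \<bullet> f = x \<bullet> r" if f: "f \<in> B" for f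
  proof -
    have "(\<lambda>e. (A e \<bullet> f)\<^sup>2) summable_on B"
    proof (rule summable_on_comparison_test)
      show "(\<lambda>e. (norm (A e))\<^sup>2) summable_on B" using S by (rule has_sum_imp_summable)
      have "norm f = 1" using f on by (simp add: orthonormal_def norm_eq_1)
      then show "(A e \<bullet> f)\<^sup>2 \<le> (norm (A e))\<^sup>2" for e
        using Cauchy_Schwarz_ineq2[of "A e" f] by (simp add: abs_le_square_iff[symmetric])
    qed simp
    from orthonormal_summable[OF on this] obtain r
      where r: "((\<lambda>e. (A e \<bullet> f) *\<^sub>R e) has_sum r) B" using summable_on_def by blast
    have "A x \<bullet> f = x \<bullet> r" for x
    proof -
      have "((\<lambda>e. (A e \<bullet> f) * (x \<bullet> e)) has_sum (x \<bullet> r)) B"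
        using has_sum_bounded_linear[OF bounded_linear_inner_right[of x] r] by simp
      moreover have "((\<lambda>e. (A e \<bullet> f) * (x \<bullet> e)) has_sum (A x \<bullet> f)) B"
        using has_sum_bounded_linear[OF bounded_linear_inner_left[of f] blinfun_expansion[OF B, of x A]]
        by (simp add: mult.commute)
      ultimately show ?thesis by (metis has_sum_unique)
    qed
    then show ?thesis by blast
  qed
  then obtain r where r: "\<And>f x. f \<in> B \<Longrightarrow> A x \<bullet> f = x \<bullet> r f" by metis
  have swap: "((\<lambda>(f, e). (A e \<bullet> f)\<^sup>2) has_sum T) (B \<times> C) \<longleftrightarrow>
      ((\<lambda>(e, f). (A e \<bullet> f)\<^sup>2) has_sum T) (C \<times> B)" for C T
    by (subst has_sum_swap) (simp add: case_prod_unfold)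
  have row: "((\<lambda>f. (A e \<bullet> f)\<^sup>2) has_sum (norm (A e))\<^sup>2) B" for e by (rule parseval[OF B])
  have col: "((\<lambda>e. (A e \<bullet> f)\<^sup>2) has_sum (norm (r f))\<^sup>2) C"
    if "orthonormal_basis C" "f \<in> B" for C f
    using parseval[OF that(1), of "r f"] r[OF that(2)] by (simp add: inner_commute)
  have "(\<lambda>(e, f). (A e \<bullet> f)\<^sup>2) summable_on B \<times> B"
    using row S by (intro summable_on_SigmaI[where g = "\<lambda>e. (norm (A e))\<^sup>2"])
      (auto dest: has_sum_imp_summable)
  then have "((\<lambda>(e, f). (A e \<bullet> f)\<^sup>2) has_sum S) (B \<times> B)"
    using row S by (intro has_sum_SigmaI[where g = "\<lambda>e. (norm (A e))\<^sup>2"]) auto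
  then have "((\<lambda>(f, e). (A e \<bullet> f)\<^sup>2) has_sum S) (B \<times> B)" using swap by blast
  then have rS: "((\<lambda>f. (norm (r f))\<^sup>2) has_sum S) B"
    by (rule has_sum_SigmaD) (use col[OF B] in auto)
  have "(\<lambda>(f, e). (A e \<bullet> f)\<^sup>2) summable_on B \<times> B'"
    using col[OF B'] rS by (intro summable_on_SigmaI[where g = "\<lambda>f. (norm (r f))\<^sup>2"])
      (auto dest: has_sum_imp_summable)
  then have "((\<lambda>(f, e). (A e \<bullet> f)\<^sup>2) has_sum S) (B \<times> B')"
    using col[OF B'] rS by (intro has_sum_SigmaI[where g = "\<lambda>f. (norm (r f))\<^sup>2"]) auto
  then have "((\<lambda>(e, f). (A e \<bullet> f)\<^sup>2) has_sum S) (B' \<times> B)" using swap by blast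
  then show ?thesis by (rule has_sum_SigmaD) (use row in auto)
qed

definition some_basis :: "'a::{real_inner,banach} set" where
  "some_basis = (SOME B. orthonormal_basis B)"

lemma some_basis: "orthonormal_basis some_basis"
  unfolding some_basis_def by (rule someI_ex[OF orthonormal_basis_exists])

lemma orthonormal_some_basis: "orthonormal some_basis"
  by (rule conjunct1[OF some_basis[unfolded orthonormal_basis_def]])

lemma hilbert_schmidt_some_basis:
  "hilbert_schmidt A \<longleftrightarrow> (\<lambda>e. (norm (A e))\<^sup>2) summable_on some_basis"
  unfolding hilbert_schmidt_def
  by (metis some_basis hilbert_schmidt_basis summable_on_def)

lemma hilbert_schmidt_zero: "hilbert_schmidt 0"
  by (simp add: hilbert_schmidt_some_basis)

lemma hilbert_schmidt_scaleR: "hilbert_schmidt A \<Longrightarrow> hilbert_schmidt (c *\<^sub>R A)"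
  by (simp add: hilbert_schmidt_some_basis blinfun.scaleR_left power_mult_distrib summable_on_cmult_right)

lemma hilbert_schmidt_add:
  assumes "hilbert_schmidt A" "hilbert_schmidt C"
  shows "hilbert_schmidt (A + C)"
  unfolding hilbert_schmidt_some_basis
proof (rule summable_on_comparison_test)
  show "(\<lambda>e. 2 * (norm (A e))\<^sup>2 + 2 * (norm (C e))\<^sup>2) summable_on some_basis"
    using assms unfolding hilbert_schmidt_some_basis by (intro summable_on_add summable_on_cmult_right)
  fix e
  have "(norm (A e + C e))\<^sup>2 \<le> (norm (A e) + norm (C e))\<^sup>2"
    by (intro power_mono norm_triangle_ineq) simp
  also have "\<dots> \<le> 2 * (norm (A e))\<^sup>2 + 2 * (norm (C e))\<^sup>2"
    using zero_le_power2[of "norm (A e) - norm (C e)"] by (simp add: power2_sum power2_diff)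
  finally show "(norm ((A + C) e))\<^sup>2 \<le> 2 * (norm (A e))\<^sup>2 + 2 * (norm (C e))\<^sup>2"
    by (simp add: blinfun.add_left)
qed simp

lemma hilbert_schmidt_inner_summable:
  assumes "hilbert_schmidt A" "hilbert_schmidt C"
  shows "(\<lambda>e. A e \<bullet> C e) summable_on some_basis"
proof -
  have *: "A e \<bullet> C e = 1/2 * ((norm ((A + C) e))\<^sup>2 + (- 1) * ((norm (A e))\<^sup>2 + (norm (C e))\<^sup>2))" for e
    by (simp add: blinfun.add_left power2_norm_eq_inner inner_add_left inner_add_right inner_commute)
  show ?thesis unfolding *
    using hilbert_schmidt_add[OF assms] assms unfolding hilbert_schmidt_some_basis
    by (intro summable_on_cmult_right summable_on_add)
qed

text \<open>
  The Hilbert tensor product of a Hilbert space with itself, realised as the space of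
  Hilbert--Schmidt operators; the inner product below does not depend on the basis by
  \<open>hilbert_schmidt_basis\<close> and polarisation.
\<close>

typedef (overloaded) 'a hs_op = "Collect hilbert_schmidt :: ('a::{real_inner,banach} \<Rightarrow>\<^sub>L 'a) set"
  morphisms op_of_hs Abs_hs_op
  using hilbert_schmidt_zero by auto

setup_lifting type_definition_hs_op

lemma op_of_hs [simp]: "hilbert_schmidt (op_of_hs T)"
  using op_of_hs by auto

instantiation hs_op :: ("{real_inner,banach}") real_inner
begin

lift_definition zero_hs_op :: "'a hs_op" is 0
  by (simp add: hilbert_schmidt_zero)
lift_definition scaleR_hs_op :: "real \<Rightarrow> 'a hs_op \<Rightarrow> 'a hs_op" is scaleR
  by (simp add: hilbert_schmidt_scaleR)
lift_definition plus_hs_op :: "'a hs_op \<Rightarrow> 'a hs_op \<Rightarrow> 'a hs_op" is "(+)"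
  by (simp add: hilbert_schmidt_add)
lift_definition uminus_hs_op :: "'a hs_op \<Rightarrow> 'a hs_op" is uminus
  using hilbert_schmidt_scaleR[where c = "- 1"] by simp
lift_definition minus_hs_op :: "'a hs_op \<Rightarrow> 'a hs_op \<Rightarrow> 'a hs_op" is "(-)"
  using hilbert_schmidt_add[OF _ hilbert_schmidt_scaleR[where c = "- 1"]] by simp

definition inner_hs_op :: "'a hs_op \<Rightarrow> 'a hs_op \<Rightarrow> real" where
  "inner_hs_op S T = infsum (\<lambda>e. op_of_hs S e \<bullet> op_of_hs T e) some_basis"
definition norm_hs_op :: "'a hs_op \<Rightarrow> real" where
  "norm_hs_op T = sqrt (T \<bullet> T)"
definition dist_hs_op :: "'a hs_op \<Rightarrow> 'a hs_op \<Rightarrow> real" where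
  "dist_hs_op S T = norm (S - T)"
definition sgn_hs_op :: "'a hs_op \<Rightarrow> 'a hs_op" where
  "sgn_hs_op T = inverse (norm T) *\<^sub>R T"
definition uniformity_hs_op :: "('a hs_op \<times> 'a hs_op) filter" where
  "uniformity_hs_op = (INF e\<in>{0<..}. principal {(x, y). dist x y < e})"
definition open_hs_op :: "'a hs_op set \<Rightarrow> bool" where
  "open_hs_op U = (\<forall>x\<in>U. \<forall>\<^sub>F (x', y) in uniformity. x' = x \<longrightarrow> y \<in> U)"

instance
proof
  fix R S T :: "'a hs_op" and c d :: real
  show "R + S + T = R + (S + T)" "R + S = S + R" "0 + R = R" "- R + R = 0" "R - S = R + - S"
    "c *\<^sub>R (R + S) = c *\<^sub>R R + c *\<^sub>R S" "(c + d) *\<^sub>R R = c *\<^sub>R R + d *\<^sub>R R"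
    "c *\<^sub>R d *\<^sub>R R = (c * d) *\<^sub>R R" "1 *\<^sub>R R = R"
    by (simp_all add: op_of_hs_inject[symmetric] plus_hs_op.rep_eq zero_hs_op.rep_eq uminus_hs_op.rep_eq
        minus_hs_op.rep_eq scaleR_hs_op.rep_eq scaleR_add_left scaleR_add_right)
  show "sgn R = inverse (norm R) *\<^sub>R R" "dist R S = norm (R - S)" "norm R = sqrt (R \<bullet> R)"
    "uniformity = (INF e\<in>{0<..}. principal {(x::'a hs_op, y). dist x y < e})"
    by (simp_all add: sgn_hs_op_def dist_hs_op_def norm_hs_op_def uniformity_hs_op_def)
  show "open U = (\<forall>x\<in>U. \<forall>\<^sub>F (x', y) in uniformity. x' = x \<longrightarrow> y \<in> U)" for U :: "'a hs_op set"
    by (simp add: open_hs_op_def)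
  show "R \<bullet> S = S \<bullet> R" by (simp add: inner_hs_op_def inner_commute)
  show "(R + S) \<bullet> T = R \<bullet> T + S \<bullet> T"
    by (simp add: inner_hs_op_def plus_hs_op.rep_eq blinfun.add_left inner_add_left
        infsum_add hilbert_schmidt_inner_summable)
  show "(c *\<^sub>R R) \<bullet> T = c * (R \<bullet> T)"
    by (simp add: inner_hs_op_def scaleR_hs_op.rep_eq blinfun.scaleR_left infsum_cmult_right')
  show "0 \<le> R \<bullet> R" by (simp add: inner_hs_op_def infsum_nonneg)
  show "R \<bullet> R = 0 \<longleftrightarrow> R = 0"
  proof
    assume "R \<bullet> R = 0"
    then have "op_of_hs R e \<bullet> op_of_hs R e = 0" if "e \<in> some_basis" for e
      using that by (intro nonneg_infsum_le_0D[of "\<lambda>e. op_of_hs R e \<bullet> op_of_hs R e" some_basis])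
        (auto simp: inner_hs_op_def hilbert_schmidt_inner_summable)
    then have z: "op_of_hs R e = 0" if "e \<in> some_basis" for e using that by simp
    have "op_of_hs R x = 0" for x
    proof -
      have "((\<lambda>e. (x \<bullet> e) *\<^sub>R op_of_hs R e) has_sum 0) some_basis"
        using z by (intro has_sum_0) auto
      then show ?thesis using blinfun_expansion[OF some_basis, of x "op_of_hs R"] has_sum_unique by blast
    qed
    then show "R = 0"
      by (simp add: op_of_hs_inject[symmetric] zero_hs_op.rep_eq blinfun_eqI)
  next
    assume "R = 0" then show "R \<bullet> R = 0" by (simp add: inner_hs_op_def zero_hs_op.rep_eq)
  qed
qed

end

lemma hs_norm_has_sum:
  "((\<lambda>e. (norm (op_of_hs T e))\<^sup>2) has_sum (norm T)\<^sup>2) some_basis"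
  using hilbert_schmidt_inner_summable[of "op_of_hs T" "op_of_hs T"]
  by (simp add: power2_norm_eq_inner inner_hs_op_def has_sum_infsum)

lemma op_norm_le_hs_norm: "norm (op_of_hs T) \<le> norm T"
proof (rule norm_blinfun_bound)
  fix x
  have lim: "((\<lambda>F. \<Sum>e\<in>F. (x \<bullet> e) *\<^sub>R op_of_hs T e) \<longlongrightarrow> op_of_hs T x) (finite_subsets_at_top some_basis)"
    using blinfun_expansion[OF some_basis, of x "op_of_hs T"] by (simp add: has_sum_def)
  have "norm (\<Sum>e\<in>F. (x \<bullet> e) *\<^sub>R op_of_hs T e) \<le> norm T * norm x"
    if F: "finite F" "F \<subseteq> some_basis" for F
  proof -
    have "norm (\<Sum>e\<in>F. (x \<bullet> e) *\<^sub>R op_of_hs T e) \<le> (\<Sum>e\<in>F. \<bar>x \<bullet> e\<bar> * \<bar>norm (op_of_hs T e)\<bar>)"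
      by (rule order_trans[OF norm_sum]) simp
    also have "\<dots> \<le> L2_set (\<lambda>e. x \<bullet> e) F * L2_set (\<lambda>e. norm (op_of_hs T e)) F"
      by (rule L2_set_mult_ineq)
    also have "\<dots> \<le> norm x * norm T"
    proof (intro mult_mono)
      show "L2_set (\<lambda>e. x \<bullet> e) F \<le> norm x"
        using bessel_finite[OF orthonormal_subset[OF orthonormal_some_basis F(2)] F(1), of x]
        by (simp add: L2_set_def real_le_lsqrt sum_nonneg)
      have "(\<Sum>e\<in>F. (norm (op_of_hs T e))\<^sup>2) \<le> (norm T)\<^sup>2"
        by (rule finite_sum_le_has_sum[OF hs_norm_has_sum]) (use F in auto)
      then show "L2_set (\<lambda>e. norm (op_of_hs T e)) F \<le> norm T"
        by (simp add: L2_set_def real_le_lsqrt sum_nonneg)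
    qed auto
    finally show ?thesis by (simp add: mult.commute)
  qed
  then show "norm (op_of_hs T x) \<le> norm T * norm x"
    by (intro tendsto_upperbound[OF tendsto_norm[OF lim]] eventually_finite_subsets_at_top_weakI) auto
qed simp

instance hs_op :: ("{real_inner,banach}") banach
proof
  fix X :: "nat \<Rightarrow> 'a hs_op" assume X: "Cauchy X"
  have "Cauchy (\<lambda>i. op_of_hs (X i))"
  proof (rule CauchyI)
    fix \<epsilon> :: real assume "\<epsilon> > 0"
    then obtain N where "\<And>i j. i \<ge> N \<Longrightarrow> j \<ge> N \<Longrightarrow> norm (X i - X j) < \<epsilon>" using CauchyD[OF X] by blast
    then show "\<exists>N. \<forall>i\<ge>N. \<forall>j\<ge>N. norm (op_of_hs (X i) - op_of_hs (X j)) < \<epsilon>"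
      using op_norm_le_hs_norm by (metis minus_hs_op.rep_eq order_le_less_trans)
  qed
  then obtain A where A: "(\<lambda>i. op_of_hs (X i)) \<longlonglongrightarrow> A"
    using Cauchy_convergent convergent_def by blast
  have bd: "(\<Sum>e\<in>F. (norm (op_of_hs (X i) e - A e))\<^sup>2) \<le> \<epsilon>\<^sup>2"
    if N: "\<And>i j. i \<ge> N \<Longrightarrow> j \<ge> N \<Longrightarrow> norm (X i - X j) < \<epsilon>"
      and F: "finite F" "F \<subseteq> some_basis" and i: "i \<ge> N" for F N i \<epsilon>
  proof (rule tendsto_upperbound[OF _ _ sequentially_bot])
    show "(\<lambda>j. \<Sum>e\<in>F. (norm (op_of_hs (X i) e - op_of_hs (X j) e))\<^sup>2)
        \<longlonglongrightarrow> (\<Sum>e\<in>F. (norm (op_of_hs (X i) e - A e))\<^sup>2)"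
      by (intro tendsto_intros A)
    have "(\<Sum>e\<in>F. (norm (op_of_hs (X i) e - op_of_hs (X j) e))\<^sup>2) \<le> \<epsilon>\<^sup>2" if "j \<ge> N" for j
    proof -
      have "(\<Sum>e\<in>F. (norm (op_of_hs (X i - X j) e))\<^sup>2) \<le> (norm (X i - X j))\<^sup>2"
        by (rule finite_sum_le_has_sum[OF hs_norm_has_sum]) (use F in auto)
      also have "\<dots> \<le> \<epsilon>\<^sup>2" using N[OF i that] by (intro power_mono) auto
      finally show ?thesis by (simp add: minus_hs_op.rep_eq blinfun.diff_left)
    qed
    then show "\<forall>\<^sub>F j in sequentially. (\<Sum>e\<in>F. (norm (op_of_hs (X i) e - op_of_hs (X j) e))\<^sup>2) \<le> \<epsilon>\<^sup>2"
      by (auto simp: eventually_sequentially)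
  qed
  have hs: "hilbert_schmidt (op_of_hs (X i) - A)"
    if N: "\<And>i j. i \<ge> N \<Longrightarrow> j \<ge> N \<Longrightarrow> norm (X i - X j) < \<epsilon>" and i: "i \<ge> N" for i N \<epsilon>
    unfolding hilbert_schmidt_some_basis
    using bd[OF N _ _ i] by (intro nonneg_bdd_above_summable_on bdd_aboveI[of _ "\<epsilon>\<^sup>2"])
      (auto simp: blinfun.diff_left)
  obtain N1 where N1: "\<And>i j. i \<ge> N1 \<Longrightarrow> j \<ge> N1 \<Longrightarrow> norm (X i - X j) < 1"
    using CauchyD[OF X, of 1] by auto
  have "hilbert_schmidt (op_of_hs (X N1) + (- 1) *\<^sub>R (op_of_hs (X N1) - A))"
    by (intro hilbert_schmidt_add hilbert_schmidt_scaleR hs[OF N1]) auto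
  then have A_hs: "hilbert_schmidt A" by simp
  then obtain T where T: "op_of_hs T = A" using Abs_hs_op_inverse by blast
  have "X \<longlonglongrightarrow> T"
  proof (rule LIMSEQ_I)
    fix \<epsilon> :: real assume "\<epsilon> > 0"
    then obtain N where N: "\<And>i j. i \<ge> N \<Longrightarrow> j \<ge> N \<Longrightarrow> norm (X i - X j) < \<epsilon>/2"
      using CauchyD[OF X, of "\<epsilon>/2"] by auto
    have "norm (X i - T) < \<epsilon>" if "i \<ge> N" for i
    proof -
      have "(norm (X i - T))\<^sup>2 \<le> (\<epsilon>/2)\<^sup>2"
        by (rule has_sum_le_finite_sums[OF hs_norm_has_sum])
           (use bd[OF N _ _ that] T in \<open>auto simp: minus_hs_op.rep_eq blinfun.diff_left\<close>)
      then show ?thesis using \<open>\<epsilon> > 0\<close> by (smt (verit) power2_le_imp_le field_sum_of_halves)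
    qed
    then show "\<exists>N. \<forall>i\<ge>N. norm (X i - T) < \<epsilon>" by blast
  qed
  then show "convergent X" by (rule convergentI)
qed

text \<open>\<open>h \<otimes> h'\<close> is the operator \<open>x \<mapsto> \<langle>h', x\<rangle> h\<close>.\<close>

lemma bounded_linear_tensor: "bounded_linear (\<lambda>x. (h' \<bullet> x) *\<^sub>R h)"
  by (rule bounded_linear_compose[OF bounded_linear_scaleR_left bounded_linear_inner_right])

lift_definition tensor :: "'a::{real_inner,banach} \<Rightarrow> 'a \<Rightarrow> 'a hs_op" (infixr "\<otimes>" 75)
  is "\<lambda>h h'. Blinfun (\<lambda>x. (h' \<bullet> x) *\<^sub>R h)"
proof -
  fix h h' :: 'a
  have "(\<lambda>e. (norm h)\<^sup>2 * (h' \<bullet> e)\<^sup>2) summable_on some_basis"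
    by (intro summable_on_cmult_right bessel_summable orthonormal_some_basis)
  then show "Blinfun (\<lambda>x. (h' \<bullet> x) *\<^sub>R h) \<in> Collect hilbert_schmidt"
    by (simp add: hilbert_schmidt_some_basis bounded_linear_Blinfun_apply[OF bounded_linear_tensor]
        power_mult_distrib mult.commute)
qed

lemma tensor_apply: "op_of_hs (h \<otimes> h') x = (h' \<bullet> x) *\<^sub>R h"
  by (simp add: tensor.rep_eq bounded_linear_Blinfun_apply[OF bounded_linear_tensor])

definition tensor_square :: "'a::{real_inner,banach} \<Rightarrow> 'a hs_op" where
  "tensor_square h = h \<otimes> h"

text \<open>
  The Bochner integral for an arbitrary, possibly non-separable, normed space: the integral of the
  library is restricted to second-countable types. As in the textbook definition, the
  approximating simple functions converge almost everywhere, so that strong measurability (and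
  hence almost sure separability of the range) is part of integrability.
\<close>

definition has_bochner :: "'a measure \<Rightarrow> ('a \<Rightarrow> 'b::real_normed_vector) \<Rightarrow> 'b \<Rightarrow> bool" where
  "has_bochner M f I \<longleftrightarrow>
    (\<exists>s. (\<forall>i::nat. Bochner_Integration.simple_bochner_integrable M (s i)) \<and>
         (AE x in M. (\<lambda>i. s i x) \<longlonglongrightarrow> f x) \<and>
         (\<lambda>i. \<integral>\<^sup>+x. ennreal (norm (f x - s i x)) \<partial>M) \<longlonglongrightarrow> 0 \<and>
         (\<lambda>i. Bochner_Integration.simple_bochner_integral M (s i)) \<longlonglongrightarrow> I)"

definition bochner_integrable :: "'a measure \<Rightarrow> ('a \<Rightarrow> 'b::real_normed_vector) \<Rightarrow> bool" where
  "bochner_integrable M f \<longleftrightarrow> (\<exists>I. has_bochner M f I)"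

definition bochner_integral :: "'a measure \<Rightarrow> ('a \<Rightarrow> 'b::real_normed_vector) \<Rightarrow> 'b" where
  "bochner_integral M f = (if bochner_integrable M f then THE I. has_bochner M f I else 0)"

lemma has_bochner_unique:
  assumes "has_bochner M f I" "has_bochner M f J"
  shows "I = J"
proof -
  obtain s where s: "\<And>i. Bochner_Integration.simple_bochner_integrable M (s i)"
    and s_lim: "AE x in M. (\<lambda>i. s i x) \<longlonglongrightarrow> f x"
    and s_L1: "(\<lambda>i. \<integral>\<^sup>+x. ennreal (norm (f x - s i x)) \<partial>M) \<longlonglongrightarrow> 0"
    and s_I: "(\<lambda>i. Bochner_Integration.simple_bochner_integral M (s i)) \<longlonglongrightarrow> I"
    using assms(1) unfolding has_bochner_def by blast
  obtain t where t: "\<And>i. Bochner_Integration.simple_bochner_integrable M (t i)"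
    and t_lim: "AE x in M. (\<lambda>i. t i x) \<longlonglongrightarrow> f x"
    and t_L1: "(\<lambda>i. \<integral>\<^sup>+x. ennreal (norm (f x - t i x)) \<partial>M) \<longlonglongrightarrow> 0"
    and t_J: "(\<lambda>i. Bochner_Integration.simple_bochner_integral M (t i)) \<longlonglongrightarrow> J"
    using assms(2) unfolding has_bochner_def by blast
  have norm_sf: "simple_function M (\<lambda>x. norm (u x - v x))"
    if "Bochner_Integration.simple_bochner_integrable M u" "Bochner_Integration.simple_bochner_integrable M v" for u v :: "'a \<Rightarrow> 'b"
    using that by (auto elim!: Bochner_Integration.simple_bochner_integrable.cases intro: simple_function_compose2)
  have norm_meas: "(\<lambda>x. norm (u x - v x)) \<in> borel_measurable M"
    if "Bochner_Integration.simple_bochner_integrable M u" "Bochner_Integration.simple_bochner_integrable M v" for u v :: "'a \<Rightarrow> 'b"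
    using norm_sf[OF that] by (rule borel_measurable_simple_function)
  have approx: "\<exists>g\<in>borel_measurable M. AE x in M. ennreal (norm (f x - u x)) = g x"
    if u: "Bochner_Integration.simple_bochner_integrable M u" for u
  proof (intro bexI)
    show "(\<lambda>x. liminf (\<lambda>j. ennreal (norm (s j x - u x)))) \<in> borel_measurable M"
      by (intro borel_measurable_liminf measurable_compose[OF norm_meas[OF s u]] measurable_ennreal)
    show "AE x in M. ennreal (norm (f x - u x)) = liminf (\<lambda>j. ennreal (norm (s j x - u x)))"
      using s_lim
    proof eventually_elim
      case (elim x)
      have "(\<lambda>j. ennreal (norm (s j x - u x))) \<longlonglongrightarrow> ennreal (norm (f x - u x))"
        by (intro tendsto_intros elim)
      then show ?case by (rule lim_imp_Liminf[OF sequentially_bot, symmetric])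
    qed
  qed
  have bound: "ennreal (norm (Bochner_Integration.simple_bochner_integral M (s i) - Bochner_Integration.simple_bochner_integral M (t i)))
      \<le> (\<integral>\<^sup>+x. ennreal (norm (f x - s i x)) \<partial>M) + (\<integral>\<^sup>+x. ennreal (norm (f x - t i x)) \<partial>M)" for i
  proof -
    have d: "Bochner_Integration.simple_bochner_integrable M (\<lambda>x. s i x - t i x)"
      by (rule simple_bochner_integrable_compose2[where p = "(-)", OF _ s t]) simp
    obtain g where g: "g \<in> borel_measurable M" "AE x in M. ennreal (norm (f x - s i x)) = g x"
      using approx[OF s] by blast
    obtain h where h: "h \<in> borel_measurable M" "AE x in M. ennreal (norm (f x - t i x)) = h x"
      using approx[OF t] by blast
    have "ennreal (norm (Bochner_Integration.simple_bochner_integral M (s i) - Bochner_Integration.simple_bochner_integral M (t i)))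
        = ennreal (norm (Bochner_Integration.simple_bochner_integral M (\<lambda>x. s i x - t i x)))"
      by (simp add: simple_bochner_integral_diff s t)
    also have "\<dots> \<le> ennreal (Bochner_Integration.simple_bochner_integral M (\<lambda>x. norm (s i x - t i x)))"
      by (intro ennreal_leI simple_bochner_integral_norm_bound d)
    also have "\<dots> = (\<integral>\<^sup>+x. ennreal (norm (s i x - t i x)) \<partial>M)"
      by (rule simple_bochner_integral_eq_nn_integral
          [OF simple_bochner_integrable_compose2[where p = "\<lambda>x y. norm (x - y)", OF _ s t]]) auto
    also have "\<dots> \<le> (\<integral>\<^sup>+x. g x + h x \<partial>M)"
    proof (rule nn_integral_mono_AE)
      show "AE x in M. ennreal (norm (s i x - t i x)) \<le> g x + h x"
        using g(2) h(2)
      proof eventually_elim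
        case (elim x)
        have "norm (s i x - t i x) \<le> norm (f x - s i x) + norm (f x - t i x)"
          using norm_triangle_ineq4[of "f x - t i x" "f x - s i x"] by simp
        then have "ennreal (norm (s i x - t i x)) \<le> ennreal (norm (f x - s i x)) + ennreal (norm (f x - t i x))"
          by (simp add: ennreal_plus[symmetric] del: ennreal_plus)
        then show ?case using elim by simp
      qed
    qed
    also have "\<dots> = (\<integral>\<^sup>+x. g x \<partial>M) + (\<integral>\<^sup>+x. h x \<partial>M)"
      by (rule nn_integral_add) (use g h in auto)
    also have "\<dots> = (\<integral>\<^sup>+x. ennreal (norm (f x - s i x)) \<partial>M) + (\<integral>\<^sup>+x. ennreal (norm (f x - t i x)) \<partial>M)"
      using nn_integral_cong_AE[OF g(2)] nn_integral_cong_AE[OF h(2)] by simp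
    finally show ?thesis .
  qed
  have "(\<lambda>i. ennreal (norm (Bochner_Integration.simple_bochner_integral M (s i) - Bochner_Integration.simple_bochner_integral M (t i)))) \<longlonglongrightarrow> 0"
    by (rule tendsto_sandwich[OF _ _ tendsto_const])
       (use bound tendsto_add[OF s_L1 t_L1] in auto)
  moreover have "(\<lambda>i. ennreal (norm (Bochner_Integration.simple_bochner_integral M (s i) - Bochner_Integration.simple_bochner_integral M (t i))))
      \<longlonglongrightarrow> ennreal (norm (I - J))"
    by (intro tendsto_intros s_I t_J)
  ultimately have "ennreal (norm (I - J)) = 0" using LIMSEQ_unique by blast
  then show ?thesis by simp
qed

lemma bochner_integral_eqI: "has_bochner M f I \<Longrightarrow> bochner_integral M f = I"
  unfolding bochner_integral_def bochner_integrable_def using has_bochner_unique by (metis the_equality)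

lemma has_bochner_lebesgue_integral:
  fixes f :: "'a \<Rightarrow> 'b::{banach, second_countable_topology}"
  assumes f: "integrable M f"
  shows "has_bochner M f (integral\<^sup>L M f)"
proof -
  obtain s where s: "\<And>i::nat. simple_function M (s i)"
    and lim: "\<And>x. x \<in> space M \<Longrightarrow> (\<lambda>i. s i x) \<longlonglongrightarrow> f x"
    and bd: "\<And>i x. x \<in> space M \<Longrightarrow> norm (s i x) \<le> 2 * norm (f x)"
    using borel_measurable_implies_sequence_metric[OF borel_measurable_integrable[OF f], of 0]
    by (simp add: dist_norm) metis
  have m [measurable]: "s i \<in> borel_measurable M" for i
    using s by (rule borel_measurable_simple_function)
  have fm [measurable]: "f \<in> borel_measurable M" using f by simp
  have i2: "integrable M (\<lambda>x. 2 * norm (f x))" using f by simp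
  have fin: "(\<integral>\<^sup>+x. ennreal (2 * norm (f x)) \<partial>M) < \<infinity>"
    using i2 unfolding integrable_iff_bounded by simp
  have int: "integrable M (s i)" for i
    by (rule Bochner_Integration.integrable_bound[OF i2]) (use bd in auto)
  have sb: "Bochner_Integration.simple_bochner_integrable M (s i)" for i
    using s int by (intro simple_bochner_integrableI_bounded) (auto simp: integrable_iff_bounded)
  show ?thesis unfolding has_bochner_def
  proof (intro exI[of _ s] conjI allI sb)
    show "AE x in M. (\<lambda>i. s i x) \<longlonglongrightarrow> f x" using lim by auto
    show "(\<lambda>i. \<integral>\<^sup>+x. ennreal (norm (f x - s i x)) \<partial>M) \<longlonglongrightarrow> 0"
      by (rule nn_integral_dominated_convergence_norm[where w = "\<lambda>x. 2 * norm (f x)"])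
        (use lim bd fin in auto)
    have "(\<lambda>i. integral\<^sup>L M (s i)) \<longlonglongrightarrow> integral\<^sup>L M f"
      by (rule integral_dominated_convergence[where w = "\<lambda>x. 2 * norm (f x)"]) (use lim bd i2 in auto)
    then show "(\<lambda>i. Bochner_Integration.simple_bochner_integral M (s i)) \<longlonglongrightarrow> integral\<^sup>L M f"
      by (simp add: simple_bochner_integrable_eq_integral sb)
  qed
qed

definition positive_definite_kernel :: "('h \<Rightarrow> 'h \<Rightarrow> real) \<Rightarrow> bool" where
  "positive_definite_kernel k \<longleftrightarrow>
    (\<forall>x y. k x y = k y x) \<and>
    (\<forall>F c. finite F \<longrightarrow> 0 \<le> (\<Sum>x\<in>F. \<Sum>y\<in>F. c x * c y * k x y))"

text \<open>
  A reproducing kernel Hilbert space is a Hilbert space of functions; its elements are given by a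
  Hilbert space type \<open>'f\<close> together with the linear embedding \<open>emb\<close> that sends an element to the
  function it stands for. \<open>kernel_section k emb x\<close> is the element \<open>k(\<cdot>, x)\<close>.
\<close>

definition kernel_section :: "('h \<Rightarrow> 'h \<Rightarrow> real) \<Rightarrow> ('f \<Rightarrow> 'h \<Rightarrow> real) \<Rightarrow> 'h \<Rightarrow> 'f" where
  "kernel_section k emb x = (THE f. emb f = (\<lambda>y. k y x))"

definition rkhs :: "('h \<Rightarrow> 'h \<Rightarrow> real) \<Rightarrow> ('f::{real_inner,banach} \<Rightarrow> 'h \<Rightarrow> real) \<Rightarrow> bool" where
  "rkhs k emb \<longleftrightarrow>
    (\<forall>x. linear (\<lambda>f. emb f x)) \<and> inj emb \<and>
    (\<forall>x. (\<lambda>y. k y x) \<in> range emb) \<and>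
    (\<forall>f x. emb f x = f \<bullet> kernel_section k emb x)"

definition mean_embedding ::
  "('h \<Rightarrow> 'h \<Rightarrow> real) \<Rightarrow> ('f::{real_inner,banach} \<Rightarrow> 'h \<Rightarrow> real) \<Rightarrow> 'h measure \<Rightarrow> 'f" where
  "mean_embedding k emb P = bochner_integral P (kernel_section k emb)"

definition covariance_embedding ::
  "('h \<Rightarrow> 'h \<Rightarrow> real) \<Rightarrow> ('f::{real_inner,banach} \<Rightarrow> 'h \<Rightarrow> real) \<Rightarrow> 'h measure \<Rightarrow> 'f hs_op" where
  "covariance_embedding k emb P =
    bochner_integral P (\<lambda>x. tensor_square (kernel_section k emb x - mean_embedding k emb P))"

definition covariance_operator ::
  "('h \<Rightarrow> 'h \<Rightarrow> real) \<Rightarrow> ('f::{real_inner,banach} \<Rightarrow> 'h \<Rightarrow> real) \<Rightarrow> 'h measure \<Rightarrow> 'f hs_op hs_op" where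
  "covariance_operator k emb P =
    bochner_integral P (\<lambda>x. tensor_square
      (tensor_square (kernel_section k emb x - mean_embedding k emb P) - covariance_embedding k emb P))"

text \<open>The mean embedding is injective on the distributions on \<open>\<A>\<close> for which it is defined.\<close>

definition characteristic ::
  "'h set set \<Rightarrow> ('h \<Rightarrow> 'h \<Rightarrow> real) \<Rightarrow> ('f::{real_inner,banach} \<Rightarrow> 'h \<Rightarrow> real) \<Rightarrow> bool" where
  "characteristic \<A> k emb \<longleftrightarrow>
    (\<forall>P Q. prob_space P \<and> sets P = \<A> \<and> bochner_integrable P (kernel_section k emb) \<and>
           prob_space Q \<and> sets Q = \<A> \<and> bochner_integrable Q (kernel_section k emb) \<and>
           mean_embedding k emb P = mean_embedding k emb Q \<longrightarrow> P = Q)"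

definition empirical_mean ::
  "('h \<Rightarrow> 'h \<Rightarrow> real) \<Rightarrow> ('f::{real_inner,banach} \<Rightarrow> 'h \<Rightarrow> real) \<Rightarrow> nat \<Rightarrow> (nat \<Rightarrow> 'h) \<Rightarrow> 'f" where
  "empirical_mean k emb n x = (1 / real n) *\<^sub>R (\<Sum>i<n. kernel_section k emb (x i))"

definition empirical_covariance ::
  "('h \<Rightarrow> 'h \<Rightarrow> real) \<Rightarrow> ('f::{real_inner,banach} \<Rightarrow> 'h \<Rightarrow> real) \<Rightarrow> nat \<Rightarrow> (nat \<Rightarrow> 'h) \<Rightarrow> 'f hs_op" where
  "empirical_covariance k emb n x =
    (1 / real n) *\<^sub>R (\<Sum>i<n. tensor_square (kernel_section k emb (x i) - empirical_mean k emb n x))"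

definition test_statistic ::
  "('h \<Rightarrow> 'h \<Rightarrow> real) \<Rightarrow> ('f::{real_inner,banach} \<Rightarrow> 'h \<Rightarrow> real) \<Rightarrow>
    nat \<Rightarrow> nat \<Rightarrow> (nat \<Rightarrow> 'h) \<Rightarrow> (nat \<Rightarrow> 'h) \<Rightarrow> real" where
  "test_statistic k emb n m x y =
    (norm (empirical_covariance k emb n x - empirical_covariance k emb m y))\<^sup>2"

definition eigenspace :: "'a::{real_inner,banach} hs_op \<Rightarrow> real \<Rightarrow> 'a set" where
  "eigenspace T c = {x. op_of_hs T x = c *\<^sub>R x}"

text \<open>
  Every nonzero \<open>c\<close> occurs in the sequence exactly as often as the dimension of its eigenspace
  (zero times if \<open>c\<close> is not an eigenvalue). The value \<open>0\<close> may occur any number of times, since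
  the nonzero eigenvalues may be finite in number.
\<close>

definition eigenvalue_sequence :: "'a::{real_inner,banach} hs_op \<Rightarrow> (nat \<Rightarrow> real) \<Rightarrow> bool" where
  "eigenvalue_sequence T lam \<longleftrightarrow>
    (\<forall>c. c \<noteq> 0 \<longrightarrow> finite {l. lam l = c} \<and>
      (\<exists>B. finite B \<and> independent B \<and> span B = eigenspace T c \<and> card B = card {l. lam l = c}))"

end

theory Submission
  imports Defs
begin

text \<open>
  Write \<open>\<phi> = k(\<cdot>, X) - \<mu>\<close> for the centred feature and \<open>W = \<phi> \<otimes> \<phi> - \<Sigma>\<close> for the fluctuation of its tensor
  square, a centred random element of the space of Hilbert--Schmidt operators with covariance
  operator \<open>V\<close>. Centring at the empirical means changes a sample covariance only by the tensor square
  of the mean error, which has norm of order \<open>1 / n\<close> (\<open>empirical_covariance_centred\<close>,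
  \<open>mean_tensor_square_L1\<close>). For \<open>P = Q\<close> the two copies of \<open>\<Sigma>\<close> cancel, and up to a negligible term
  the statistic is \<open>\<parallel>G\<parallel>\<^sup>2\<close>, where \<open>G\<close> is one weighted sum of independent copies of \<open>W\<close> over both samples.
  The squares of the weights add up to \<open>(n + m) / n + (n + m) / m\<close>, which tends to
  \<open>1 / \<rho> + 1 / (1 - \<rho>) = 1 / (\<rho> (1 - \<rho>))\<close>.

  Nonnegative random variables converge in distribution as soon as their Laplace transforms
  converge at the integers (\<open>weak_conv_if_laplace_conv\<close>). The Laplace transform of \<open>\<parallel>G\<parallel>\<^sup>2\<close> is computed
  in the eigenbasis of \<open>V\<close> (\<open>laplace_norm_weighted_iid_sum_tendsto\<close>). For finitely many coordinates
  \<open>g\<close>, the identity \<open>exp (- \<parallel>g\<parallel>\<^sup>2 / 2) = E exp (\<i> \<langle>g, Z\<rangle>)\<close> with a standard Gaussian \<open>Z\<close> reduces everything to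
  characteristic functions of real weighted sums (\<open>laplace_quadratic_tendsto\<close>), which obey a
  one-dimensional central limit theorem (\<open>char_weighted_iid_sum_tendsto\<close>). The remaining coordinates are negligible uniformly in the sample sizes, since \<open>E \<parallel>W\<parallel>\<^sup>2\<close> is the sum of the
  eigenvalues (\<open>covariance_eigenexpansion\<close>).

  That last fact is where the eigenvalue sequence is tied to the law of \<open>W\<close>. The positive compact
  operator \<open>V\<close> has an eigenvector in every closed invariant subspace on which its quadratic form does
  not vanish (\<open>positive_hs_op_eigenvector\<close>); hence \<open>W\<close> has variance \<open>0\<close> in each direction orthogonal to the
  eigenvectors. Since \<open>W\<close> takes its values in a separable subspace, countably many directions
  determine its component there, which therefore vanishes almost surely.
\<close>

section \<open>Strong measurability and Bochner integrals\<close>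

text \<open>
  In a space that need not be separable, Borel measurability is not stable under addition, while
  pointwise limits of simple functions are stable under all continuous operations.
\<close>

definition strongly_measurable :: "'a measure \<Rightarrow> ('a \<Rightarrow> 'b::topological_space) \<Rightarrow> bool" where
  "strongly_measurable M f \<longleftrightarrow>
    (\<exists>s. (\<forall>i::nat. simple_function M (s i)) \<and> (\<forall>x\<in>space M. (\<lambda>i. s i x) \<longlonglongrightarrow> f x))"

lemma strongly_measurable_simple: "simple_function M f \<Longrightarrow> strongly_measurable M f"
  unfolding strongly_measurable_def by (intro exI[of _ "\<lambda>_. f"]) auto

lemma strongly_measurable_const: "strongly_measurable M (\<lambda>_. c)"
  by (rule strongly_measurable_simple) simp

lemma strongly_measurable_continuous:
  assumes f: "strongly_measurable M f" and h: "continuous_on UNIV h"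
  shows "strongly_measurable M (\<lambda>x. h (f x))"
proof -
  obtain s where s: "\<And>i::nat. simple_function M (s i)" "\<And>x. x \<in> space M \<Longrightarrow> (\<lambda>i. s i x) \<longlonglongrightarrow> f x"
    using f unfolding strongly_measurable_def by blast
  have "(\<lambda>i. h (s i x)) \<longlonglongrightarrow> h (f x)" if "x \<in> space M" for x
    by (rule continuous_on_tendsto_compose[OF h s(2)[OF that]]) auto
  then show ?thesis unfolding strongly_measurable_def
    using simple_function_compose1[OF s(1)] by (intro exI[of _ "\<lambda>i x. h (s i x)"]) auto
qed

lemma strongly_measurable_Pair:
  assumes f: "strongly_measurable M f" and g: "strongly_measurable M g"
  shows "strongly_measurable M (\<lambda>x. (f x, g x))"
proof -
  obtain s where s: "\<And>i::nat. simple_function M (s i)" "\<And>x. x \<in> space M \<Longrightarrow> (\<lambda>i. s i x) \<longlonglongrightarrow> f x"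
    using f unfolding strongly_measurable_def by blast
  obtain t where t: "\<And>i::nat. simple_function M (t i)" "\<And>x. x \<in> space M \<Longrightarrow> (\<lambda>i. t i x) \<longlonglongrightarrow> g x"
    using g unfolding strongly_measurable_def by blast
  show ?thesis unfolding strongly_measurable_def
    using s t by (intro exI[of _ "\<lambda>i x. (s i x, t i x)"]) (auto intro: tendsto_Pair)
qed

lemma strongly_measurable_continuous2:
  assumes "strongly_measurable M f" "strongly_measurable M g"
    and "continuous_on UNIV (\<lambda>p. h (fst p) (snd p))"
  shows "strongly_measurable M (\<lambda>x. h (f x) (g x))"
  using strongly_measurable_continuous[OF strongly_measurable_Pair[OF assms(1,2)] assms(3)] by simp

lemma strongly_measurable_add:
  fixes f g :: "'a \<Rightarrow> 'b::real_normed_vector"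
  shows "strongly_measurable M f \<Longrightarrow> strongly_measurable M g \<Longrightarrow> strongly_measurable M (\<lambda>x. f x + g x)"
  by (erule (1) strongly_measurable_continuous2) (intro continuous_intros)

lemma strongly_measurable_diff:
  fixes f g :: "'a \<Rightarrow> 'b::real_normed_vector"
  shows "strongly_measurable M f \<Longrightarrow> strongly_measurable M g \<Longrightarrow> strongly_measurable M (\<lambda>x. f x - g x)"
  by (erule (1) strongly_measurable_continuous2) (intro continuous_intros)

lemma strongly_measurable_scaleR:
  fixes f :: "'a \<Rightarrow> 'b::real_normed_vector"
  shows "strongly_measurable M f \<Longrightarrow> strongly_measurable M (\<lambda>x. c *\<^sub>R f x)"
  by (erule strongly_measurable_continuous) (intro continuous_intros)

lemma strongly_measurable_sum:
  fixes f :: "'i \<Rightarrow> 'a \<Rightarrow> 'b::real_normed_vector"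
  assumes "\<And>i. strongly_measurable M (f i)"
  shows "strongly_measurable M (\<lambda>x. \<Sum>i\<in>I. f i x)"
proof (induction I rule: infinite_finite_induct)
  case (insert i I)
  then show ?case using strongly_measurable_add[OF assms[of i] insert.IH] by simp
qed (simp_all add: strongly_measurable_const)

lemma strongly_measurable_comp:
  assumes f: "strongly_measurable N f" and T: "T \<in> M \<rightarrow>\<^sub>M N"
  shows "strongly_measurable M (\<lambda>x. f (T x))"
proof -
  obtain s where s: "\<And>i::nat. simple_function N (s i)" "\<And>x. x \<in> space N \<Longrightarrow> (\<lambda>i. s i x) \<longlonglongrightarrow> f x"
    using f unfolding strongly_measurable_def by blast
  have "simple_function M (\<lambda>x. s i (T x))" for i
    using simple_function_comp[OF T s(1)] by (simp add: comp_def)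
  then show ?thesis unfolding strongly_measurable_def
    using s(2) measurable_space[OF T] by (intro exI[of _ "\<lambda>i x. s i (T x)"]) auto
qed

lemma strongly_measurable_real:
  fixes f :: "'a \<Rightarrow> real"
  assumes "strongly_measurable M f"
  shows "f \<in> borel_measurable M"
proof -
  obtain s where s: "\<And>i::nat. simple_function M (s i)" "\<And>x. x \<in> space M \<Longrightarrow> (\<lambda>i. s i x) \<longlonglongrightarrow> f x"
    using assms unfolding strongly_measurable_def by blast
  show ?thesis
    by (rule borel_measurable_LIMSEQ_real[OF s(2)]) (auto intro: borel_measurable_simple_function s(1))
qed

lemma measurable_norm_strongly:
  fixes f :: "'a \<Rightarrow> 'b::real_normed_vector"
  shows "strongly_measurable M f \<Longrightarrow> (\<lambda>x. norm (f x)) \<in> borel_measurable M"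
  by (rule strongly_measurable_real, erule strongly_measurable_continuous) (intro continuous_intros)

lemma measurable_inner_strongly:
  fixes f g :: "'a \<Rightarrow> 'b::real_inner"
  shows "strongly_measurable M f \<Longrightarrow> strongly_measurable M g \<Longrightarrow> (\<lambda>x. f x \<bullet> g x) \<in> borel_measurable M"
  by (rule strongly_measurable_real, erule (1) strongly_measurable_continuous2) (intro continuous_intros)

lemma strongly_measurable_finite_range_approx:
  fixes f :: "'a \<Rightarrow> 'b::topological_space"
  assumes "strongly_measurable M f"
  obtains s where "\<And>i::nat. finite (s i ` space M)" "\<And>x. x \<in> space M \<Longrightarrow> (\<lambda>i. s i x) \<longlonglongrightarrow> f x"
  using assms unfolding strongly_measurable_def simple_function_def by blast

lemma has_bochner_cong_AE:
  assumes fg: "AE x in M. f x = g x" and f: "has_bochner M f I"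
  shows "has_bochner M g I"
proof -
  obtain s where s: "\<And>i::nat. Bochner_Integration.simple_bochner_integrable M (s i)"
    "AE x in M. (\<lambda>i. s i x) \<longlonglongrightarrow> f x"
    "(\<lambda>i. \<integral>\<^sup>+x. ennreal (norm (f x - s i x)) \<partial>M) \<longlonglongrightarrow> 0"
    "(\<lambda>i. Bochner_Integration.simple_bochner_integral M (s i)) \<longlonglongrightarrow> I"
    using f unfolding has_bochner_def by blast
  have "AE x in M. (\<lambda>i. s i x) \<longlonglongrightarrow> g x" using s(2) fg by eventually_elim simp
  moreover have "(\<integral>\<^sup>+x. ennreal (norm (f x - s i x)) \<partial>M) = (\<integral>\<^sup>+x. ennreal (norm (g x - s i x)) \<partial>M)" for i
    by (rule nn_integral_cong_AE) (use fg in eventually_elim, simp)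
  ultimately show ?thesis unfolding has_bochner_def using s by (intro exI[of _ s]) simp
qed

lemma bochner_integral_cong_AE:
  assumes "AE x in M. f x = g x"
  shows "bochner_integral M f = bochner_integral M g"
proof -
  have "AE x in M. g x = f x" using assms by eventually_elim simp
  then have "has_bochner M f I \<longleftrightarrow> has_bochner M g I" for I
    using has_bochner_cong_AE[OF assms] has_bochner_cong_AE by blast
  then have "has_bochner M f = has_bochner M g" by blast
  then show ?thesis by (simp add: bochner_integral_def bochner_integrable_def)
qed

text \<open>
  Changing a Bochner integrable function on a null set makes it a limit of simple functions
  everywhere, so that its compositions with continuous functions are measurable and not merely
  almost everywhere equal to measurable functions.
\<close>

lemma bochner_integrable_strongly_measurable_version:
  fixes f :: "'a \<Rightarrow> 'b::real_normed_vector"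
  assumes "bochner_integrable M f"
  obtains E where "E \<in> sets M" "AE x in M. x \<in> E" "strongly_measurable M (\<lambda>x. indicator E x *\<^sub>R f x)"
proof -
  obtain s where s: "\<And>i::nat. Bochner_Integration.simple_bochner_integrable M (s i)"
    and lim: "AE x in M. (\<lambda>i. s i x) \<longlonglongrightarrow> f x"
    using assms unfolding bochner_integrable_def has_bochner_def by blast
  obtain N where bad: "{x \<in> space M. \<not> (\<lambda>i. s i x) \<longlonglongrightarrow> f x} \<subseteq> N" and N: "N \<in> null_sets M"
    using AE_E[OF lim] by (metis null_setsI)
  define E where "E = space M - N"
  have E: "E \<in> sets M" using N by (auto simp: E_def)
  have sf: "simple_function M (s i)" for i using s[of i] by (auto elim: Bochner_Integration.simple_bochner_integrable.cases)
  have "simple_function M (\<lambda>x. indicator E x *\<^sub>R s i x)" for i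
    by (rule simple_function_compose2[OF simple_function_indicator[OF E] sf])
  moreover have "(\<lambda>i. indicator E x *\<^sub>R s i x) \<longlonglongrightarrow> indicator E x *\<^sub>R f x" if "x \<in> space M" for x
    using bad that by (auto simp: E_def indicator_def)
  ultimately have "strongly_measurable M (\<lambda>x. indicator E x *\<^sub>R f x)"
    unfolding strongly_measurable_def by (intro exI[of _ "\<lambda>i x. indicator E x *\<^sub>R s i x"]) auto
  moreover have "AE x in M. x \<in> E"
    using AE_not_in[OF N] AE_space by eventually_elim (simp add: E_def)
  ultimately show thesis using that E by blast
qed

text \<open>
  The simple approximations converge in \<open>L\<^sup>1\<close> by dominated convergence of the real functions
  \<open>\<parallel>f - s\<^sub>i\<parallel>\<close>; completeness of the range then supplies the limit of their integrals.
\<close>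

lemma has_bochner_if_strongly_measurable:
  fixes f :: "'a \<Rightarrow> 'b::banach"
  assumes M: "prob_space M" and f: "strongly_measurable M f" and int: "integrable M (\<lambda>x. norm (f x))"
  shows "has_bochner M f (bochner_integral M f)"
proof -
  interpret prob_space M by fact
  obtain s where s: "\<And>i::nat. simple_function M (s i)" and lim: "\<And>x. x \<in> space M \<Longrightarrow> (\<lambda>i. s i x) \<longlonglongrightarrow> f x"
    using f unfolding strongly_measurable_def by blast
  have [measurable]: "(\<lambda>x. norm (f x)) \<in> borel_measurable M" by (rule measurable_norm_strongly[OF f])
  have [measurable]: "(\<lambda>x. norm (s i x)) \<in> borel_measurable M" for i
    by (intro measurable_norm_strongly strongly_measurable_simple s)
  \<comment> \<open>Truncation makes the approximating simple functions dominated by \<open>f\<close>.\<close>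
  define E where "E i = {x \<in> space M. norm (s i x) \<le> 2 * norm (f x)}" for i
  define t where "t i x = indicator (E i) x *\<^sub>R s i x" for i x
  have t: "simple_function M (t i)" for i unfolding t_def E_def
    by (rule simple_function_compose2[OF simple_function_indicator s]) measurable
  have tb: "norm (t i x) \<le> 2 * norm (f x)" for i x
    by (auto simp: t_def E_def indicator_def)
  have tlim: "(\<lambda>i. t i x) \<longlonglongrightarrow> f x" if x: "x \<in> space M" for x
  proof (cases "f x = 0")
    case True
    then have "t i x = 0" for i using tb[of i x] by simp
    then show ?thesis using True by simp
  next
    case False
    have "\<forall>\<^sub>F i in sequentially. norm (s i x) < 2 * norm (f x)"
      using False by (intro order_tendstoD(2)[OF tendsto_norm[OF lim[OF x]]]) simp
    then have "\<forall>\<^sub>F i in sequentially. s i x = t i x"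
      by eventually_elim (use x in \<open>auto simp: t_def E_def indicator_def\<close>)
    from Lim_transform_eventually[OF lim[OF x] this] show ?thesis .
  qed
  have sb: "Bochner_Integration.simple_bochner_integrable M (t i)" for i
    using t by (intro Bochner_Integration.simple_bochner_integrable.intros) auto
  have dm [measurable]: "(\<lambda>x. norm (f x - t i x)) \<in> borel_measurable M" for i
    by (intro measurable_norm_strongly strongly_measurable_diff f strongly_measurable_simple t)
  have db: "norm (f x - t i x) \<le> 3 * norm (f x)" for i x
    using norm_triangle_ineq4[of "f x" "t i x"] tb[of i x] by simp
  have di: "integrable M (\<lambda>x. norm (f x - t i x))" for i
    by (rule Bochner_Integration.integrable_bound[where f = "\<lambda>x. 3 * norm (f x)"]) (use int db in auto)
  have "(\<lambda>i. \<integral>x. norm (f x - t i x) \<partial>M) \<longlonglongrightarrow> (\<integral>x. 0 \<partial>M)"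
  proof (rule integral_dominated_convergence[where w = "\<lambda>x. 3 * norm (f x)"])
    show "AE x in M. (\<lambda>i. norm (f x - t i x)) \<longlonglongrightarrow> 0"
    proof (rule AE_I2)
      fix x assume "x \<in> space M"
      then have "(\<lambda>i. norm (f x - t i x)) \<longlonglongrightarrow> norm (f x - f x)" by (intro tendsto_intros tlim)
      then show "(\<lambda>i. norm (f x - t i x)) \<longlonglongrightarrow> 0" by simp
    qed
  qed (use int db in auto)
  then have d0: "(\<lambda>i. \<integral>x. norm (f x - t i x) \<partial>M) \<longlonglongrightarrow> 0" by simp
  let ?J = "\<lambda>i. Bochner_Integration.simple_bochner_integral M (t i)"
  have J: "norm (?J i - ?J j) \<le> (\<integral>x. norm (f x - t i x) \<partial>M) + (\<integral>x. norm (f x - t j x) \<partial>M)" for i j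
  proof -
    have "norm (?J i - ?J j) = norm (Bochner_Integration.simple_bochner_integral M (\<lambda>x. t i x - t j x))"
      by (simp add: simple_bochner_integral_diff sb)
    also have "\<dots> \<le> Bochner_Integration.simple_bochner_integral M (\<lambda>x. norm (t i x - t j x))"
      by (intro simple_bochner_integral_norm_bound simple_bochner_integrable_compose2[where p = "(-)", OF _ sb sb]) simp
    also have "\<dots> = (\<integral>x. norm (t i x - t j x) \<partial>M)"
      by (intro simple_bochner_integrable_eq_integral
          simple_bochner_integrable_compose2[where p = "\<lambda>x y. norm (x - y)", OF _ sb sb]) simp
    also have "\<dots> \<le> (\<integral>x. norm (f x - t i x) + norm (f x - t j x) \<partial>M)"
    proof (rule integral_mono)
      show "integrable M (\<lambda>x. norm (t i x - t j x))"
        by (rule integrable.intros[OF has_bochner_integral_simple_bochner_integrable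
              [OF simple_bochner_integrable_compose2[where p = "\<lambda>x y. norm (x - y)", OF _ sb sb]]]) simp
      show "norm (t i x - t j x) \<le> norm (f x - t i x) + norm (f x - t j x)" for x
        using norm_triangle_ineq4[of "f x - t j x" "f x - t i x"] by simp
    qed (use di in auto)
    also have "\<dots> = (\<integral>x. norm (f x - t i x) \<partial>M) + (\<integral>x. norm (f x - t j x) \<partial>M)" using di by simp
    finally show ?thesis .
  qed
  have "Cauchy ?J"
  proof (rule CauchyI)
    fix e :: real assume "e > 0"
    from LIMSEQ_D[OF d0, of "e / 2"] this obtain N where
      N: "\<And>i. i \<ge> N \<Longrightarrow> (\<integral>x. norm (f x - t i x) \<partial>M) < e / 2" by fastforce
    have "norm (?J i - ?J j) < e" if "i \<ge> N" "j \<ge> N" for i j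
      using J[of i j] N[OF that(1)] N[OF that(2)] by linarith
    then show "\<exists>N. \<forall>i\<ge>N. \<forall>j\<ge>N. norm (?J i - ?J j) < e" by blast
  qed
  then obtain I where I: "?J \<longlonglongrightarrow> I" using Cauchy_convergent convergent_def by blast
  have "(\<lambda>i. ennreal (\<integral>x. norm (f x - t i x) \<partial>M)) \<longlonglongrightarrow> ennreal 0"
    by (rule tendsto_ennrealI[OF d0])
  then have "(\<lambda>i. \<integral>\<^sup>+x. ennreal (norm (f x - t i x)) \<partial>M) \<longlonglongrightarrow> 0"
    using di by (simp add: nn_integral_eq_integral)
  then have "has_bochner M f I" unfolding has_bochner_def
    using sb I tlim by (intro exI[of _ t] conjI allI AE_I2) auto
  then show ?thesis using bochner_integral_eqI by metis
qed

text \<open>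
  Bochner integrals are used only through bounded functionals, which turn every statement about
  Hilbert space valued moments into one about Lebesgue integrals of real functions.
\<close>

lemma has_bochner_functional:
  fixes f :: "'a \<Rightarrow> 'b::real_normed_vector" and \<Lambda> :: "'b \<Rightarrow> real"
  assumes f: "strongly_measurable M f" and I: "has_bochner M f I" and \<Lambda>: "bounded_linear \<Lambda>"
  shows "integrable M (\<lambda>x. \<Lambda> (f x))" and "(\<integral>x. \<Lambda> (f x) \<partial>M) = \<Lambda> I"
proof -
  obtain s where s: "\<And>i::nat. Bochner_Integration.simple_bochner_integrable M (s i)"
    "(\<lambda>i. \<integral>\<^sup>+x. ennreal (norm (f x - s i x)) \<partial>M) \<longlonglongrightarrow> 0"
    "(\<lambda>i. Bochner_Integration.simple_bochner_integral M (s i)) \<longlonglongrightarrow> I"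
    using I unfolding has_bochner_def by blast
  have sf: "simple_function M (s i)" for i using s(1)[of i] by (auto elim: Bochner_Integration.simple_bochner_integrable.cases)
  interpret \<Lambda>: bounded_linear \<Lambda> by fact
  obtain K where K: "K \<ge> 0" "\<And>x. norm (\<Lambda> x) \<le> norm x * K" using \<Lambda>.nonneg_bounded by blast
  have "has_bochner_integral M (\<lambda>x. \<Lambda> (f x)) (\<Lambda> I)"
  proof (rule has_bochner_integral.intros[where s = "\<lambda>i x. \<Lambda> (s i x)"])
    show "(\<lambda>x. \<Lambda> (f x)) \<in> borel_measurable M"
      by (intro strongly_measurable_real strongly_measurable_continuous[OF f] \<Lambda>.continuous_on continuous_intros)
    show "Bochner_Integration.simple_bochner_integrable M (\<lambda>x. \<Lambda> (s i x))" for i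
      using simple_bochner_integrable_compose2[where p = "\<lambda>x y. \<Lambda> x", OF _ s(1) s(1)] by (simp add: \<Lambda>.zero)
    show "(\<lambda>i. Bochner_Integration.simple_bochner_integral M (\<lambda>x. \<Lambda> (s i x))) \<longlonglongrightarrow> \<Lambda> I"
      using \<Lambda>.tendsto[OF s(3)] by (simp add: simple_bochner_integral_linear[OF \<Lambda>.linear_axioms s(1)])
    have "(\<integral>\<^sup>+x. ennreal (norm (\<Lambda> (f x) - \<Lambda> (s i x))) \<partial>M) \<le> ennreal K * (\<integral>\<^sup>+x. ennreal (norm (f x - s i x)) \<partial>M)" for i
    proof -
      have "(\<lambda>x. norm (f x - s i x)) \<in> borel_measurable M"
        by (intro measurable_norm_strongly strongly_measurable_diff f strongly_measurable_simple sf)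
      then have "ennreal K * (\<integral>\<^sup>+x. ennreal (norm (f x - s i x)) \<partial>M) = (\<integral>\<^sup>+x. ennreal K * ennreal (norm (f x - s i x)) \<partial>M)"
        by (simp add: nn_integral_cmult)
      moreover have "(\<integral>\<^sup>+x. ennreal (norm (\<Lambda> (f x) - \<Lambda> (s i x))) \<partial>M) \<le> (\<integral>\<^sup>+x. ennreal K * ennreal (norm (f x - s i x)) \<partial>M)"
        using K by (intro nn_integral_mono)
          (simp add: \<Lambda>.diff[symmetric] ennreal_mult[symmetric] mult.commute flip: real_norm_def del: ennreal_le_iff2)
      ultimately show ?thesis by simp
    qed
    note bound = this
    have "(\<lambda>i. ennreal K * (\<integral>\<^sup>+x. ennreal (norm (f x - s i x)) \<partial>M)) \<longlonglongrightarrow> ennreal K * 0"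
      by (intro ennreal_tendsto_cmult s(2)) simp
    then have "(\<lambda>i. ennreal K * (\<integral>\<^sup>+x. ennreal (norm (f x - s i x)) \<partial>M)) \<longlonglongrightarrow> 0" by simp
    from tendsto_sandwich[OF _ _ tendsto_const this]
    show "(\<lambda>i. \<integral>\<^sup>+x. ennreal (norm (\<Lambda> (f x) - \<Lambda> (s i x))) \<partial>M) \<longlonglongrightarrow> 0"
      using bound by (simp add: always_eventually)
  qed
  then show "integrable M (\<lambda>x. \<Lambda> (f x))" "(\<integral>x. \<Lambda> (f x) \<partial>M) = \<Lambda> I"
    by (auto simp: integrable.simps has_bochner_integral_integral_eq)
qed

section \<open>Weak convergence from Laplace transforms\<close>

text \<open>
  On \<open>[0, \<infinity>)\<close> the ramps that characterise weak convergence are continuous functions of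
  \<open>exp (- x) \<in> [0, 1]\<close>. By the Weierstrass theorem they are uniform limits of polynomials in
  \<open>exp (- x)\<close>, whose expectations are combinations of Laplace transforms at integers. Uniformity up
  to infinity is available because the ramps vanish there.
\<close>

lemma weak_conv_if_laplace_conv:
  fixes X :: "nat \<Rightarrow> 'a \<Rightarrow> real" and Y :: "'b \<Rightarrow> real"
  assumes M: "prob_space M" and L: "prob_space L"
    and X [measurable]: "\<And>n. X n \<in> borel_measurable M" and Y [measurable]: "Y \<in> borel_measurable L"
    and X0: "\<And>n. AE \<omega> in M. 0 \<le> X n \<omega>" and Y0: "AE v in L. 0 \<le> Y v"
    and conv: "\<And>j::nat. (\<lambda>n. \<integral>\<omega>. exp (- (real j * X n \<omega>)) \<partial>M) \<longlonglongrightarrow> (\<integral>v. exp (- (real j * Y v)) \<partial>L)"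
  shows "weak_conv_m (\<lambda>n. distr M borel (X n)) (distr L borel Y)"
proof (rule integral_cts_step_conv_imp_weak_conv)
  interpret M: prob_space M by fact
  interpret L: prob_space L by fact
  show "real_distribution (distr M borel (X n))" for n by (rule M.real_distribution_distr) simp
  show "real_distribution (distr L borel Y)" by (rule L.real_distribution_distr) simp
  fix x y :: real assume xy: "x < y"
  \<comment> \<open>Cutting the logarithm off below \<open>exp (- (y + 1))\<close> makes \<open>g\<close> continuous at \<open>0\<close>
     without changing it on the values where the ramp is not yet \<open>0\<close>.\<close>
  define g where "g t = cts_step x y (- ln (max t (exp (- (y + 1)))))" for t
  have step_cont: "continuous_on UNIV (cts_step x y)"
    by (rule uniformly_continuous_imp_continuous[OF cts_step_uniformly_continuous[OF xy]])
  have g_cont: "continuous_on {0..1} g" unfolding g_def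
    by (rule continuous_on_compose2[OF step_cont]) (auto intro!: continuous_intros simp: less_max_iff_disj less_imp_neq[THEN not_sym])
  have g_exp: "g (exp (- z)) = cts_step x y z" for z
  proof -
    have "- ln (max (exp (- z)) (exp (- (y + 1)))) = min z (y + 1)"
      by (auto simp: max_def min_def)
    then show ?thesis using xy by (simp add: g_def cts_step_def min_def)
  qed
  have [measurable]: "cts_step x y \<in> borel_measurable borel"
    by (rule borel_measurable_continuous_onI[OF step_cont])
  have "(\<lambda>n. \<integral>\<omega>. cts_step x y (X n \<omega>) \<partial>M) \<longlonglongrightarrow> (\<integral>v. cts_step x y (Y v) \<partial>L)"
  proof (rule LIMSEQ_I)
    fix e :: real assume e: "e > 0"
    then have e3: "e / 3 > 0" by simp
    obtain p where p: "real_polynomial_function p" "\<And>t. t \<in> {0..1} \<Longrightarrow> \<bar>g t - p t\<bar> < e / 3"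
      using Stone_Weierstrass_real_polynomial_function[OF compact_Icc g_cont e3] by blast
    obtain a d where pa: "p = (\<lambda>t. \<Sum>i\<le>d. a i * t ^ i)"
      using p(1) real_polynomial_function_iff_sum by blast
    have poly: "\<bar>(\<integral>\<omega>. cts_step x y (U \<omega>) \<partial>K) - (\<Sum>i\<le>d. a i * (\<integral>\<omega>. exp (- (real i * U \<omega>)) \<partial>K))\<bar> \<le> e / 3"
      if K: "prob_space K" and U [measurable]: "U \<in> borel_measurable K" and U0: "AE \<omega> in K. 0 \<le> U \<omega>"
      for K :: "'c measure" and U
    proof -
      interpret K: prob_space K by fact
      have int: "integrable K (\<lambda>\<omega>. exp (- (real i * U \<omega>)))" for i
        using U0 by (intro K.integrable_const_bound[where B = 1]) auto
      have ints: "integrable K (\<lambda>\<omega>. cts_step x y (U \<omega>))"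
        using xy by (intro K.integrable_const_bound[where B = 1]) (auto simp: cts_step_def)
      have "(\<Sum>i\<le>d. a i * (\<integral>\<omega>. exp (- (real i * U \<omega>)) \<partial>K)) = (\<integral>\<omega>. (\<Sum>i\<le>d. a i * exp (- (real i * U \<omega>))) \<partial>K)"
        using int by simp
      then have "\<bar>(\<integral>\<omega>. cts_step x y (U \<omega>) \<partial>K) - (\<Sum>i\<le>d. a i * (\<integral>\<omega>. exp (- (real i * U \<omega>)) \<partial>K))\<bar>
          = \<bar>\<integral>\<omega>. cts_step x y (U \<omega>) - (\<Sum>i\<le>d. a i * exp (- (real i * U \<omega>))) \<partial>K\<bar>"
        using int ints by simp
      also have "\<dots> \<le> (\<integral>\<omega>. \<bar>cts_step x y (U \<omega>) - (\<Sum>i\<le>d. a i * exp (- (real i * U \<omega>)))\<bar> \<partial>K)"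
        by (rule integral_abs_bound)
      also have "\<dots> \<le> (\<integral>\<omega>. e / 3 \<partial>K)"
      proof (rule integral_mono_AE)
        show "AE \<omega> in K. \<bar>cts_step x y (U \<omega>) - (\<Sum>i\<le>d. a i * exp (- (real i * U \<omega>)))\<bar> \<le> e / 3"
          using U0
        proof eventually_elim
          case (elim \<omega>)
          have "\<bar>g (exp (- U \<omega>)) - p (exp (- U \<omega>))\<bar> < e / 3"
            using elim by (intro p(2)) auto
          then show ?case by (simp add: g_exp pa exp_of_nat_mult[symmetric])
        qed
      qed (use int ints in auto)
      finally show ?thesis by (simp add: K.prob_space)
    qed
    have "(\<lambda>n. \<Sum>i\<le>d. a i * (\<integral>\<omega>. exp (- (real i * X n \<omega>)) \<partial>M)) \<longlonglongrightarrow> (\<Sum>i\<le>d. a i * (\<integral>v. exp (- (real i * Y v)) \<partial>L))"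
      by (intro tendsto_intros conv)
    from LIMSEQ_D[OF this e3] obtain N where
      N: "\<And>n. n \<ge> N \<Longrightarrow> \<bar>(\<Sum>i\<le>d. a i * (\<integral>\<omega>. exp (- (real i * X n \<omega>)) \<partial>M)) - (\<Sum>i\<le>d. a i * (\<integral>v. exp (- (real i * Y v)) \<partial>L))\<bar> < e / 3"
      by auto
    show "\<exists>N. \<forall>n\<ge>N. norm ((\<integral>\<omega>. cts_step x y (X n \<omega>) \<partial>M) - (\<integral>v. cts_step x y (Y v) \<partial>L)) < e"
    proof (intro exI allI impI)
      fix n assume "n \<ge> N"
      then show "norm ((\<integral>\<omega>. cts_step x y (X n \<omega>) \<partial>M) - (\<integral>v. cts_step x y (Y v) \<partial>L)) < e"
        using N[of n] poly[OF M X X0, of n] poly[OF L Y Y0] unfolding real_norm_def by linarith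
    qed
  qed
  then show "(\<lambda>n. integral\<^sup>L (distr M borel (X n)) (cts_step x y)) \<longlonglongrightarrow> integral\<^sup>L (distr L borel Y) (cts_step x y)"
    by (simp add: integral_distr)
qed

section \<open>A central limit theorem for weighted sums\<close>

lemma exp_minus_quadratic_bound:
  fixes u :: real
  assumes "u \<ge> 0"
  shows "\<bar>(1 - u) - exp (- u)\<bar> \<le> u\<^sup>2"
proof -
  have lo: "1 - u \<le> exp (- u)" using exp_ge_add_one_self[of "- u"] by simp
  have e: "1 + u + u\<^sup>2 / 2 \<le> exp u" using exp_lower_Taylor_quadratic[OF assms] by simp
  have "1 \<le> (1 - u + u\<^sup>2) * (1 + u + u\<^sup>2 / 2)"
  proof -
    have "(1 - u + u\<^sup>2) * (1 + u + u\<^sup>2 / 2) = 1 + u\<^sup>2 / 2 + u ^ 3 / 2 + u ^ 4 / 2"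
      by (simp add: field_simps power2_eq_square power3_eq_cube power4_eq_xxxx)
    then show ?thesis using assms by simp
  qed
  also have "\<dots> \<le> (1 - u + u\<^sup>2) * exp u"
  proof (rule mult_left_mono[OF e])
    have "0 \<le> (u - 1 / 2)\<^sup>2 + 3 / 4" by simp
    then show "0 \<le> 1 - u + u\<^sup>2" by (simp add: power2_eq_square algebra_simps)
  qed
  finally have "exp (- u) \<le> 1 - u + u\<^sup>2" by (simp add: exp_minus field_simps)
  then show ?thesis using lo by auto
qed

text \<open>
  With a second moment only, the Taylor remainder of the characteristic function is at most \<open>t\<^sup>2\<close> times the
  integral of \<open>min (6 w\<^sup>2) (\<bar>t\<bar> \<bar>w\<bar>\<^sup>3)\<close>, which tends to \<open>0\<close> with \<open>t\<close> by dominated convergence.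
\<close>

lemma char_second_order:
  fixes w :: "'a \<Rightarrow> real"
  assumes P: "prob_space P" and w [measurable]: "w \<in> borel_measurable P"
    and w2: "integrable P (\<lambda>x. (w x)\<^sup>2)" and w0: "(\<integral>x. w x \<partial>P) = 0"
    and e: "\<epsilon> > 0"
  obtains \<delta> where "\<delta> > 0"
    "\<And>t. \<bar>t\<bar> \<le> \<delta> \<Longrightarrow> cmod (char (distr P borel w) t - of_real (exp (- ((\<integral>x. (w x)\<^sup>2 \<partial>P) * t\<^sup>2 / 2)))) \<le> \<epsilon> * t\<^sup>2"
proof -
  interpret P: prob_space P by fact
  define v where "v = (\<integral>x. (w x)\<^sup>2 \<partial>P)"
  have v0: "v \<ge> 0" by (simp add: v_def)
  have iw: "integrable P w" by (rule P.square_integrable_imp_integrable[OF w w2])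
  define r where "r t = (\<integral>x. min (6 * (w x)\<^sup>2) (\<bar>t\<bar> * \<bar>w x\<bar> ^ 3) \<partial>P)" for t
  have ir: "integrable P (\<lambda>x. min (6 * (w x)\<^sup>2) (\<bar>t\<bar> * \<bar>w x\<bar> ^ 3))" for t
    by (rule Bochner_Integration.integrable_bound[where f = "\<lambda>x. 6 * (w x)\<^sup>2"]) (use w2 in \<open>auto simp: min_def\<close>)
  have approx: "cmod (char (distr P borel w) t - (1 - t\<^sup>2 * v / 2)) \<le> t\<^sup>2 / 6 * r t" for t
    unfolding r_def by (rule P.char_approx3'[OF w iw w2 w0 _ refl]) (simp add: w0 v_def)
  have "(\<lambda>n. r (1 / real (Suc n))) \<longlonglongrightarrow> (\<integral>x. 0 \<partial>P)" unfolding r_def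
  proof (rule integral_dominated_convergence[where w = "\<lambda>x. 6 * (w x)\<^sup>2"])
    show "AE x in P. (\<lambda>n. min (6 * (w x)\<^sup>2) (\<bar>1 / real (Suc n)\<bar> * \<bar>w x\<bar> ^ 3)) \<longlonglongrightarrow> 0"
    proof (rule AE_I2)
      fix x
      have "(\<lambda>n. \<bar>1 / real (Suc n)\<bar> * \<bar>w x\<bar> ^ 3) \<longlonglongrightarrow> \<bar>0\<bar> * \<bar>w x\<bar> ^ 3"
        by (intro tendsto_intros) (use LIMSEQ_inverse_real_of_nat in \<open>simp add: inverse_eq_divide\<close>)
      then have "(\<lambda>n. min (6 * (w x)\<^sup>2) (\<bar>1 / real (Suc n)\<bar> * \<bar>w x\<bar> ^ 3)) \<longlonglongrightarrow> min (6 * (w x)\<^sup>2) (\<bar>0\<bar> * \<bar>w x\<bar> ^ 3)"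
        by (intro tendsto_min tendsto_const)
      then show "(\<lambda>n. min (6 * (w x)\<^sup>2) (\<bar>1 / real (Suc n)\<bar> * \<bar>w x\<bar> ^ 3)) \<longlonglongrightarrow> 0" by simp
    qed
  qed (use w2 in \<open>auto simp: min_def\<close>)
  then have "(\<lambda>n. r (1 / real (Suc n))) \<longlonglongrightarrow> 0" by simp
  from order_tendstoD(2)[OF this, of "3 * \<epsilon>"] e obtain n where n: "r (1 / real (Suc n)) < 3 * \<epsilon>"
    using eventually_happens'[OF sequentially_bot] by fastforce
  \<comment> \<open>The first bound controls the Taylor remainder, the second the difference between \<open>1 - v t\<^sup>2 / 2\<close>
     and the exponential; each may use half of \<open>\<epsilon> t\<^sup>2\<close>.\<close>
  define \<delta> where "\<delta> = min (1 / real (Suc n)) (sqrt (2 * \<epsilon> / (v\<^sup>2 + 1)))"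
  show thesis
  proof (rule that)
    show "\<delta> > 0" using e by (simp add: \<delta>_def add_nonneg_pos)
    fix t :: real assume t: "\<bar>t\<bar> \<le> \<delta>"
    have "r t \<le> r (1 / real (Suc n))" unfolding r_def
    proof (rule integral_mono[OF ir ir])
      fix x
      have "\<bar>t\<bar> * \<bar>w x\<bar> ^ 3 \<le> \<bar>1 / real (Suc n)\<bar> * \<bar>w x\<bar> ^ 3"
        using t by (intro mult_right_mono) (auto simp: \<delta>_def)
      then show "min (6 * (w x)\<^sup>2) (\<bar>t\<bar> * \<bar>w x\<bar> ^ 3) \<le> min (6 * (w x)\<^sup>2) (\<bar>1 / real (Suc n)\<bar> * \<bar>w x\<bar> ^ 3)"
        by (intro min.mono order_refl)
    qed
    then have "t\<^sup>2 / 6 * r t \<le> t\<^sup>2 / 6 * (3 * \<epsilon>)" using n by (intro mult_left_mono) auto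
    then have 1: "cmod (char (distr P borel w) t - (1 - t\<^sup>2 * v / 2)) \<le> \<epsilon> / 2 * t\<^sup>2"
      by (intro order_trans[OF approx[of t]]) (simp add: mult.commute)
    have "\<bar>t\<bar> \<le> sqrt (2 * \<epsilon> / (v\<^sup>2 + 1))" using t by (simp add: \<delta>_def)
    then have "\<bar>t\<bar>\<^sup>2 \<le> 2 * \<epsilon> / (v\<^sup>2 + 1)"
      using e by (metis abs_ge_zero power_mono real_sqrt_pow2 add_nonneg_nonneg divide_nonneg_nonneg
          less_imp_le mult_nonneg_nonneg zero_le_numeral zero_le_one zero_le_power2)
    then have "t\<^sup>2 * (v\<^sup>2 + 1) \<le> 2 * \<epsilon>" by (simp add: pos_le_divide_eq add_nonneg_pos)
    then have "t\<^sup>2 * v\<^sup>2 \<le> 2 * \<epsilon>" by (simp add: algebra_simps)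
         (smt (verit) zero_le_power2)
    then have "(t\<^sup>2 * v\<^sup>2) * t\<^sup>2 \<le> (2 * \<epsilon>) * t\<^sup>2" by (rule mult_right_mono) simp
    then have "(v * t\<^sup>2 / 2)\<^sup>2 \<le> \<epsilon> / 2 * t\<^sup>2" by (simp add: power2_eq_square field_simps)
    with exp_minus_quadratic_bound[of "v * t\<^sup>2 / 2"] v0
    have "\<bar>(1 - v * t\<^sup>2 / 2) - exp (- (v * t\<^sup>2 / 2))\<bar> \<le> \<epsilon> / 2 * t\<^sup>2" by simp
    moreover have "(1 - t\<^sup>2 * v / 2) - of_real (exp (- (v * t\<^sup>2 / 2)))
        = complex_of_real ((1 - v * t\<^sup>2 / 2) - exp (- (v * t\<^sup>2 / 2)))"
      by (simp add: mult.commute)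
    ultimately have 2: "cmod ((1 - t\<^sup>2 * v / 2) - of_real (exp (- (v * t\<^sup>2 / 2)))) \<le> \<epsilon> / 2 * t\<^sup>2"
      by (simp only: norm_of_real)
    have "cmod (char (distr P borel w) t - of_real (exp (- (v * t\<^sup>2 / 2)))) \<le> \<epsilon> / 2 * t\<^sup>2 + \<epsilon> / 2 * t\<^sup>2"
      by (rule norm_diff_triangle_le[OF 1]) (use 2 in simp)
    also have "\<dots> = \<epsilon> * t\<^sup>2" by simp
    finally show "cmod (char (distr P borel w) t - of_real (exp (- ((\<integral>x. (w x)\<^sup>2 \<partial>P) * t\<^sup>2 / 2)))) \<le> \<epsilon> * t\<^sup>2"
      unfolding v_def .
  qed
qed

text \<open>
  The product of the characteristic functions is compared factor by factor with the product of
  Gaussian ones. If all weights are small, each factor costs at most \<open>\<epsilon>\<close> times the squared weight,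
  and the squared weights have a bounded sum. The index type is arbitrary, so that two samples
  can be treated as one.
\<close>

lemma char_weighted_iid_sum_tendsto:
  fixes \<zeta> :: "'i \<Rightarrow> 'w \<Rightarrow> 'a" and w :: "'a \<Rightarrow> real" and a :: "nat \<Rightarrow> 'i \<Rightarrow> real"
  assumes M: "prob_space M" and indep: "prob_space.indep_vars M (\<lambda>_. S) \<zeta> UNIV"
    and dist: "\<And>i. distr M S (\<zeta> i) = P"
    and w [measurable]: "w \<in> borel_measurable P"
    and w2: "integrable P (\<lambda>x. (w x)\<^sup>2)" and w0: "(\<integral>x. w x \<partial>P) = 0"
    and fin: "\<And>N. finite (I N)"
    and small: "\<And>\<delta>. \<delta> > 0 \<Longrightarrow> \<forall>\<^sub>F N in sequentially. \<forall>i\<in>I N. \<bar>a N i\<bar> \<le> \<delta>"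
    and sq: "(\<lambda>N. \<Sum>i\<in>I N. (a N i)\<^sup>2) \<longlonglongrightarrow> \<kappa>"
  shows "(\<lambda>N. \<integral>\<omega>. iexp (\<Sum>i\<in>I N. a N i * w (\<zeta> i \<omega>)) \<partial>M)
           \<longlonglongrightarrow> complex_of_real (exp (- (\<kappa> * (\<integral>x. (w x)\<^sup>2 \<partial>P) / 2)))"
proof -
  interpret M: prob_space M by fact
  have \<zeta> [measurable]: "\<zeta> i \<in> M \<rightarrow>\<^sub>M S" for i using indep by (simp add: M.indep_vars_def)
  have sP: "sets P = sets S" using dist[of undefined] by auto
  have wS [measurable]: "w \<in> borel_measurable S" using w sP measurable_cong_sets by blast
  have P: "prob_space P" using M.prob_space_distr[OF \<zeta>[of undefined]] dist by simp
  interpret P: prob_space P by fact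
  define v where "v = (\<integral>x. (w x)\<^sup>2 \<partial>P)"
  have v0: "v \<ge> 0" by (simp add: v_def)
  define ch where "ch = char (distr P borel w)"
  have ch1: "cmod (ch t) \<le> 1" for t unfolding ch_def
    by (rule real_distribution.cmod_char_le_1[OF P.real_distribution_distr]) simp
  have split: "(\<integral>\<omega>. iexp (\<Sum>i\<in>I N. a N i * w (\<zeta> i \<omega>)) \<partial>M) = (\<Prod>i\<in>I N. ch (a N i))" for N
  proof -
    have "(\<integral>\<omega>. iexp (\<Sum>i\<in>I N. a N i * w (\<zeta> i \<omega>)) \<partial>M)
        = char (distr M borel (\<lambda>\<omega>. \<Sum>i\<in>I N. a N i * w (\<zeta> i \<omega>))) 1"
      by (simp add: char_def integral_distr)
    also have "\<dots> = (\<Prod>i\<in>I N. char (distr M borel (\<lambda>\<omega>. a N i * w (\<zeta> i \<omega>))) 1)"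
      by (rule M.char_distr_sum, rule M.indep_vars_compose2[OF M.indep_vars_subset[OF indep]]) auto
    also have "\<dots> = (\<Prod>i\<in>I N. ch (a N i))"
    proof (rule prod.cong[OF refl])
      fix i
      have "ch (a N i) = (\<integral>x. iexp (a N i * w x) \<partial>distr M S (\<zeta> i))"
        by (simp add: ch_def char_def integral_distr dist)
      also have "\<dots> = char (distr M borel (\<lambda>\<omega>. a N i * w (\<zeta> i \<omega>))) 1"
        by (simp add: char_def integral_distr)
      finally show "char (distr M borel (\<lambda>\<omega>. a N i * w (\<zeta> i \<omega>))) 1 = ch (a N i)" ..
    qed
    finally show ?thesis .
  qed
  define G where "G N = (\<Prod>i\<in>I N. complex_of_real (exp (- (v * (a N i)\<^sup>2 / 2))))" for N
  have G_eq: "G N = complex_of_real (exp (- ((\<Sum>i\<in>I N. (a N i)\<^sup>2) * v / 2)))" for N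
    by (simp add: G_def exp_sum[OF fin, symmetric] sum_negf sum_distrib_left sum_divide_distrib mult.commute
        flip: of_real_prod)
  have G_lim: "G \<longlonglongrightarrow> complex_of_real (exp (- (\<kappa> * v / 2)))"
    unfolding G_eq by (intro tendsto_intros sq) simp
  have "(\<lambda>N. (\<Prod>i\<in>I N. ch (a N i)) - G N) \<longlonglongrightarrow> 0"
  proof (rule LIMSEQ_I)
    fix e :: real assume e: "e > 0"
    have \<kappa>0: "\<kappa> \<ge> 0" using sq by (rule LIMSEQ_le_const) (auto simp: sum_nonneg)
    define \<epsilon> where "\<epsilon> = e / (\<kappa> + 1)"
    have \<epsilon>: "\<epsilon> > 0" using e \<kappa>0 by (simp add: \<epsilon>_def)
    from char_second_order[OF P w w2 w0 \<epsilon>] obtain \<delta> where \<delta>: "\<delta> > 0"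
      and bd: "\<And>t. \<bar>t\<bar> \<le> \<delta> \<Longrightarrow> cmod (ch t - of_real (exp (- (v * t\<^sup>2 / 2)))) \<le> \<epsilon> * t\<^sup>2"
      unfolding ch_def v_def by blast
    have "\<forall>\<^sub>F N in sequentially. norm ((\<Prod>i\<in>I N. ch (a N i)) - G N) < e"
      using small[OF \<delta>] order_tendstoD(2)[OF sq, of "\<kappa> + 1", simplified]
    proof eventually_elim
      case (elim N)
      have "norm ((\<Prod>i\<in>I N. ch (a N i)) - G N)
          \<le> (\<Sum>i\<in>I N. norm (ch (a N i) - of_real (exp (- (v * (a N i)\<^sup>2 / 2)))))"
        unfolding G_def by (rule norm_prod_diff) (use ch1 v0 in \<open>auto simp del: of_real_exp\<close>)
      also have "\<dots> \<le> (\<Sum>i\<in>I N. \<epsilon> * (a N i)\<^sup>2)"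
        using elim(1) by (intro sum_mono bd) auto
      also have "\<dots> = \<epsilon> * (\<Sum>i\<in>I N. (a N i)\<^sup>2)" by (simp add: sum_distrib_left)
      also have "\<dots> < \<epsilon> * (\<kappa> + 1)" using elim(2) \<epsilon> by (intro mult_strict_left_mono) auto
      also have "\<dots> = e" using \<kappa>0 by (simp add: \<epsilon>_def)
      finally show ?case .
    qed
    then show "\<exists>N0. \<forall>N\<ge>N0. norm ((\<Prod>i\<in>I N. ch (a N i)) - G N - 0) < e"
      by (simp add: eventually_sequentially)
  qed
  from tendsto_add[OF this G_lim] show ?thesis unfolding split v_def[symmetric] by simp
qed

section \<open>Linearising Gaussian quadratic forms\<close>

lemma char_std_normal_sum:
  fixes Z :: "nat \<Rightarrow> 'v \<Rightarrow> real"
  assumes L: "prob_space L" and indep: "prob_space.indep_vars L (\<lambda>_. borel) Z UNIV"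
    and Z: "\<And>l. distributed L lborel (Z l) std_normal_density"
  shows "(\<integral>v. iexp (\<Sum>l<K. c l * Z l v) \<partial>L) = complex_of_real (exp (- ((\<Sum>l<K. (c l)\<^sup>2) / 2)))"
proof -
  interpret L: prob_space L by fact
  have [measurable]: "Z l \<in> borel_measurable L" for l
    using indep by (simp add: L.indep_vars_def)
  have dZ: "distr L borel (Z l) = std_normal_distribution" for l
    using Z[of l] by (metis distributed_distr_eq_density distr_cong sets_lborel)
  have "(\<integral>v. iexp (\<Sum>l<K. c l * Z l v) \<partial>L) = char (distr L borel (\<lambda>v. \<Sum>l<K. c l * Z l v)) 1"
    by (simp add: char_def integral_distr)
  also have "\<dots> = (\<Prod>l<K. char (distr L borel (\<lambda>v. c l * Z l v)) 1)"
    by (rule L.char_distr_sum, rule L.indep_vars_compose2[OF L.indep_vars_subset[OF indep]]) auto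
  also have "\<dots> = (\<Prod>l<K. complex_of_real (exp (- ((c l)\<^sup>2 / 2))))"
  proof (rule prod.cong[OF refl])
    fix l
    have "char (distr L borel (\<lambda>v. c l * Z l v)) 1 = char (distr L borel (Z l)) (c l)"
      by (simp add: char_def integral_distr)
    then show "char (distr L borel (\<lambda>v. c l * Z l v)) 1 = complex_of_real (exp (- ((c l)\<^sup>2 / 2)))"
      by (simp add: dZ char_std_normal_distribution)
  qed
  also have "\<dots> = complex_of_real (exp (- ((\<Sum>l<K. (c l)\<^sup>2) / 2)))"
    by (simp add: exp_sum[symmetric] sum_negf sum_divide_distrib flip: of_real_prod)
  finally show ?thesis .
qed

text \<open>
  Averaging \<open>exp (\<i> \<langle>g, Z\<rangle>)\<close> over a standard Gaussian \<open>Z\<close> gives \<open>exp (- \<parallel>g\<parallel>\<^sup>2 / 2)\<close>. Exchanging the two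
  expectations expresses the Laplace transform of \<open>\<parallel>g\<parallel>\<^sup>2\<close> through characteristic functions of linear
  combinations of the coordinates, to which one-dimensional limit theorems apply. Averaging the
  Gaussian limit over the same \<open>Z\<close> yields the weighted sum of squares directly.
\<close>

lemma laplace_quadratic_tendsto:
  fixes Z :: "nat \<Rightarrow> 'v \<Rightarrow> real" and g :: "nat \<Rightarrow> nat \<Rightarrow> 'w \<Rightarrow> real"
  assumes L: "prob_space L" and indep: "prob_space.indep_vars L (\<lambda>_. borel) Z UNIV"
    and Z: "\<And>l. distributed L lborel (Z l) std_normal_density"
    and M: "prob_space M" and g [measurable]: "\<And>N l. g N l \<in> borel_measurable M"
    and conv: "\<And>c. (\<lambda>N. \<integral>\<omega>. iexp (\<Sum>l<K. c l * g N l \<omega>) \<partial>M)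
                 \<longlonglongrightarrow> complex_of_real (exp (- ((\<Sum>l<K. d l * (c l)\<^sup>2) / 2)))"
  shows "(\<lambda>N. \<integral>\<omega>. exp (- ((\<Sum>l<K. (g N l \<omega>)\<^sup>2) / 2)) \<partial>M)
           \<longlonglongrightarrow> (\<integral>v. exp (- ((\<Sum>l<K. d l * (Z l v)\<^sup>2) / 2)) \<partial>L)"
proof -
  interpret L: prob_space L by fact
  interpret M: prob_space M by fact
  interpret MxL: pair_prob_space M L ..
  have [measurable]: "Z l \<in> borel_measurable L" for l
    using indep by (simp add: L.indep_vars_def)
  have eq: "complex_of_real (\<integral>\<omega>. exp (- ((\<Sum>l<K. (g N l \<omega>)\<^sup>2) / 2)) \<partial>M)
      = (\<integral>v. (\<integral>\<omega>. iexp (\<Sum>l<K. Z l v * g N l \<omega>) \<partial>M) \<partial>L)" for N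
  proof -
    have "complex_of_real (\<integral>\<omega>. exp (- ((\<Sum>l<K. (g N l \<omega>)\<^sup>2) / 2)) \<partial>M)
        = (\<integral>\<omega>. complex_of_real (exp (- ((\<Sum>l<K. (g N l \<omega>)\<^sup>2) / 2))) \<partial>M)"
      by (rule integral_complex_of_real[symmetric])
    also have "\<dots> = (\<integral>\<omega>. (\<integral>v. iexp (\<Sum>l<K. g N l \<omega> * Z l v) \<partial>L) \<partial>M)"
      by (simp only: char_std_normal_sum[OF L indep Z])
    also have "\<dots> = (\<integral>v. (\<integral>\<omega>. iexp (\<Sum>l<K. g N l \<omega> * Z l v) \<partial>M) \<partial>L)"
      by (rule MxL.Fubini_integral[symmetric], rule MxL.P.integrable_const_bound[where B = 1]) auto
    finally show ?thesis by (simp add: mult.commute)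
  qed
  have "(\<lambda>N. \<integral>v. (\<integral>\<omega>. iexp (\<Sum>l<K. Z l v * g N l \<omega>) \<partial>M) \<partial>L)
      \<longlonglongrightarrow> (\<integral>v. complex_of_real (exp (- ((\<Sum>l<K. d l * (Z l v)\<^sup>2) / 2))) \<partial>L)"
  proof (rule integral_dominated_convergence[where w = "\<lambda>_. 1"])
    show "AE v in L. (\<lambda>N. \<integral>\<omega>. iexp (\<Sum>l<K. Z l v * g N l \<omega>) \<partial>M)
        \<longlonglongrightarrow> complex_of_real (exp (- ((\<Sum>l<K. d l * (Z l v)\<^sup>2) / 2)))"
      by (rule AE_I2) (rule conv)
    show "AE v in L. norm (\<integral>\<omega>. iexp (\<Sum>l<K. Z l v * g N l \<omega>) \<partial>M) \<le> 1" for N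
    proof (rule AE_I2)
      fix v
      have "norm (\<integral>\<omega>. iexp (\<Sum>l<K. Z l v * g N l \<omega>) \<partial>M) \<le> (\<integral>\<omega>. norm (iexp (\<Sum>l<K. Z l v * g N l \<omega>)) \<partial>M)"
        by (rule integral_norm_bound)
      also have "\<dots> = 1" by (simp add: M.prob_space)
      finally show "norm (\<integral>\<omega>. iexp (\<Sum>l<K. Z l v * g N l \<omega>) \<partial>M) \<le> 1" .
    qed
  qed auto
  then have "(\<lambda>N. complex_of_real (\<integral>\<omega>. exp (- ((\<Sum>l<K. (g N l \<omega>)\<^sup>2) / 2)) \<partial>M))
      \<longlonglongrightarrow> complex_of_real (\<integral>v. exp (- ((\<Sum>l<K. d l * (Z l v)\<^sup>2) / 2)) \<partial>L)"
    by (simp only: eq[symmetric] integral_complex_of_real)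
  then show ?thesis using tendsto_of_real_iff by blast
qed

section \<open>Spectral theory of positive Hilbert--Schmidt operators\<close>

lemma orthonormal_set_spanning:
  fixes B :: "'a::real_inner set"
  assumes B: "finite B" "independent B"
  obtains C where "finite C" "orthonormal C" "span C = span B" "card C = card B"
proof -
  obtain D where D: "finite D" "span D = span B" "pairwise orthogonal D"
    using basis_orthogonal[OF B(1)] by blast
  define D' where "D' = D - {0}"
  define C where "C = (\<lambda>x. inverse (norm x) *\<^sub>R x) ` D'"
  have D': "finite D'" "span D' = span B" "pairwise orthogonal D'" "0 \<notin> D'"
    using D by (auto simp: D'_def intro: pairwise_subset)
  have C: "span C = span B" unfolding C_def
    using D' by (subst span_image_scale) auto
  have on: "orthonormal C" unfolding orthonormal_def
  proof (intro ballI)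
    fix x y assume "x \<in> C" "y \<in> C"
    then obtain a b where a: "a \<in> D'" "x = inverse (norm a) *\<^sub>R a"
      and b: "b \<in> D'" "y = inverse (norm b) *\<^sub>R b" by (auto simp: C_def)
    show "x \<bullet> y = (if x = y then 1 else 0)"
    proof (cases "a = b")
      case True
      then have "a \<noteq> 0" using a D'(4) by auto
      then show ?thesis using True a b by (simp add: dot_square_norm power2_eq_square)
    next
      case False
      then have "a \<bullet> b = 0" using D'(3) a b by (auto simp: pairwise_def orthogonal_def)
      then have xy: "x \<bullet> y = 0" using a b by simp
      have "x \<noteq> 0" using a D'(4) by auto
      then show ?thesis using xy by auto
    qed
  qed
  have "0 \<notin> C"
  proof
    assume "0 \<in> C"
    then have "(0::'a) \<bullet> 0 = 1" using on unfolding orthonormal_def by metis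
    then show False by simp
  qed
  moreover have "pairwise orthogonal C"
    using on by (auto simp: orthonormal_def pairwise_def orthogonal_def)
  ultimately have "independent C" by (intro pairwise_orthogonal_independent)
  then have card: "card C = card B"
    using B C dim_span_eq_card_independent by metis
  have "finite C" using D'(1) by (simp add: C_def)
  then show thesis by (rule that[OF _ on C card])
qed

text \<open>
  Within an eigenspace the vectors come from orthonormalising a basis, matched with the indices by
  multiplicity; vectors of different eigenspaces are orthogonal by symmetry of the operator. The
  indices with eigenvalue \<open>0\<close> are not tied to any eigenvector, and get the vector \<open>0\<close>.
\<close>

lemma eigenvector_sequence:
  fixes T :: "'a::{real_inner,banach} hs_op"
  assumes lam: "eigenvalue_sequence T lam"
    and sym: "\<And>x y. op_of_hs T x \<bullet> y = x \<bullet> op_of_hs T y"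
  obtains u :: "nat \<Rightarrow> 'a" where
    "\<And>l m. u l \<bullet> u m = (if l = m \<and> lam l \<noteq> 0 then 1 else 0)"
    "\<And>l. op_of_hs T (u l) = lam l *\<^sub>R u l"
    "\<And>c. c \<noteq> 0 \<Longrightarrow> eigenspace T c = span (u ` {l. lam l = c})"
proof -
  have "\<exists>C. finite C \<and> orthonormal C \<and> span C = eigenspace T c \<and> card C = card {l. lam l = c}"
    if c: "c \<noteq> 0" for c
  proof -
    obtain B where B: "finite B" "independent B" "span B = eigenspace T c" "card B = card {l. lam l = c}"
      using lam c unfolding eigenvalue_sequence_def by blast
    from orthonormal_set_spanning[OF B(1,2)] show ?thesis using B(3,4) by metis
  qed
  then obtain C where C: "\<And>c. c \<noteq> 0 \<Longrightarrow> finite (C c) \<and> orthonormal (C c) \<and> span (C c) = eigenspace T c \<and> card (C c) = card {l. lam l = c}"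
    by metis
  have "\<exists>f. bij_betw f {l. lam l = c} (C c)" if "c \<noteq> 0" for c
    using C[OF that] lam that by (intro finite_same_card_bij) (auto simp: eigenvalue_sequence_def)
  then obtain f where f: "\<And>c. c \<noteq> 0 \<Longrightarrow> bij_betw (f c) {l. lam l = c} (C c)" by metis
  define u where "u l = (if lam l = 0 then 0 else f (lam l) l)" for l
  have uC: "u l \<in> C (lam l)" if "lam l \<noteq> 0" for l
    using f[OF that] that by (auto simp: u_def bij_betw_def)
  have img: "u ` {l. lam l = c} = C c" if "c \<noteq> 0" for c
    using f[OF that] that by (auto simp: u_def bij_betw_def)
  have eig: "op_of_hs T (u l) = lam l *\<^sub>R u l" for l
  proof (cases "lam l = 0")
    case True
    then show ?thesis by (simp add: u_def blinfun.zero_right)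
  next
    case False
    then have "u l \<in> eigenspace T (lam l)" using uC[OF False] C[OF False] span_base by blast
    then show ?thesis by (simp add: eigenspace_def)
  qed
  show thesis
  proof (rule that[of u])
    fix l m
    show "u l \<bullet> u m = (if l = m \<and> lam l \<noteq> 0 then 1 else 0)"
    proof (cases "lam l = 0 \<or> lam m = 0")
      case True
      then show ?thesis by (auto simp: u_def)
    next
      case False
      show ?thesis
      proof (cases "lam l = lam m")
        case True
        have "u l = u m \<longleftrightarrow> l = m"
          using f[of "lam l"] False True by (auto simp: u_def bij_betw_def inj_on_def)
        then show ?thesis using False True uC[of l] uC[of m] C[of "lam l"] by (simp add: orthonormal_def)
      next
        case neq: False
        have "lam l * (u l \<bullet> u m) = lam m * (u l \<bullet> u m)"
          using sym[of "u l" "u m"] by (simp add: eig)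
        then show ?thesis using neq by auto
      qed
    qed
  next
    show "op_of_hs T (u l) = lam l *\<^sub>R u l" for l by (rule eig)
    show "eigenspace T c = span (u ` {l. lam l = c})" if "c \<noteq> 0" for c
      using img[OF that] C[OF that] by simp
  qed
qed

lemma compact_bounded_combinations:
  fixes g :: "'i \<Rightarrow> 'a::real_normed_vector"
  assumes "finite F"
  shows "compact {\<Sum>e\<in>F. a e *\<^sub>R g e | a. \<forall>e. \<bar>a e\<bar> \<le> 1}"
  using assms
proof (induction F)
  case empty
  have "{\<Sum>e\<in>{}. a e *\<^sub>R g e | a. \<forall>e. \<bar>a e\<bar> \<le> 1} \<subseteq> {0}" by auto
  then show ?case using finite_subset finite_imp_compact by blast
next
  case (insert i F)
  have "compact ((\<lambda>t. t *\<^sub>R g i) ` {- 1..1::real})"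
    by (intro compact_continuous_image continuous_intros) auto
  from compact_sums[OF this insert.IH]
  have "compact {x + y |x y. x \<in> (\<lambda>t. t *\<^sub>R g i) ` {- 1..1} \<and> y \<in> {\<Sum>e\<in>F. a e *\<^sub>R g e | a. \<forall>e. \<bar>a e\<bar> \<le> 1}}" .
  also have "{x + y |x y. x \<in> (\<lambda>t. t *\<^sub>R g i) ` {- 1..1} \<and> y \<in> {\<Sum>e\<in>F. a e *\<^sub>R g e | a. \<forall>e. \<bar>a e\<bar> \<le> 1}}
      = {\<Sum>e\<in>insert i F. a e *\<^sub>R g e | a. \<forall>e. \<bar>a e\<bar> \<le> 1}" (is "?L = ?R")
  proof (intro equalityI subsetI)
    fix z assume "z \<in> ?L"
    then obtain t a where t: "\<bar>t\<bar> \<le> 1" and a: "\<forall>e. \<bar>a e\<bar> \<le> 1" and z: "z = t *\<^sub>R g i + (\<Sum>e\<in>F. a e *\<^sub>R g e)"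
      by (auto simp: abs_le_iff)
    have "(\<Sum>e\<in>F. (a(i := t)) e *\<^sub>R g e) = (\<Sum>e\<in>F. a e *\<^sub>R g e)"
      using insert.hyps by (intro sum.cong) auto
    then have "z = (\<Sum>e\<in>insert i F. (a(i := t)) e *\<^sub>R g e)"
      using insert.hyps z by simp
    then show "z \<in> ?R" using t a by (intro CollectI exI[of _ "a(i := t)"]) simp
  next
    fix z assume "z \<in> ?R"
    then obtain a where a: "\<forall>e. \<bar>a e\<bar> \<le> 1" and z: "z = (\<Sum>e\<in>insert i F. a e *\<^sub>R g e)" by auto
    then have "z = a i *\<^sub>R g i + (\<Sum>e\<in>F. a e *\<^sub>R g e)" using insert.hyps by simp
    moreover have "a i \<in> {- 1..1}" using a[THEN spec, of i] by (auto simp: abs_le_iff)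
    ultimately show "z \<in> ?L" using a by blast
  qed
  finally show ?case .
qed

text \<open>
  In the operator norm a Hilbert--Schmidt operator is the limit of its compositions with projections
  onto the spans of finitely many basis vectors. This makes it compact.
\<close>

lemma hs_op_finite_rank_approx:
  fixes T :: "'a::{real_inner,banach} hs_op"
  assumes e: "\<epsilon> > 0"
  obtains F where "finite F" "F \<subseteq> some_basis"
    "\<And>x. norm x \<le> 1 \<Longrightarrow> norm (op_of_hs T x - (\<Sum>e\<in>F. (x \<bullet> e) *\<^sub>R op_of_hs T e)) \<le> \<epsilon>"
proof -
  let ?s = "\<lambda>e. (norm (op_of_hs T e))\<^sup>2"
  have "(sum ?s \<longlongrightarrow> (norm T)\<^sup>2) (finite_subsets_at_top some_basis)"
    using hs_norm_has_sum[of T] by (simp add: has_sum_def)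
  from order_tendstoD(1)[OF this, of "(norm T)\<^sup>2 - \<epsilon>\<^sup>2"] e
  obtain F where F: "finite F" "F \<subseteq> some_basis" "sum ?s F > (norm T)\<^sup>2 - \<epsilon>\<^sup>2"
    unfolding eventually_finite_subsets_at_top by force
  have tail: "norm (\<Sum>e\<in>H. (x \<bullet> e) *\<^sub>R op_of_hs T e) \<le> \<epsilon>"
    if x: "norm x \<le> 1" and H: "finite H" "H \<subseteq> some_basis" "H \<inter> F = {}" for x H
  proof -
    have "norm (\<Sum>e\<in>H. (x \<bullet> e) *\<^sub>R op_of_hs T e) \<le> (\<Sum>e\<in>H. \<bar>x \<bullet> e\<bar> * \<bar>norm (op_of_hs T e)\<bar>)"
      by (rule order_trans[OF norm_sum]) simp
    also have "\<dots> \<le> L2_set (\<lambda>e. x \<bullet> e) H * L2_set (\<lambda>e. norm (op_of_hs T e)) H"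
      by (rule L2_set_mult_ineq)
    also have "\<dots> \<le> 1 * \<epsilon>"
    proof (intro mult_mono)
      have "(\<Sum>e\<in>H. (x \<bullet> e)\<^sup>2) \<le> (norm x)\<^sup>2"
        by (rule bessel_finite[OF orthonormal_subset[OF orthonormal_some_basis H(2)] H(1)])
      also have "\<dots> \<le> 1" using x by (simp add: power_le_one)
      finally show "L2_set (\<lambda>e. x \<bullet> e) H \<le> 1" by (simp add: L2_set_def)
      have "sum ?s (F \<union> H) \<le> (norm T)\<^sup>2"
        by (rule finite_sum_le_has_sum[OF hs_norm_has_sum]) (use F H in auto)
      then have "sum ?s F + sum ?s H \<le> (norm T)\<^sup>2"
        using F H by (subst (asm) sum.union_disjoint) auto
      then have "sum ?s H \<le> \<epsilon>\<^sup>2" using F(3) by simp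
      then show "L2_set (\<lambda>e. norm (op_of_hs T e)) H \<le> \<epsilon>"
        using e by (simp add: L2_set_def real_le_lsqrt)
    qed auto
    finally show ?thesis by simp
  qed
  show thesis
  proof (rule that[OF F(1,2)])
    fix x :: 'a assume x: "norm x \<le> 1"
    have lim: "((\<lambda>H. (\<Sum>e\<in>H. (x \<bullet> e) *\<^sub>R op_of_hs T e) - (\<Sum>e\<in>F. (x \<bullet> e) *\<^sub>R op_of_hs T e))
        \<longlongrightarrow> op_of_hs T x - (\<Sum>e\<in>F. (x \<bullet> e) *\<^sub>R op_of_hs T e)) (finite_subsets_at_top some_basis)"
      using blinfun_expansion[OF some_basis, of x "op_of_hs T"] by (intro tendsto_intros) (simp add: has_sum_def)
    show "norm (op_of_hs T x - (\<Sum>e\<in>F. (x \<bullet> e) *\<^sub>R op_of_hs T e)) \<le> \<epsilon>"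
    proof (rule tendsto_upperbound[OF tendsto_norm[OF lim]])
      show "\<forall>\<^sub>F H in finite_subsets_at_top some_basis.
          norm ((\<Sum>e\<in>H. (x \<bullet> e) *\<^sub>R op_of_hs T e) - (\<Sum>e\<in>F. (x \<bullet> e) *\<^sub>R op_of_hs T e)) \<le> \<epsilon>"
        unfolding eventually_finite_subsets_at_top
      proof (intro exI[of _ F] conjI allI impI F(1,2))
        fix H assume H: "finite H \<and> F \<subseteq> H \<and> H \<subseteq> some_basis"
        then have "(\<Sum>e\<in>H. (x \<bullet> e) *\<^sub>R op_of_hs T e) - (\<Sum>e\<in>F. (x \<bullet> e) *\<^sub>R op_of_hs T e)
            = (\<Sum>e\<in>H - F. (x \<bullet> e) *\<^sub>R op_of_hs T e)" by (simp add: sum_diff)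
        then show "norm ((\<Sum>e\<in>H. (x \<bullet> e) *\<^sub>R op_of_hs T e) - (\<Sum>e\<in>F. (x \<bullet> e) *\<^sub>R op_of_hs T e)) \<le> \<epsilon>"
          using tail[OF x, of "H - F"] H by auto
      qed
    qed simp
  qed
qed

lemma hs_op_compact:
  fixes T :: "'a::{real_inner,banach} hs_op"
  shows "compact (closure (op_of_hs T ` cball 0 1))"
  unfolding compact_eq_totally_bounded complete_eq_closed
proof (intro conjI allI impI closed_closure)
  fix e :: real assume e: "e > 0"
  then have e3: "e / 3 > 0" by simp
  from hs_op_finite_rank_approx[OF e3, of T] obtain F where F: "finite F" "F \<subseteq> some_basis"
    and ap: "\<And>x. norm x \<le> 1 \<Longrightarrow> norm (op_of_hs T x - (\<Sum>e\<in>F. (x \<bullet> e) *\<^sub>R op_of_hs T e)) \<le> e / 3" by blast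
  let ?K = "{\<Sum>e\<in>F. a e *\<^sub>R op_of_hs T e | a. \<forall>e. \<bar>a e\<bar> \<le> 1}"
  from compact_bounded_combinations[OF F(1), of "op_of_hs T", unfolded compact_eq_totally_bounded] e3
  obtain D where D: "finite D" "?K \<subseteq> (\<Union>y\<in>D. ball y (e / 3))" by blast
  have "op_of_hs T ` cball 0 1 \<subseteq> (\<Union>y\<in>D. cball y (2 * e / 3))"
  proof
    fix z assume "z \<in> op_of_hs T ` cball 0 1"
    then obtain x where x: "norm x \<le> 1" and z: "z = op_of_hs T x" by auto
    \<comment> \<open>Outside \<open>F\<close> the coefficients are irrelevant; they are set to \<open>0\<close> to stay in \<open>?K\<close>.\<close>
    define a where "a e = (if e \<in> F then x \<bullet> e else 0)" for e
    have "\<bar>a e\<bar> \<le> 1" for e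
    proof (cases "e \<in> F")
      case True
      then have "norm e = 1" using F(2) orthonormal_some_basis
        unfolding orthonormal_def norm_eq_1 by (metis subsetD)
      then show ?thesis using Cauchy_Schwarz_ineq2[of x e] x True by (simp add: a_def)
    qed (simp add: a_def)
    moreover have "(\<Sum>e\<in>F. (x \<bullet> e) *\<^sub>R op_of_hs T e) = (\<Sum>e\<in>F. a e *\<^sub>R op_of_hs T e)"
      by (simp add: a_def)
    ultimately have "(\<Sum>e\<in>F. (x \<bullet> e) *\<^sub>R op_of_hs T e) \<in> ?K" by auto
    then obtain y where y: "y \<in> D" "dist y (\<Sum>e\<in>F. (x \<bullet> e) *\<^sub>R op_of_hs T e) < e / 3"
      using D(2) by auto
    have "dist y z \<le> dist y (\<Sum>e\<in>F. (x \<bullet> e) *\<^sub>R op_of_hs T e) + dist (\<Sum>e\<in>F. (x \<bullet> e) *\<^sub>R op_of_hs T e) z"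
      by (rule dist_triangle)
    also have "\<dots> \<le> e / 3 + e / 3"
      using y(2) ap[OF x] by (simp add: z dist_norm norm_minus_commute)
    finally show "z \<in> (\<Union>y\<in>D. cball y (2 * e / 3))" using y(1) by auto
  qed
  moreover have "closed (\<Union>y\<in>D. cball y (2 * e / 3))" using D(1) by (intro closed_UN) auto
  ultimately have "closure (op_of_hs T ` cball 0 1) \<subseteq> (\<Union>y\<in>D. cball y (2 * e / 3))"
    by (rule closure_minimal)
  also have "\<dots> \<subseteq> (\<Union>y\<in>D. ball y e)" using e by (intro UN_mono) auto
  finally show "\<exists>k. finite k \<and> closure (op_of_hs T ` cball 0 1) \<subseteq> (\<Union>x\<in>k. ball x e)" using D(1) by blast
qed

text \<open>
  The supremum \<open>c\<close> of the quadratic form on the unit ball of \<open>S\<close> is an eigenvalue: positivity gives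
  \<open>\<parallel>T x\<parallel>\<^sup>2 \<le> c \<langle>T x, x\<rangle>\<close>, so \<open>T x - c x\<close> tends to \<open>0\<close> along a maximising sequence, and compactness
  makes a subsequence converge.
\<close>

lemma positive_hs_op_eigenvector:
  fixes T :: "'a::{real_inner,banach} hs_op"
  assumes sym: "\<And>x y. op_of_hs T x \<bullet> y = x \<bullet> op_of_hs T y"
    and pos: "\<And>x. op_of_hs T x \<bullet> x \<ge> 0"
    and S: "subspace S" "closed S" and inv: "\<And>x. x \<in> S \<Longrightarrow> op_of_hs T x \<in> S"
    and x0: "x0 \<in> S" "op_of_hs T x0 \<bullet> x0 \<noteq> 0"
  obtains c x where "c > 0" "x \<in> S" "x \<noteq> 0" "op_of_hs T x = c *\<^sub>R x"
proof -
  define b where "b x = op_of_hs T x \<bullet> x" for x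
  define R where "R = b ` {x \<in> S. norm x \<le> 1}"
  have b_scale: "b (t *\<^sub>R x) = t\<^sup>2 * b x" for t x
    by (simp add: b_def blinfun.scaleR_right power2_eq_square)
  have bdd: "bdd_above R"
  proof (rule bdd_aboveI)
    fix r assume "r \<in> R"
    then obtain x where x: "norm x \<le> 1" "r = b x" by (auto simp: R_def)
    have "b x \<le> norm (op_of_hs T x) * norm x" unfolding b_def by (rule norm_cauchy_schwarz)
    also have "\<dots> \<le> (norm (op_of_hs T) * norm x) * norm x"
      by (intro mult_right_mono norm_blinfun) simp
    also have "\<dots> \<le> (norm (op_of_hs T) * 1) * 1" using x by (intro mult_mono) auto
    finally show "r \<le> norm (op_of_hs T)" using x by simp
  qed
  define c where "c = Sup R"
  have b_le: "b y \<le> c * (norm y)\<^sup>2" if "y \<in> S" for y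
  proof (cases "y = 0")
    case True
    then show ?thesis by (simp add: b_def)
  next
    case False
    have "b (inverse (norm y) *\<^sub>R y) \<in> R" unfolding R_def
      using that False S(1) by (auto simp: subspace_scale)
    then have "b (inverse (norm y) *\<^sub>R y) \<le> c" unfolding c_def by (rule cSup_upper[OF _ bdd])
    then show ?thesis using False by (simp add: b_scale power_inverse field_simps)
  qed
  have "b x0 > 0" using x0(2) pos[of x0] by (simp add: b_def)
  then have "0 < c * (norm x0)\<^sup>2" using b_le[OF x0(1)] by linarith
  then have c: "c > 0" by (simp add: zero_less_mult_iff)
  have T_le: "(norm (op_of_hs T x))\<^sup>2 \<le> c * b x" if x: "x \<in> S" for x
  proof -
    let ?y = "op_of_hs T x"
    \<comment> \<open>\<open>1 / c\<close> is the step that minimises the resulting quadratic bound.\<close>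
    have "0 \<le> b (x - (1 / c) *\<^sub>R ?y)" unfolding b_def by (rule pos)
    also have "\<dots> = b x - 2 / c * (norm ?y)\<^sup>2 + (1 / c)\<^sup>2 * b ?y"
      by (simp add: b_def blinfun.diff_right blinfun.scaleR_right inner_diff_left inner_diff_right
          sym[of ?y x] power2_norm_eq_inner) (simp add: power2_eq_square algebra_simps diff_divide_distrib)
    also have "\<dots> \<le> b x - 2 / c * (norm ?y)\<^sup>2 + (1 / c)\<^sup>2 * (c * (norm ?y)\<^sup>2)"
      using b_le[OF inv[OF x]] by (intro add_left_mono mult_left_mono) auto
    also have "\<dots> = b x - (norm ?y)\<^sup>2 / c" using c by (simp add: power2_eq_square field_simps)
    finally show ?thesis using c by (simp add: field_simps)
  qed
  have R: "R \<noteq> {}" using S(1) by (auto simp: R_def intro!: exI[of _ 0] subspace_0)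
  have "\<exists>x. x \<in> S \<and> norm x \<le> 1 \<and> b x > c - 1 / real (Suc n)" for n
  proof -
    have "c - 1 / real (Suc n) < Sup R" by (simp add: c_def)
    from less_cSupE[OF this R] show ?thesis by (auto simp: R_def)
  qed
  then obtain X where X: "\<And>n. X n \<in> S" "\<And>n. norm (X n) \<le> 1" "\<And>n. b (X n) > c - 1 / real (Suc n)"
    by metis
  have "(\<lambda>n. c * (1 / real (Suc n))) \<longlonglongrightarrow> c * 0"
    by (intro tendsto_intros) (use LIMSEQ_inverse_real_of_nat in \<open>simp add: inverse_eq_divide\<close>)
  then have c0: "(\<lambda>n. c * (1 / real (Suc n))) \<longlonglongrightarrow> 0" by simp
  have near: "(norm (op_of_hs T (X n) - c *\<^sub>R X n))\<^sup>2 \<le> c * (1 / real (Suc n))" for n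
  proof -
    have "(norm (op_of_hs T (X n) - c *\<^sub>R X n))\<^sup>2
        = (norm (op_of_hs T (X n)))\<^sup>2 - 2 * c * b (X n) + c\<^sup>2 * (norm (X n))\<^sup>2"
      unfolding b_def power2_norm_eq_inner
      by (simp add: inner_diff_left inner_diff_right inner_commute power2_eq_square)
    also have "\<dots> \<le> c * b (X n) - 2 * c * b (X n) + c\<^sup>2 * 1"
      using T_le[OF X(1)] X(2)[of n] c by (intro add_mono diff_mono mult_left_mono) (auto simp: power_le_one)
    also have "\<dots> = c * (c - b (X n))" by (simp add: algebra_simps power2_eq_square)
    also have "\<dots> \<le> c * (1 / real (Suc n))" using X(3)[of n] c by (intro mult_left_mono) auto
    finally show ?thesis .
  qed
  have "(\<lambda>n. (norm (op_of_hs T (X n) - c *\<^sub>R X n))\<^sup>2) \<longlonglongrightarrow> 0"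
    by (rule tendsto_sandwich[OF _ _ tendsto_const c0]) (use near in \<open>auto intro!: always_eventually\<close>)
  then have "(\<lambda>n. sqrt ((norm (op_of_hs T (X n) - c *\<^sub>R X n))\<^sup>2)) \<longlonglongrightarrow> sqrt 0" by (rule tendsto_real_sqrt)
  then have d0: "(\<lambda>n. op_of_hs T (X n) - c *\<^sub>R X n) \<longlonglongrightarrow> 0"
    by (simp add: tendsto_norm_zero_iff)
  have "op_of_hs T (X n) \<in> closure (op_of_hs T ` cball 0 1)" for n
    using X(2)[of n] by (intro subsetD[OF closure_subset] imageI) simp
  then have "\<forall>n. op_of_hs T (X n) \<in> closure (op_of_hs T ` cball 0 1)" by blast
  then obtain y r where r: "strict_mono r" "((\<lambda>n. op_of_hs T (X n)) \<circ> r) \<longlonglongrightarrow> y"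
    using seq_compactE[OF compact_imp_seq_compact[OF hs_op_compact[of T]], of "\<lambda>n. op_of_hs T (X n)"] by metis
  define x where "x = (1 / c) *\<^sub>R y"
  have "(\<lambda>n. (1 / c) *\<^sub>R (op_of_hs T (X (r n)) - (op_of_hs T (X (r n)) - c *\<^sub>R X (r n)))) \<longlonglongrightarrow> (1 / c) *\<^sub>R (y - 0)"
    using r(2) LIMSEQ_subseq_LIMSEQ[OF d0 r(1)] by (intro tendsto_intros) (simp_all add: comp_def)
  then have Xx: "(\<lambda>n. X (r n)) \<longlonglongrightarrow> x" using c by (simp add: x_def)
  have "(\<lambda>n. op_of_hs T (X (r n))) \<longlonglongrightarrow> op_of_hs T x" by (intro tendsto_intros Xx)
  moreover have "(\<lambda>n. op_of_hs T (X (r n))) \<longlonglongrightarrow> y" using r(2) by (simp add: comp_def)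
  ultimately have "op_of_hs T x = y" by (rule LIMSEQ_unique)
  then have Tx: "op_of_hs T x = c *\<^sub>R x" using c by (simp add: x_def)
  have xS: "x \<in> S" by (rule closed_sequentially[OF S(2) _ Xx]) (use X(1) in auto)
  have bl: "(\<lambda>n. b (X (r n))) \<longlonglongrightarrow> b x" unfolding b_def by (intro tendsto_intros Xx)
  have cl: "(\<lambda>n. c - 1 / real (Suc (r n))) \<longlonglongrightarrow> c - 0"
    using LIMSEQ_subseq_LIMSEQ[OF LIMSEQ_inverse_real_of_nat r(1)]
    by (intro tendsto_intros) (simp add: comp_def inverse_eq_divide)
  have "c - 0 \<le> b x"
    by (rule LIMSEQ_le[OF cl bl]) (use X(3) in \<open>auto intro: less_imp_le\<close>)
  then have "x \<noteq> 0" using c by (auto simp: b_def)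
  then show thesis using that c xS Tx by blast
qed

text \<open>
  Otherwise the orthogonal complement of the given eigenvectors, which is closed and invariant,
  would contain a further eigenvector with nonzero eigenvalue, while all of these lie in the span.
\<close>

lemma positive_hs_op_zero_off_eigenvectors:
  fixes T :: "'a::{real_inner,banach} hs_op"
  assumes sym: "\<And>x y. op_of_hs T x \<bullet> y = x \<bullet> op_of_hs T y"
    and pos: "\<And>x. op_of_hs T x \<bullet> x \<ge> 0"
    and eig: "\<And>l. op_of_hs T (u l) = lam l *\<^sub>R u l"
    and full: "\<And>c. c \<noteq> 0 \<Longrightarrow> eigenspace T c \<subseteq> span (range u)"
    and x: "\<And>l. x \<bullet> u l = 0"
  shows "op_of_hs T x \<bullet> x = 0"
proof (rule ccontr)
  assume nz: "op_of_hs T x \<bullet> x \<noteq> 0"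
  define S where "S = {x. \<forall>l. x \<bullet> u l = 0}"
  have sub: "subspace S" by (auto simp: S_def subspace_def inner_add_left)
  have cl: "closed S" unfolding S_def by (intro closed_Collect_all closed_Collect_eq continuous_intros)
  have inv: "op_of_hs T y \<in> S" if "y \<in> S" for y using that by (simp add: S_def sym eig)
  have "x \<in> S" using x by (simp add: S_def)
  from positive_hs_op_eigenvector[OF sym pos sub cl inv this nz] obtain c y
    where y: "c > 0" "y \<in> S" "y \<noteq> 0" "op_of_hs T y = c *\<^sub>R y" by blast
  then have "y \<in> span (range u)" using full[of c] by (auto simp: eigenspace_def)
  then have "y \<in> closure (span (range u))" using closure_subset by blast
  then have "y \<bullet> y = 0"
    by (rule orthogonal_closure_span[rotated]) (use y(2) in \<open>auto simp: S_def\<close>)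
  then show False using y(3) by simp
qed

section \<open>Sums of independent Hilbert space variables\<close>

lemma distr_iid_pair:
  assumes M: "prob_space M" and indep: "prob_space.indep_vars M (\<lambda>_. S) \<zeta> UNIV"
    and dist: "\<And>i. distr M S (\<zeta> i) = P" and ij: "i \<noteq> j"
  shows "distr M (S \<Otimes>\<^sub>M S) (\<lambda>\<omega>. (\<zeta> i \<omega>, \<zeta> j \<omega>)) = P \<Otimes>\<^sub>M P"
proof -
  interpret prob_space M by fact
  let ?r = "\<lambda>i \<omega>. restrict (\<lambda>i. \<zeta> i \<omega>) {i}"
  have "indep_var (PiM {i} (\<lambda>_. S)) (?r i) (PiM {j} (\<lambda>_. S)) (?r j)"
    by (rule indep_var_restrict[OF indep]) (use ij in auto)
  then have "indep_var S ((\<lambda>f. f i) \<circ> ?r i) S ((\<lambda>f. f j) \<circ> ?r j)"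
    by (rule indep_var_compose) auto
  then have "indep_var S (\<zeta> i) S (\<zeta> j)" by (simp add: comp_def)
  then show ?thesis by (simp add: indep_var_distribution_eq dist)
qed

text \<open>
  Mixed terms vanish: the pair of variables has a product distribution, and already the inner
  integral over one of them is \<open>0\<close>, as \<open>F\<close> has mean \<open>0\<close> in every direction.
\<close>

lemma norm_weighted_iid_sum:
  fixes F :: "'a \<Rightarrow> 'g::real_inner" and \<zeta> :: "'i \<Rightarrow> 'w \<Rightarrow> 'a"
  assumes M: "prob_space M" and indep: "prob_space.indep_vars M (\<lambda>_. S) \<zeta> UNIV"
    and dist: "\<And>i. distr M S (\<zeta> i) = P"
    and F: "strongly_measurable P F" and F2: "integrable P (\<lambda>x. (norm (F x))\<^sup>2)"
    and F0: "\<And>v. (\<integral>x. F x \<bullet> v \<partial>P) = 0" and I: "finite I"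
  shows "integrable M (\<lambda>\<omega>. (norm (\<Sum>i\<in>I. a i *\<^sub>R F (\<zeta> i \<omega>)))\<^sup>2)"
    and "(\<integral>\<omega>. (norm (\<Sum>i\<in>I. a i *\<^sub>R F (\<zeta> i \<omega>)))\<^sup>2 \<partial>M) = (\<Sum>i\<in>I. (a i)\<^sup>2) * (\<integral>x. (norm (F x))\<^sup>2 \<partial>P)"
proof -
  interpret prob_space M by fact
  have \<zeta> [measurable]: "\<zeta> i \<in> M \<rightarrow>\<^sub>M S" for i using indep by (simp add: indep_vars_def)
  have sP: "sets P = sets S" using dist[of undefined] by auto
  have \<zeta>P: "\<zeta> i \<in> M \<rightarrow>\<^sub>M P" for i using \<zeta> sP measurable_cong_sets by blast
  have P: "prob_space P" using prob_space_distr[OF \<zeta>[of undefined]] dist by simp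
  interpret P: prob_space P by fact
  interpret PP: pair_prob_space P P ..
  have F\<zeta>: "strongly_measurable M (\<lambda>\<omega>. F (\<zeta> i \<omega>))" for i by (rule strongly_measurable_comp[OF F \<zeta>P])
  have [measurable]: "(\<lambda>x. norm (F x)) \<in> borel_measurable S"
    using measurable_norm_strongly[OF F] sP measurable_cong_sets by blast
  have n2: "integrable M (\<lambda>\<omega>. (norm (F (\<zeta> i \<omega>)))\<^sup>2)"
    and n2': "(\<integral>\<omega>. (norm (F (\<zeta> i \<omega>)))\<^sup>2 \<partial>M) = (\<integral>x. (norm (F x))\<^sup>2 \<partial>P)" for i
  proof -
    show "integrable M (\<lambda>\<omega>. (norm (F (\<zeta> i \<omega>)))\<^sup>2)"
      using F2 unfolding dist[of i, symmetric] by (subst (asm) integrable_distr_eq) auto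
    show "(\<integral>\<omega>. (norm (F (\<zeta> i \<omega>)))\<^sup>2 \<partial>M) = (\<integral>x. (norm (F x))\<^sup>2 \<partial>P)"
      unfolding dist[of i, symmetric] by (subst integral_distr) auto
  qed
  have int: "integrable M (\<lambda>\<omega>. F (\<zeta> i \<omega>) \<bullet> F (\<zeta> j \<omega>))" for i j
  proof (rule Bochner_Integration.integrable_bound)
    show "integrable M (\<lambda>\<omega>. (norm (F (\<zeta> i \<omega>)))\<^sup>2 + (norm (F (\<zeta> j \<omega>)))\<^sup>2)"
      by (intro Bochner_Integration.integrable_add n2)
    show "(\<lambda>\<omega>. F (\<zeta> i \<omega>) \<bullet> F (\<zeta> j \<omega>)) \<in> borel_measurable M"
      by (rule measurable_inner_strongly[OF F\<zeta> F\<zeta>])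
    have "\<bar>x \<bullet> y\<bar> \<le> (norm x)\<^sup>2 + (norm y)\<^sup>2" for x y :: 'g
    proof -
      have "2 * (norm x * norm y) \<le> (norm x)\<^sup>2 + (norm y)\<^sup>2"
        using sum_squares_bound[of "norm x" "norm y"] by simp
      moreover have "0 \<le> norm x * norm y" by simp
      ultimately show ?thesis using Cauchy_Schwarz_ineq2[of x y] by linarith
    qed
    then show "AE \<omega> in M. norm (F (\<zeta> i \<omega>) \<bullet> F (\<zeta> j \<omega>)) \<le> norm ((norm (F (\<zeta> i \<omega>)))\<^sup>2 + (norm (F (\<zeta> j \<omega>)))\<^sup>2)"
      by simp
  qed
  have off: "(\<integral>\<omega>. F (\<zeta> i \<omega>) \<bullet> F (\<zeta> j \<omega>) \<partial>M) = 0" if ij: "i \<noteq> j" for i j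
  proof -
    define k where "k p = F (fst p) \<bullet> F (snd p)" for p
    have kP: "k \<in> borel_measurable (P \<Otimes>\<^sub>M P)" unfolding k_def
      by (intro measurable_inner_strongly strongly_measurable_comp[OF F] measurable_fst measurable_snd)
    have "sets (P \<Otimes>\<^sub>M P) = sets (S \<Otimes>\<^sub>M S)" by (intro sets_pair_measure_cong sP)
    then have kS [measurable]: "k \<in> borel_measurable (S \<Otimes>\<^sub>M S)" using kP measurable_cong_sets by blast
    note d = distr_iid_pair[OF M indep dist ij]
    have ik: "integrable (P \<Otimes>\<^sub>M P) k" unfolding d[symmetric]
      by (subst integrable_distr_eq) (use int[of i j] in \<open>auto simp: k_def\<close>)
    have "(\<integral>\<omega>. F (\<zeta> i \<omega>) \<bullet> F (\<zeta> j \<omega>) \<partial>M) = (\<integral>p. k p \<partial>(P \<Otimes>\<^sub>M P))" unfolding d[symmetric]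
      by (subst integral_distr) (auto simp: k_def)
    also have "\<dots> = (\<integral>x. (\<integral>y. k (x, y) \<partial>P) \<partial>P)" by (rule PP.integral_fst'[OF ik, symmetric])
    also have "\<dots> = 0" using F0 by (simp add: k_def inner_commute)
    finally show ?thesis .
  qed
  have exp: "(norm (\<Sum>i\<in>I. a i *\<^sub>R F (\<zeta> i \<omega>)))\<^sup>2 = (\<Sum>i\<in>I. \<Sum>j\<in>I. a i * (a j * (F (\<zeta> i \<omega>) \<bullet> F (\<zeta> j \<omega>))))" for \<omega>
    by (simp add: power2_norm_eq_inner inner_sum_left inner_sum_right sum_distrib_left inner_commute mult.left_commute)
  show "integrable M (\<lambda>\<omega>. (norm (\<Sum>i\<in>I. a i *\<^sub>R F (\<zeta> i \<omega>)))\<^sup>2)"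
    unfolding exp using int by simp
  have "(\<integral>\<omega>. (norm (\<Sum>i\<in>I. a i *\<^sub>R F (\<zeta> i \<omega>)))\<^sup>2 \<partial>M)
      = (\<Sum>i\<in>I. \<Sum>j\<in>I. a i * (a j * (\<integral>\<omega>. F (\<zeta> i \<omega>) \<bullet> F (\<zeta> j \<omega>) \<partial>M)))"
    unfolding exp using int by simp
  also have "\<dots> = (\<Sum>i\<in>I. \<Sum>j\<in>I. if j = i then (a i)\<^sup>2 * (\<integral>x. (norm (F x))\<^sup>2 \<partial>P) else 0)"
    using off n2' by (intro sum.cong refl) (auto simp: power2_eq_square power2_norm_eq_inner[symmetric])
  also have "\<dots> = (\<Sum>i\<in>I. (a i)\<^sup>2) * (\<integral>x. (norm (F x))\<^sup>2 \<partial>P)"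
    using I by (simp add: sum_distrib_right)
  finally show "(\<integral>\<omega>. (norm (\<Sum>i\<in>I. a i *\<^sub>R F (\<zeta> i \<omega>)))\<^sup>2 \<partial>M) = (\<Sum>i\<in>I. (a i)\<^sup>2) * (\<integral>x. (norm (F x))\<^sup>2 \<partial>P)" .
qed

section \<open>The covariance operator and its eigenvectors\<close>

text \<open>
  For the vectors of \<open>eigenvector_sequence\<close> this is the orthogonal projection onto the complement of
  the first \<open>K\<close> of them; indices with \<open>u l = 0\<close> contribute nothing.
\<close>

definition truncation_residual :: "(nat \<Rightarrow> 'g::real_inner) \<Rightarrow> nat \<Rightarrow> 'g \<Rightarrow> 'g" where
  "truncation_residual u K x = x - (\<Sum>l<K. (x \<bullet> u l) *\<^sub>R u l)"

lemma norm_truncation_residual: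
  fixes u :: "nat \<Rightarrow> 'g::real_inner"
  assumes "\<And>l m. u l \<bullet> u m = (if l = m \<and> lam l \<noteq> 0 then 1 else 0)"
  shows "(norm (truncation_residual u K x))\<^sup>2 = (norm x)\<^sup>2 - (\<Sum>l<K. (x \<bullet> u l)\<^sup>2)"
proof -
  let ?s = "\<Sum>l<K. (x \<bullet> u l) *\<^sub>R u l"
  have z: "u l = 0" if "lam l = 0" for l using assms[of l l] that by simp
  have "?s \<bullet> ?s = (\<Sum>l<K. \<Sum>m<K. (x \<bullet> u l) * ((x \<bullet> u m) * (u m \<bullet> u l)))"
    by (simp add: inner_sum_left inner_sum_right sum_distrib_left inner_commute mult.left_commute)
  also have "\<dots> = (\<Sum>l<K. \<Sum>m<K. if m = l then (x \<bullet> u l)\<^sup>2 else 0)"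
    using z by (intro sum.cong refl) (auto simp: assms power2_eq_square)
  also have "\<dots> = (\<Sum>l<K. (x \<bullet> u l)\<^sup>2)" by simp
  finally have ss: "?s \<bullet> ?s = (\<Sum>l<K. (x \<bullet> u l)\<^sup>2)" .
  have xs: "x \<bullet> ?s = (\<Sum>l<K. (x \<bullet> u l)\<^sup>2)" by (simp add: inner_sum_right power2_eq_square)
  show ?thesis
    unfolding truncation_residual_def power2_norm_eq_inner
    by (simp add: inner_diff_left inner_diff_right inner_commute[of ?s x] ss xs)
qed

lemma norm_truncation_residual_le:
  fixes u :: "nat \<Rightarrow> 'g::real_inner"
  assumes "\<And>l m. u l \<bullet> u m = (if l = m \<and> lam l \<noteq> 0 then 1 else 0)"
  shows "(norm (truncation_residual u K x))\<^sup>2 \<le> (norm x)\<^sup>2"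
  unfolding norm_truncation_residual[OF assms] by (simp add: sum_nonneg)

lemma truncation_residual_symmetric:
  "truncation_residual u K x \<bullet> y = x \<bullet> truncation_residual u K y"
  by (simp add: truncation_residual_def inner_diff_left inner_diff_right inner_sum_left inner_sum_right
      inner_commute mult.commute)

lemma bounded_linear_truncation_residual: "bounded_linear (truncation_residual u K)"
  unfolding truncation_residual_def
  by (intro bounded_linear_sub bounded_linear_ident bounded_linear_sum
      bounded_linear_compose[OF bounded_linear_scaleR_left bounded_linear_inner_left])

text \<open>
  The eigenvectors exhaust \<open>F\<close>: a direction \<open>y\<close> orthogonal to all of them satisfies
  \<open>\<integral> \<langle>F, y\<rangle>\<^sup>2 = \<langle>T y, y\<rangle> = 0\<close>, and countably many such directions suffice because \<open>F\<close> is a limit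
  of simple functions.
\<close>

lemma covariance_eigenexpansion:
  fixes F :: "'a \<Rightarrow> 'g::{real_inner,banach}"
  assumes P: "prob_space P" and F: "strongly_measurable P F"
    and F2: "integrable P (\<lambda>x. (norm (F x))\<^sup>2)"
    and T: "\<And>x y. op_of_hs T x \<bullet> y = (\<integral>w. (F w \<bullet> x) * (F w \<bullet> y) \<partial>P)"
    and lam: "eigenvalue_sequence T lam"
  obtains u :: "nat \<Rightarrow> 'g" where
    "\<And>l m. u l \<bullet> u m = (if l = m \<and> lam l \<noteq> 0 then 1 else 0)"
    "\<And>l. op_of_hs T (u l) = lam l *\<^sub>R u l" "\<And>l. lam l \<ge> 0" "summable lam"
    "(\<lambda>K. \<integral>w. (norm (truncation_residual u K (F w)))\<^sup>2 \<partial>P) \<longlonglongrightarrow> 0"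
proof -
  interpret prob_space P by fact
  have sym: "op_of_hs T x \<bullet> y = x \<bullet> op_of_hs T y" for x y
    using T[of x y] T[of y x] by (simp add: inner_commute mult.commute)
  have pos: "op_of_hs T x \<bullet> x \<ge> 0" for x by (simp add: T)
  have Fm [measurable]: "(\<lambda>w. F w \<bullet> x) \<in> borel_measurable P" for x
    by (rule measurable_inner_strongly[OF F strongly_measurable_const])
  have sq: "integrable P (\<lambda>w. (F w \<bullet> x)\<^sup>2)" for x
  proof (rule Bochner_Integration.integrable_bound)
    show "integrable P (\<lambda>w. (norm (F w))\<^sup>2 * (norm x)\<^sup>2)" using F2 by simp
    have "(F w \<bullet> x)\<^sup>2 \<le> (norm (F w) * norm x)\<^sup>2" for w
      by (rule power2_le_iff_abs_le[THEN iffD2]) (auto simp: Cauchy_Schwarz_ineq2)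
    then show "AE w in P. norm ((F w \<bullet> x)\<^sup>2) \<le> norm ((norm (F w))\<^sup>2 * (norm x)\<^sup>2)"
      by (simp add: power_mult_distrib)
  qed measurable
  obtain u where u: "\<And>l m. u l \<bullet> u m = (if l = m \<and> lam l \<noteq> 0 then 1 else 0)"
    and eig: "\<And>l. op_of_hs T (u l) = lam l *\<^sub>R u l"
    and full: "\<And>c. c \<noteq> 0 \<Longrightarrow> eigenspace T c = span (u ` {l. lam l = c})"
    using eigenvector_sequence[OF lam sym] by blast
  have u0: "u l = 0" if "lam l = 0" for l using u[of l l] that by simp
  have lamE: "(\<integral>w. (F w \<bullet> u l)\<^sup>2 \<partial>P) = lam l" for l
    using T[of "u l" "u l"] by (cases "lam l = 0") (simp_all add: eig u power2_eq_square)
  have lam0: "lam l \<ge> 0" for l using lamE[of l] by (metis integral_nonneg_AE zero_le_power2 AE_I2)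
  note res = norm_truncation_residual[OF u]
  have resE: "(\<integral>w. (norm (truncation_residual u K (F w)))\<^sup>2 \<partial>P) = (\<integral>w. (norm (F w))\<^sup>2 \<partial>P) - (\<Sum>l<K. lam l)" for K
    unfolding res using F2 sq by (simp add: lamE)
  have "(\<Sum>l<K. lam l) \<le> (\<integral>w. (norm (F w))\<^sup>2 \<partial>P)" for K
  proof -
    have "0 \<le> (\<integral>w. (norm (truncation_residual u K (F w)))\<^sup>2 \<partial>P)" by simp
    then show ?thesis unfolding resE by simp
  qed
  then have summ: "summable lam" by (rule summableI_nonneg_bounded[OF lam0])
  \<comment> \<open>The orthogonal projection onto the closed span of the eigenvectors.\<close>
  define s where "s x = (\<Sum>l. (x \<bullet> u l) *\<^sub>R u l)" for x
  have s: "(\<lambda>l. (x \<bullet> u l) *\<^sub>R u l) sums s x" and orth: "\<And>l. (x - s x) \<bullet> u l = 0" for x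
  proof -
    let ?J = "{l. lam l \<noteq> 0}"
    have inj: "inj_on u ?J"
      by (rule inj_onI) (metis (mono_tags, lifting) mem_Collect_eq u zero_neq_one)
    have on: "orthonormal (u ` ?J)"
      unfolding orthonormal_def using inj by (auto simp: u inj_on_def)
    obtain r where r: "((\<lambda>e. (x \<bullet> e) *\<^sub>R e) has_sum r) (u ` ?J)" "\<And>e. e \<in> u ` ?J \<Longrightarrow> (x - r) \<bullet> e = 0"
      using orthonormal_residual[OF on] by blast
    from r(1) have "((\<lambda>l. (x \<bullet> u l) *\<^sub>R u l) has_sum r) ?J"
      by (simp add: has_sum_reindex[OF inj] comp_def)
    then have "((\<lambda>l. (x \<bullet> u l) *\<^sub>R u l) has_sum r) UNIV"
      by (rule has_sum_cong_neutral[THEN iffD1, rotated -1]) (auto simp: u0)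
    then have "(\<lambda>l. (x \<bullet> u l) *\<^sub>R u l) sums r" by (rule has_sum_imp_sums)
    moreover from this have "s x = r" unfolding s_def by (rule sums_unique[symmetric])
    ultimately show "(\<lambda>l. (x \<bullet> u l) *\<^sub>R u l) sums s x" by simp
    show "(x - s x) \<bullet> u l = 0" for l
      using r(2)[of "u l"] u0[of l] \<open>s x = r\<close> by (cases "lam l = 0") auto
  qed
  have cross: "(x - s x) \<bullet> s d = 0" for x d
  proof -
    have "(\<lambda>l. (x - s x) \<bullet> ((d \<bullet> u l) *\<^sub>R u l)) sums ((x - s x) \<bullet> s d)"
      by (rule bounded_linear.sums[OF bounded_linear_inner_right s])
    then show ?thesis using orth[of x] by (simp add: sums_iff)
  qed
  obtain t where tf: "\<And>i::nat. finite (t i ` space P)" and tl: "\<And>w. w \<in> space P \<Longrightarrow> (\<lambda>i. t i w) \<longlonglongrightarrow> F w"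
    using strongly_measurable_finite_range_approx[OF F] by blast
  define D where "D = (\<Union>i. t i ` space P)"
  have "countable D" unfolding D_def using tf by (intro countable_UN) (auto intro: countable_finite)
  moreover have "AE w in P. F w \<bullet> (d - s d) = 0" for d
  proof -
    have "op_of_hs T (d - s d) \<bullet> (d - s d) = 0"
    proof (rule positive_hs_op_zero_off_eigenvectors[OF sym pos eig])
      show "eigenspace T c \<subseteq> span (range u)" if "c \<noteq> 0" for c
        unfolding full[OF that] by (intro span_mono) auto
    qed (rule orth)
    then have "(\<integral>w. (F w \<bullet> (d - s d))\<^sup>2 \<partial>P) = 0" by (simp add: T power2_eq_square)
    then have "AE w in P. (F w \<bullet> (d - s d))\<^sup>2 = 0"
      by (subst (asm) integral_nonneg_eq_0_iff_AE[OF sq]) auto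
    then show ?thesis by simp
  qed
  ultimately have ae: "AE w in P. \<forall>d\<in>D. F w \<bullet> (d - s d) = 0" by (subst AE_ball_countable) auto
  have zero: "AE w in P. F w - s (F w) = 0"
    using ae AE_space
  proof eventually_elim
    case (elim w)
    let ?r = "F w - s (F w)"
    have "?r \<bullet> t i w = 0" for i
    proof -
      have "F w \<bullet> (t i w - s (t i w)) = 0" using elim by (auto simp: D_def)
      moreover have "s (F w) \<bullet> (t i w - s (t i w)) = 0" using cross[of "t i w" "F w"] by (simp add: inner_commute)
      ultimately have "?r \<bullet> (t i w - s (t i w)) = 0" by (simp add: inner_diff_left)
      then show ?thesis using cross[of "F w" "t i w"] by (simp add: inner_diff_right)
    qed
    moreover have "(\<lambda>i. ?r \<bullet> t i w) \<longlonglongrightarrow> ?r \<bullet> F w" by (intro tendsto_intros tl elim)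
    ultimately have "?r \<bullet> F w = 0" by (simp add: LIMSEQ_const_iff)
    then have "?r \<bullet> ?r = 0" using cross[of "F w" "F w"] by (subst inner_diff_right) simp
    then show ?case by simp
  qed
  have tr: "strongly_measurable P (\<lambda>w. truncation_residual u K (F w))" for K
    by (rule strongly_measurable_continuous[OF F])
      (intro bounded_linear.continuous_on[OF bounded_linear_truncation_residual] continuous_on_id)
  have "(\<lambda>K. \<integral>w. (norm (truncation_residual u K (F w)))\<^sup>2 \<partial>P) \<longlonglongrightarrow> (\<integral>w. 0 \<partial>P)"
  proof (rule integral_dominated_convergence[where w = "\<lambda>w. (norm (F w))\<^sup>2"])
    show "AE w in P. (\<lambda>K. (norm (truncation_residual u K (F w)))\<^sup>2) \<longlonglongrightarrow> 0"
      using zero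
    proof eventually_elim
      case (elim w)
      have "(\<lambda>K. (norm (F w - (\<Sum>l<K. (F w \<bullet> u l) *\<^sub>R u l)))\<^sup>2) \<longlonglongrightarrow> (norm (F w - s (F w)))\<^sup>2"
        using s[of "F w"] by (intro tendsto_intros) (simp add: sums_def)
      then show ?case using elim by (simp add: truncation_residual_def)
    qed
    show "AE w in P. norm ((norm (truncation_residual u K (F w)))\<^sup>2) \<le> (norm (F w))\<^sup>2" for K
      using norm_truncation_residual_le[OF u] by simp
    show "(\<lambda>w. (norm (truncation_residual u K (F w)))\<^sup>2) \<in> borel_measurable P" for K
      using measurable_norm_strongly[OF tr] by measurable
  qed (use F2 in auto)
  then have "(\<lambda>K. \<integral>w. (norm (truncation_residual u K (F w)))\<^sup>2 \<partial>P) \<longlonglongrightarrow> 0" by simp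
  then show thesis by (rule that[OF u eig lam0 summ])
qed

text \<open>
  The expectation of the series is the sum of the weights, hence finite.
\<close>

lemma AE_summable_weighted_squares:
  fixes Z :: "nat \<Rightarrow> 'v \<Rightarrow> real"
  assumes L: "prob_space L" and Z: "\<And>l. distributed L lborel (Z l) std_normal_density"
    and lam: "\<And>l. lam l \<ge> 0" "summable lam"
  shows "AE v in L. summable (\<lambda>l. lam l * (Z l v)\<^sup>2)"
proof -
  have [measurable]: "Z l \<in> borel_measurable L" for l
    using distributed_measurable[OF Z[of l]] by simp
  have dZ: "distr L borel (Z l) = std_normal_distribution" for l
    using Z[of l] by (metis distributed_distr_eq_density distr_cong sets_lborel)
  have E: "(\<integral>\<^sup>+v. ennreal (lam l * (Z l v)\<^sup>2) \<partial>L) = ennreal (lam l)" for l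
  proof -
    have "(\<integral>\<^sup>+v. ennreal (lam l * (Z l v)\<^sup>2) \<partial>L) = (\<integral>\<^sup>+x. ennreal (lam l * x\<^sup>2) \<partial>distr L borel (Z l))"
      by (subst nn_integral_distr) auto
    also have "\<dots> = ennreal (\<integral>x. lam l * x\<^sup>2 \<partial>std_normal_distribution)"
      unfolding dZ using integrable_std_normal_distribution_moment[of 2] lam(1)
      by (intro nn_integral_eq_integral) auto
    also have "(\<integral>x. lam l * x\<^sup>2 \<partial>std_normal_distribution) = lam l"
      using std_normal_distribution_even_moments[of 1] by (simp add: fact_numeral)
    finally show ?thesis .
  qed
  have "(\<integral>\<^sup>+v. (\<Sum>l. ennreal (lam l * (Z l v)\<^sup>2)) \<partial>L) = (\<Sum>l. \<integral>\<^sup>+v. ennreal (lam l * (Z l v)\<^sup>2) \<partial>L)"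
    by (rule nn_integral_suminf) auto
  also have "\<dots> \<noteq> \<infinity>" unfolding E using lam by (simp add: suminf_ennreal2)
  finally have "AE v in L. (\<Sum>l. ennreal (lam l * (Z l v)\<^sup>2)) \<noteq> \<infinity>"
    by (intro nn_integral_noteq_infinite) auto
  then show ?thesis
    by eventually_elim (rule summable_suminf_not_top, use lam(1) in auto)
qed

section \<open>The central limit theorem for squared norms\<close>

lemma abs_exp_minus_diff_le:
  fixes x y :: real
  assumes "0 \<le> x" "0 \<le> y"
  shows "\<bar>exp (- x) - exp (- y)\<bar> \<le> \<bar>x - y\<bar>"
proof -
  have *: "exp (- a) - exp (- b) \<le> b - a" if "0 \<le> a" "a \<le> b" for a b :: real
  proof -
    have "1 - exp (a - b) \<le> b - a" using exp_ge_add_one_self[of "a - b"] by linarith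
    then have "exp (- a) * (1 - exp (a - b)) \<le> 1 * (b - a)"
      using that by (intro mult_mono) auto
    then show ?thesis by (simp add: algebra_simps flip: exp_add)
  qed
  show ?thesis
  proof (cases "x \<le> y")
    case True
    moreover from True have "exp (- y) \<le> exp (- x)" by simp
    ultimately show ?thesis using *[of x y] assms by (simp add: abs_if)
  next
    case False
    then have yx: "y \<le> x" by simp
    moreover from yx have "exp (- x) \<le> exp (- y)" by simp
    ultimately show ?thesis using *[of y x] assms by (simp add: abs_if)
  qed
qed

text \<open>
  The weighted sum \<open>G\<close> is replaced by its first \<open>K\<close> coordinates in the eigenbasis, at the price of
  \<open>s E \<parallel>R\<^sub>K G\<parallel>\<^sup>2 = s (\<Sum>a\<^sup>2) E \<parallel>R\<^sub>K F\<parallel>\<^sup>2\<close> for the residual map \<open>R\<^sub>K\<close>. This error is small for large \<open>K\<close>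
  uniformly in \<open>N\<close>, so the limits in \<open>N\<close> and \<open>K\<close> may be taken one after the other.
\<close>

lemma laplace_norm_weighted_iid_sum_tendsto:
  fixes F :: "'a \<Rightarrow> 'g::{real_inner,banach}" and \<zeta> :: "'i \<Rightarrow> 'w \<Rightarrow> 'a" and a :: "nat \<Rightarrow> 'i \<Rightarrow> real"
    and Z :: "nat \<Rightarrow> 'v \<Rightarrow> real"
  assumes M: "prob_space M" and indep: "prob_space.indep_vars M (\<lambda>_. S) \<zeta> UNIV"
    and dist: "\<And>i. distr M S (\<zeta> i) = P"
    and F: "strongly_measurable P F" and F2: "integrable P (\<lambda>x. (norm (F x))\<^sup>2)"
    and F0: "\<And>v. (\<integral>x. F x \<bullet> v \<partial>P) = 0"
    and T: "\<And>x y. op_of_hs T x \<bullet> y = (\<integral>w. (F w \<bullet> x) * (F w \<bullet> y) \<partial>P)"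
    and lam: "eigenvalue_sequence T lam"
    and fin: "\<And>N. finite (I N)"
    and small: "\<And>\<delta>. \<delta> > 0 \<Longrightarrow> \<forall>\<^sub>F N in sequentially. \<forall>i\<in>I N. \<bar>a N i\<bar> \<le> \<delta>"
    and sq: "(\<lambda>N. \<Sum>i\<in>I N. (a N i)\<^sup>2) \<longlonglongrightarrow> \<kappa>"
    and L: "prob_space L" and Zi: "prob_space.indep_vars L (\<lambda>_. borel) Z UNIV"
    and Z: "\<And>l. distributed L lborel (Z l) std_normal_density"
    and s: "s \<ge> 0"
  shows "(\<lambda>N. \<integral>\<omega>. exp (- (s * (norm (\<Sum>i\<in>I N. a N i *\<^sub>R F (\<zeta> i \<omega>)))\<^sup>2)) \<partial>M)
           \<longlonglongrightarrow> (\<integral>v. exp (- (s * (\<kappa> * (\<Sum>l. lam l * (Z l v)\<^sup>2)))) \<partial>L)"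
proof -
  interpret M: prob_space M by fact
  interpret L: prob_space L by fact
  have \<zeta> [measurable]: "\<zeta> i \<in> M \<rightarrow>\<^sub>M S" for i using indep by (simp add: M.indep_vars_def)
  have sP: "sets P = sets S" using dist[of undefined] by auto
  have \<zeta>P: "\<zeta> i \<in> M \<rightarrow>\<^sub>M P" for i using \<zeta> sP measurable_cong_sets by blast
  have P: "prob_space P" using M.prob_space_distr[OF \<zeta>[of undefined]] dist by simp
  interpret P: prob_space P by fact
  have [measurable]: "Z l \<in> borel_measurable L" for l using Zi by (simp add: L.indep_vars_def)
  have \<kappa>0: "\<kappa> \<ge> 0" using sq by (rule LIMSEQ_le_const) (auto simp: sum_nonneg)
  obtain u where u: "\<And>l m. u l \<bullet> u m = (if l = m \<and> lam l \<noteq> 0 then 1 else 0)"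
    and eig: "\<And>l. op_of_hs T (u l) = lam l *\<^sub>R u l"
    and lam0: "\<And>l. lam l \<ge> 0" and summ: "summable lam"
    and tail: "(\<lambda>K. \<integral>w. (norm (truncation_residual u K (F w)))\<^sup>2 \<partial>P) \<longlonglongrightarrow> 0"
    using covariance_eigenexpansion[OF P F F2 T lam] by blast
  define \<tau> where "\<tau> K = (\<integral>w. (norm (truncation_residual u K (F w)))\<^sup>2 \<partial>P)" for K
  define G where "G N \<omega> = (\<Sum>i\<in>I N. a N i *\<^sub>R F (\<zeta> i \<omega>))" for N \<omega>
  have G: "strongly_measurable M (G N)" for N unfolding G_def
    by (intro strongly_measurable_sum strongly_measurable_scaleR strongly_measurable_comp[OF F \<zeta>P])
  have Gu [measurable]: "(\<lambda>\<omega>. G N \<omega> \<bullet> v) \<in> borel_measurable M" for N v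
    by (rule measurable_inner_strongly[OF G strongly_measurable_const])
  have Gn [measurable]: "(\<lambda>\<omega>. norm (G N \<omega>)) \<in> borel_measurable M" for N
    by (rule measurable_norm_strongly[OF G])
  define A where "A N K = (\<integral>\<omega>. exp (- (s * (\<Sum>l<K. (G N \<omega> \<bullet> u l)\<^sup>2))) \<partial>M)" for N K
  define B where "B K = (\<integral>v. exp (- (s * (\<kappa> * (\<Sum>l<K. lam l * (Z l v)\<^sup>2)))) \<partial>L)" for K
  let ?A = "\<lambda>N. \<integral>\<omega>. exp (- (s * (norm (G N \<omega>))\<^sup>2)) \<partial>M"
  let ?B = "\<integral>v. exp (- (s * (\<kappa> * (\<Sum>l. lam l * (Z l v)\<^sup>2)))) \<partial>L"
  have A_lim: "(\<lambda>N. A N K) \<longlonglongrightarrow> B K" for K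
  proof -
    have "(\<lambda>N. \<integral>\<omega>. exp (- ((\<Sum>l<K. (sqrt (2 * s) * (G N \<omega> \<bullet> u l))\<^sup>2) / 2)) \<partial>M)
        \<longlonglongrightarrow> (\<integral>v. exp (- ((\<Sum>l<K. (2 * s * \<kappa> * lam l) * (Z l v)\<^sup>2) / 2)) \<partial>L)"
    proof (rule laplace_quadratic_tendsto[OF L Zi Z M])
      fix c :: "nat \<Rightarrow> real"
      \<comment> \<open>A combination of coordinates of \<open>G\<close> is the weighted sum of the real variables \<open>F \<bullet> y\<close>. The factor
         \<open>sqrt (2 s)\<close> turns \<open>exp (- s g\<^sup>2)\<close> into \<open>exp (- g\<^sup>2 / 2)\<close>.\<close>
      define y where "y = (\<Sum>l<K. (c l * sqrt (2 * s)) *\<^sub>R u l)"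
      have "op_of_hs T y \<bullet> y = (\<Sum>l<K. \<Sum>m<K. (c l * sqrt (2 * s)) * ((c m * sqrt (2 * s)) * (lam m * (u m \<bullet> u l))))"
        by (simp add: y_def blinfun.sum_right blinfun.scaleR_right eig inner_sum_left inner_sum_right sum_distrib_left mult.assoc)
      also have "\<dots> = (\<Sum>l<K. \<Sum>m<K. if m = l then 2 * s * lam l * (c l)\<^sup>2 else 0)"
        using s by (intro sum.cong refl) (auto simp: u power2_eq_square)
      also have "\<dots> = (\<Sum>l<K. 2 * s * lam l * (c l)\<^sup>2)" by simp
      finally have Ty: "(\<integral>w. (F w \<bullet> y)\<^sup>2 \<partial>P) = (\<Sum>l<K. 2 * s * lam l * (c l)\<^sup>2)"
        using T[of y y] by (simp add: power2_eq_square)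
      have Fy: "(\<lambda>w. F w \<bullet> y) \<in> borel_measurable P"
        by (rule measurable_inner_strongly[OF F strongly_measurable_const])
      have Fy2: "integrable P (\<lambda>w. (F w \<bullet> y)\<^sup>2)"
      proof (rule Bochner_Integration.integrable_bound)
        show "integrable P (\<lambda>w. (norm (F w))\<^sup>2 * (norm y)\<^sup>2)" using F2 by simp
        have "(F w \<bullet> y)\<^sup>2 \<le> (norm (F w) * norm y)\<^sup>2" for w
          by (rule power2_le_iff_abs_le[THEN iffD2]) (auto simp: Cauchy_Schwarz_ineq2)
        then show "AE w in P. norm ((F w \<bullet> y)\<^sup>2) \<le> norm ((norm (F w))\<^sup>2 * (norm y)\<^sup>2)"
          by (simp add: power_mult_distrib)
      qed (use Fy in measurable)
      from char_weighted_iid_sum_tendsto[OF M indep dist Fy Fy2 F0 fin small sq]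
      have "(\<lambda>N. \<integral>\<omega>. iexp (\<Sum>i\<in>I N. a N i * (F (\<zeta> i \<omega>) \<bullet> y)) \<partial>M)
          \<longlonglongrightarrow> complex_of_real (exp (- (\<kappa> * (\<Sum>l<K. 2 * s * lam l * (c l)\<^sup>2) / 2)))"
        unfolding Ty .
      moreover have "(\<Sum>i\<in>I N. a N i * (F (\<zeta> i \<omega>) \<bullet> y)) = (\<Sum>l<K. c l * (sqrt (2 * s) * (G N \<omega> \<bullet> u l)))" for N \<omega>
      proof -
        have "(\<Sum>i\<in>I N. a N i * (F (\<zeta> i \<omega>) \<bullet> y)) = G N \<omega> \<bullet> y" by (simp add: G_def inner_sum_left)
        also have "\<dots> = (\<Sum>l<K. c l * (sqrt (2 * s) * (G N \<omega> \<bullet> u l)))"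
          by (simp add: y_def inner_sum_right mult.assoc)
        finally show ?thesis .
      qed
      moreover have "\<kappa> * (\<Sum>l<K. 2 * s * lam l * (c l)\<^sup>2) = (\<Sum>l<K. 2 * s * \<kappa> * lam l * (c l)\<^sup>2)"
        by (simp add: sum_distrib_left mult.assoc mult.left_commute)
      ultimately show "(\<lambda>N. \<integral>\<omega>. iexp (\<Sum>l<K. c l * (sqrt (2 * s) * (G N \<omega> \<bullet> u l))) \<partial>M)
          \<longlonglongrightarrow> complex_of_real (exp (- ((\<Sum>l<K. 2 * s * \<kappa> * lam l * (c l)\<^sup>2) / 2)))" by simp
    qed measurable
    moreover have "(\<Sum>l<K. (sqrt (2 * s) * (G N \<omega> \<bullet> u l))\<^sup>2) / 2 = s * (\<Sum>l<K. (G N \<omega> \<bullet> u l)\<^sup>2)" for N \<omega>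
      using s by (simp add: power_mult_distrib sum_distrib_left[symmetric])
    moreover have "(\<Sum>l<K. (2 * s * \<kappa> * lam l) * (Z l v)\<^sup>2) / 2 = s * (\<kappa> * (\<Sum>l<K. lam l * (Z l v)\<^sup>2))" for v
      by (simp add: sum_distrib_left sum_divide_distrib mult.assoc)
    ultimately show ?thesis by (simp add: A_def B_def)
  qed
  have B_lim: "B \<longlonglongrightarrow> ?B" unfolding B_def
  proof (rule integral_dominated_convergence[where w = "\<lambda>_. 1"])
    show "AE v in L. (\<lambda>K. exp (- (s * (\<kappa> * (\<Sum>l<K. lam l * (Z l v)\<^sup>2))))) \<longlonglongrightarrow> exp (- (s * (\<kappa> * (\<Sum>l. lam l * (Z l v)\<^sup>2))))"
      using AE_summable_weighted_squares[OF L Z lam0 summ]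
      by eventually_elim (intro tendsto_intros summable_LIMSEQ)
    show "AE v in L. norm (exp (- (s * (\<kappa> * (\<Sum>l<K. lam l * (Z l v)\<^sup>2))))) \<le> 1" for K
      using s \<kappa>0 lam0 by (intro AE_I2) (simp add: sum_nonneg)
  qed auto
  have gap: "\<bar>?A N - A N K\<bar> \<le> s * ((\<Sum>i\<in>I N. (a N i)\<^sup>2) * \<tau> K)" for N K
  proof -
    let ?R = "truncation_residual u K"
    interpret R: bounded_linear ?R by (rule bounded_linear_truncation_residual)
    have RF: "strongly_measurable P (\<lambda>w. ?R (F w))"
      by (rule strongly_measurable_continuous[OF F]) (intro R.continuous_on continuous_on_id)
    have [measurable]: "(\<lambda>w. norm (?R (F w))) \<in> borel_measurable P" by (rule measurable_norm_strongly[OF RF])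
    have RF2: "integrable P (\<lambda>w. (norm (?R (F w)))\<^sup>2)"
    proof (rule Bochner_Integration.integrable_bound[OF F2])
      show "AE w in P. norm ((norm (?R (F w)))\<^sup>2) \<le> norm ((norm (F w))\<^sup>2)"
        using norm_truncation_residual_le[OF u] by simp
    qed measurable
    have RF0: "(\<integral>w. ?R (F w) \<bullet> v \<partial>P) = 0" for v by (simp add: truncation_residual_symmetric F0)
    have RG: "?R (G N \<omega>) = (\<Sum>i\<in>I N. a N i *\<^sub>R ?R (F (\<zeta> i \<omega>)))" for \<omega>
      by (simp add: G_def R.sum R.scaleR)
    note RGi = norm_weighted_iid_sum[OF M indep dist RF RF2 RF0 fin, of "a N" N, folded RG]
    have ie: "integrable M (\<lambda>\<omega>. exp (- (s * (norm (G N \<omega>))\<^sup>2)))"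
      using s by (intro M.integrable_const_bound[where B = 1]) auto
    have ie': "integrable M (\<lambda>\<omega>. exp (- (s * (\<Sum>l<K. (G N \<omega> \<bullet> u l)\<^sup>2))))"
      using s by (intro M.integrable_const_bound[where B = 1]) (auto simp: sum_nonneg)
    have "\<bar>?A N - A N K\<bar> = \<bar>\<integral>\<omega>. exp (- (s * (norm (G N \<omega>))\<^sup>2)) - exp (- (s * (\<Sum>l<K. (G N \<omega> \<bullet> u l)\<^sup>2))) \<partial>M\<bar>"
      unfolding A_def using ie ie' by simp
    also have "\<dots> \<le> (\<integral>\<omega>. \<bar>exp (- (s * (norm (G N \<omega>))\<^sup>2)) - exp (- (s * (\<Sum>l<K. (G N \<omega> \<bullet> u l)\<^sup>2)))\<bar> \<partial>M)"
      by (rule integral_abs_bound)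
    also have "\<dots> \<le> (\<integral>\<omega>. s * (norm (?R (G N \<omega>)))\<^sup>2 \<partial>M)"
    proof (rule integral_mono)
      fix \<omega>
      have "\<bar>exp (- (s * (norm (G N \<omega>))\<^sup>2)) - exp (- (s * (\<Sum>l<K. (G N \<omega> \<bullet> u l)\<^sup>2)))\<bar>
          \<le> \<bar>s * (norm (G N \<omega>))\<^sup>2 - s * (\<Sum>l<K. (G N \<omega> \<bullet> u l)\<^sup>2)\<bar>"
        using s by (intro abs_exp_minus_diff_le) (auto simp: sum_nonneg)
      also have "\<dots> = \<bar>s * (norm (?R (G N \<omega>)))\<^sup>2\<bar>"
        by (simp add: norm_truncation_residual[OF u] right_diff_distrib)
      also have "\<dots> = s * (norm (?R (G N \<omega>)))\<^sup>2" using s by simp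
      finally show "\<bar>exp (- (s * (norm (G N \<omega>))\<^sup>2)) - exp (- (s * (\<Sum>l<K. (G N \<omega> \<bullet> u l)\<^sup>2)))\<bar>
          \<le> s * (norm (?R (G N \<omega>)))\<^sup>2" .
    qed (use ie ie' RGi(1) in auto)
    also have "\<dots> = s * ((\<Sum>i\<in>I N. (a N i)\<^sup>2) * \<tau> K)" using RGi by (simp add: \<tau>_def)
    finally show ?thesis .
  qed
  have "?A \<longlonglongrightarrow> ?B"
  proof (rule LIMSEQ_I)
    fix e :: real assume "e > 0"
    then have e3: "e / 3 > 0" by simp
    have "(\<lambda>K. s * ((\<kappa> + 1) * \<tau> K)) \<longlonglongrightarrow> s * ((\<kappa> + 1) * 0)"
      unfolding \<tau>_def by (intro tendsto_intros tail)
    then have "(\<lambda>K. s * ((\<kappa> + 1) * \<tau> K)) \<longlonglongrightarrow> 0" by simp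
    from eventually_conj[OF order_tendstoD(2)[OF this e3] tendstoD[OF B_lim e3]]
    obtain K where K: "s * ((\<kappa> + 1) * \<tau> K) < e / 3" "dist (B K) ?B < e / 3"
      using eventually_happens'[OF sequentially_bot] by blast
    have "\<forall>\<^sub>F N in sequentially. norm (?A N - ?B) < e"
      using tendstoD[OF A_lim e3, of K] order_tendstoD(2)[OF sq, of "\<kappa> + 1", simplified]
    proof eventually_elim
      case (elim N)
      have "\<tau> K \<ge> 0" by (simp add: \<tau>_def)
      then have "s * ((\<Sum>i\<in>I N. (a N i)\<^sup>2) * \<tau> K) \<le> s * ((\<kappa> + 1) * \<tau> K)"
        using elim(2) s by (intro mult_left_mono mult_right_mono) auto
      then show ?case using gap[of N K] elim(1) K unfolding dist_real_def real_norm_def by linarith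
    qed
    then show "\<exists>N0. \<forall>N\<ge>N0. norm (?A N - ?B) < e" by (simp add: eventually_sequentially)
  qed
  then show ?thesis unfolding G_def .
qed

section \<open>Tensor squares\<close>

lemma bounded_bilinear_tensor: "bounded_bilinear (tensor :: 'a::{real_inner,banach} \<Rightarrow> 'a \<Rightarrow> 'a hs_op)"
proof
  fix a a' b b' :: 'a and r :: real
  show "(a + a') \<otimes> b = a \<otimes> b + a' \<otimes> b" "a \<otimes> (b + b') = a \<otimes> b + a \<otimes> b'"
    "(r *\<^sub>R a) \<otimes> b = r *\<^sub>R (a \<otimes> b)" "a \<otimes> (r *\<^sub>R b) = r *\<^sub>R (a \<otimes> b)"
    by (auto simp: op_of_hs_inject[symmetric] plus_hs_op.rep_eq scaleR_hs_op.rep_eq tensor_apply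
        blinfun.add_left blinfun.scaleR_left inner_add_left scaleR_add_left scaleR_add_right intro!: blinfun_eqI)
  have "norm (a \<otimes> b) = norm a * norm b" for a b :: 'a
  proof -
    have "((\<lambda>e. (norm a)\<^sup>2 * (b \<bullet> e)\<^sup>2) has_sum ((norm a)\<^sup>2 * (norm b)\<^sup>2)) some_basis"
      by (rule has_sum_cmult_right[OF parseval[OF some_basis]])
    moreover have "((\<lambda>e. (norm a)\<^sup>2 * (b \<bullet> e)\<^sup>2) has_sum (norm (a \<otimes> b))\<^sup>2) some_basis"
      using hs_norm_has_sum[of "a \<otimes> b"] by (simp add: tensor_apply power_mult_distrib mult.commute)
    ultimately have "(norm (a \<otimes> b))\<^sup>2 = (norm a)\<^sup>2 * (norm b)\<^sup>2" by (metis has_sum_unique)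
    then show ?thesis by (simp add: power_mult_distrib[symmetric])
  qed
  then show "\<exists>K. \<forall>a b. norm ((a::'a) \<otimes> b) \<le> norm a * norm b * K" by (intro exI[of _ 1]) simp
qed

lemma inner_tensor_square:
  fixes a b :: "'a::{real_inner,banach}"
  shows "tensor_square a \<bullet> tensor_square b = (a \<bullet> b)\<^sup>2"
proof -
  have "((\<lambda>e. (a \<bullet> ((b \<bullet> e) *\<^sub>R e)) * (a \<bullet> b)) has_sum ((a \<bullet> b) * (a \<bullet> b))) some_basis"
    by (intro has_sum_cmult_left has_sum_bounded_linear[OF bounded_linear_inner_right]
        orthonormal_basis_expansion[OF some_basis])
  moreover have "op_of_hs (tensor_square a) e \<bullet> op_of_hs (tensor_square b) e = (a \<bullet> ((b \<bullet> e) *\<^sub>R e)) * (a \<bullet> b)" for e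
    by (simp add: tensor_square_def tensor_apply)
  ultimately show ?thesis unfolding inner_hs_op_def
    by (simp add: infsumI power2_eq_square)
qed

lemma norm_tensor_square: "norm (tensor_square a) = (norm a)\<^sup>2"
proof -
  have "(norm (tensor_square a))\<^sup>2 = ((norm a)\<^sup>2)\<^sup>2"
    unfolding power2_norm_eq_inner inner_tensor_square ..
  then show ?thesis by (rule power2_eq_imp_eq) auto
qed

lemma continuous_tensor_square: "continuous_on UNIV tensor_square"
  unfolding tensor_square_def
  by (intro bounded_bilinear.continuous_on[OF bounded_bilinear_tensor] continuous_on_id)

lemma strongly_measurable_tensor_square:
  "strongly_measurable M f \<Longrightarrow> strongly_measurable M (\<lambda>x. tensor_square (f x))"
  by (rule strongly_measurable_continuous[OF _ continuous_tensor_square])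

section \<open>Moments of the fluctuations of the tensor square\<close>

lemma power2_norm_diff_le:
  fixes x y :: "'a::real_normed_vector"
  shows "(norm (x - y))\<^sup>2 \<le> 2 * (norm x)\<^sup>2 + 2 * (norm y)\<^sup>2"
proof -
  have "(norm (x - y))\<^sup>2 \<le> (norm x + norm y)\<^sup>2" by (intro power_mono norm_triangle_ineq4) simp
  also have "\<dots> \<le> 2 * (norm x)\<^sup>2 + 2 * (norm y)\<^sup>2"
    using zero_le_power2[of "norm x - norm y"] by (simp add: power2_sum power2_diff)
  finally show ?thesis .
qed

lemma bounded_linear_hs_op_entry: "bounded_linear (\<lambda>A. op_of_hs A x \<bullet> y)"
proof (rule bounded_linear_intro)
  fix A B :: "'a hs_op" and r :: real
  show "op_of_hs (A + B) x \<bullet> y = op_of_hs A x \<bullet> y + op_of_hs B x \<bullet> y"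
    by (simp add: plus_hs_op.rep_eq blinfun.add_left inner_add_left)
  show "op_of_hs (r *\<^sub>R A) x \<bullet> y = r *\<^sub>R (op_of_hs A x \<bullet> y)"
    by (simp add: scaleR_hs_op.rep_eq blinfun.scaleR_left)
  have "norm (op_of_hs A x \<bullet> y) \<le> norm (op_of_hs A x) * norm y" by (simp add: Cauchy_Schwarz_ineq2)
  also have "\<dots> \<le> (norm (op_of_hs A) * norm x) * norm y" by (intro mult_right_mono norm_blinfun) simp
  also have "\<dots> \<le> (norm A * norm x) * norm y" by (intro mult_right_mono op_norm_le_hs_norm) auto
  finally show "norm (op_of_hs A x \<bullet> y) \<le> norm A * (norm x * norm y)" by (simp add: mult.assoc)
qed

text \<open>
  A fourth moment of \<open>\<phi>\<close> is a second moment of its tensor square, which is what the central limit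
  theorem for \<open>W\<close> requires. The last claim identifies the bilinear form of the covariance operator.
\<close>

lemma tensor_square_fluctuation_moments:
  fixes \<phi> :: "'a \<Rightarrow> 'f::{real_inner,banach}"
  assumes P: "prob_space P" and \<phi>: "strongly_measurable P \<phi>" and \<phi>4: "integrable P (\<lambda>x. (norm (\<phi> x)) ^ 4)"
  defines "W \<equiv> \<lambda>x. tensor_square (\<phi> x) - bochner_integral P (\<lambda>x. tensor_square (\<phi> x))"
  shows "strongly_measurable P W" "integrable P (\<lambda>x. (norm (W x))\<^sup>2)"
    "(\<integral>x. W x \<bullet> t \<partial>P) = 0"
    "op_of_hs (bochner_integral P (\<lambda>x. tensor_square (W x))) x \<bullet> y = (\<integral>w. (W w \<bullet> x) * (W w \<bullet> y) \<partial>P)"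
proof -
  interpret prob_space P by fact
  let ?C = "bochner_integral P (\<lambda>x. tensor_square (\<phi> x))"
  have [measurable]: "(\<lambda>x. norm (\<phi> x)) \<in> borel_measurable P" by (rule measurable_norm_strongly[OF \<phi>])
  note ts = strongly_measurable_tensor_square[OF \<phi>]
  have i2: "integrable P (\<lambda>x. norm (tensor_square (\<phi> x)))" unfolding norm_tensor_square
    by (rule square_integrable_imp_integrable) (use \<phi>4 in auto)
  note C = has_bochner_if_strongly_measurable[OF P ts i2]
  show W: "strongly_measurable P W" unfolding W_def
    by (intro strongly_measurable_diff ts strongly_measurable_const)
  have [measurable]: "(\<lambda>x. norm (W x)) \<in> borel_measurable P" by (rule measurable_norm_strongly[OF W])
  show W2: "integrable P (\<lambda>x. (norm (W x))\<^sup>2)"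
  proof (rule Bochner_Integration.integrable_bound)
    show "integrable P (\<lambda>x. 2 * (norm (\<phi> x)) ^ 4 + 2 * (norm ?C)\<^sup>2)" using \<phi>4 by simp
    have "(norm (W x))\<^sup>2 \<le> 2 * (norm (\<phi> x)) ^ 4 + 2 * (norm ?C)\<^sup>2" for x
      using power2_norm_diff_le[of "tensor_square (\<phi> x)" ?C] by (simp add: W_def norm_tensor_square)
    then show "AE x in P. norm ((norm (W x))\<^sup>2) \<le> norm (2 * (norm (\<phi> x)) ^ 4 + 2 * (norm ?C)\<^sup>2)" by simp
  qed measurable
  have "integrable P (\<lambda>x. tensor_square (\<phi> x) \<bullet> t)" "(\<integral>x. tensor_square (\<phi> x) \<bullet> t \<partial>P) = ?C \<bullet> t"
    using has_bochner_functional[OF ts C bounded_linear_inner_left] by auto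
  then show "(\<integral>x. W x \<bullet> t \<partial>P) = 0" by (simp add: W_def inner_diff_left prob_space)
  note tW = strongly_measurable_tensor_square[OF W]
  have "integrable P (\<lambda>x. norm (tensor_square (W x)))" unfolding norm_tensor_square by (rule W2)
  note V = has_bochner_if_strongly_measurable[OF P tW this]
  show "op_of_hs (bochner_integral P (\<lambda>x. tensor_square (W x))) x \<bullet> y = (\<integral>w. (W w \<bullet> x) * (W w \<bullet> y) \<partial>P)"
    unfolding has_bochner_functional(2)[OF tW V bounded_linear_hs_op_entry, symmetric]
    by (simp add: tensor_square_def tensor_apply)
qed

section \<open>The test statistic\<close>

lemma inner_kernel_section:
  assumes "rkhs k emb"
  shows "kernel_section k emb x \<bullet> kernel_section k emb y = k y x"
proof -
  have inj: "inj emb" and ex: "(\<lambda>z. k z x) \<in> range emb" and rep: "\<And>f z. emb f z = f \<bullet> kernel_section k emb z"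
    using assms by (auto simp: rkhs_def)
  have "\<exists>!f. emb f = (\<lambda>z. k z x)" using ex inj by (auto simp: inj_on_def)
  then have "emb (kernel_section k emb x) = (\<lambda>z. k z x)" unfolding kernel_section_def by (rule theI')
  then show ?thesis using rep[of "kernel_section k emb x" y] by simp
qed

text \<open>
  The statistic depends on the samples only through finitely many values of \<open>k\<close>, so it is measurable
  although the feature map agrees with a strongly measurable one only up to a null set.
\<close>

lemma measurable_test_statistic:
  assumes rk: "rkhs k emb" and k: "(\<lambda>(x, y). k x y) \<in> borel_measurable (S \<Otimes>\<^sub>M S)"
    and X: "\<And>i. X i \<in> M \<rightarrow>\<^sub>M S" and Y: "\<And>j. Y j \<in> M \<rightarrow>\<^sub>M S"
  shows "(\<lambda>\<omega>. test_statistic k emb n m (\<lambda>i. X i \<omega>) (\<lambda>j. Y j \<omega>)) \<in> borel_measurable M"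
proof -
  have km [measurable]: "(\<lambda>\<omega>. k (f \<omega>) (g \<omega>)) \<in> borel_measurable M" if "f \<in> M \<rightarrow>\<^sub>M S" "g \<in> M \<rightarrow>\<^sub>M S" for f g
    using measurable_compose[OF measurable_Pair[OF that] k] by simp
  have inner [measurable]: "(\<lambda>\<omega>. empirical_covariance k emb p (\<lambda>i. U i \<omega>) \<bullet> empirical_covariance k emb q (\<lambda>i. V i \<omega>)) \<in> borel_measurable M"
    if [measurable]: "\<And>i. U i \<in> M \<rightarrow>\<^sub>M S" "\<And>i. V i \<in> M \<rightarrow>\<^sub>M S" for U V :: "nat \<Rightarrow> _" and p q
    unfolding empirical_covariance_def empirical_mean_def
      inner_sum_left inner_sum_right inner_scaleR_left inner_scaleR_right inner_tensor_square
      inner_diff_left inner_diff_right inner_kernel_section[OF rk]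
    by measurable
  show ?thesis
    unfolding test_statistic_def power2_norm_eq_inner inner_diff_left inner_diff_right
    using X Y by (intro borel_measurable_diff inner)
qed

text \<open>
  Centring at the empirical instead of the true mean costs only the tensor square of the mean
  error, which is of second order.
\<close>

lemma empirical_covariance_centred:
  fixes f :: "nat \<Rightarrow> 'f::{real_inner,banach}"
  assumes n: "n > 0" and f: "\<And>i. i < n \<Longrightarrow> kernel_section k emb (x i) = f i + \<mu>"
  shows "empirical_covariance k emb n x =
    C + (1 / real n) *\<^sub>R (\<Sum>i<n. tensor_square (f i) - C) - tensor_square ((1 / real n) *\<^sub>R (\<Sum>i<n. f i))"
proof -
  interpret t: bounded_bilinear "tensor :: 'f \<Rightarrow> 'f \<Rightarrow> 'f hs_op" by (rule bounded_bilinear_tensor)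
  define g where "g = (1 / real n) *\<^sub>R (\<Sum>i<n. f i)"
  have sf: "(\<Sum>i<n. f i) = real n *\<^sub>R g" using n by (simp add: g_def)
  have "(\<Sum>i<n. kernel_section k emb (x i)) = (\<Sum>i<n. f i) + real n *\<^sub>R \<mu>"
    using f by (simp add: sum.distrib sum_constant_scaleR)
  then have m: "empirical_mean k emb n x = g + \<mu>"
    using n by (simp add: empirical_mean_def g_def scaleR_add_right)
  have "(\<Sum>i<n. tensor_square (kernel_section k emb (x i) - empirical_mean k emb n x))
      = (\<Sum>i<n. tensor_square (f i) - f i \<otimes> g - g \<otimes> f i + g \<otimes> g)"
    using f by (intro sum.cong refl) (simp add: m tensor_square_def t.diff_left t.diff_right)
  also have "\<dots> = (\<Sum>i<n. tensor_square (f i)) - (\<Sum>i<n. f i) \<otimes> g - g \<otimes> (\<Sum>i<n. f i) + real n *\<^sub>R (g \<otimes> g)"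
    by (simp add: sum.distrib sum_subtractf t.sum_left t.sum_right sum_constant_scaleR)
  also have "\<dots> = (\<Sum>i<n. tensor_square (f i)) - real n *\<^sub>R tensor_square g"
    by (simp add: sf t.scaleR_left t.scaleR_right tensor_square_def)
  finally have 1: "(\<Sum>i<n. tensor_square (kernel_section k emb (x i) - empirical_mean k emb n x))
      = (\<Sum>i<n. tensor_square (f i)) - real n *\<^sub>R tensor_square g" .
  have 2: "(\<Sum>i<n. tensor_square (f i) - C) = (\<Sum>i<n. tensor_square (f i)) - real n *\<^sub>R C"
    by (simp add: sum_subtractf sum_constant_scaleR)
  show ?thesis unfolding empirical_covariance_def 1 2 g_def[symmetric]
    using n by (simp add: scaleR_diff_right)
qed

text \<open>
  This makes \<open>x \<mapsto> exp (- s \<parallel>x\<parallel>\<^sup>2)\<close> Lipschitz, so a perturbation of the vector that is small in \<open>L\<^sup>1\<close>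
  does not affect the limit of the Laplace transforms.
\<close>

lemma abs_gauss_diff_le:
  fixes a b :: real
  shows "\<bar>exp (- a\<^sup>2) - exp (- b\<^sup>2)\<bar> \<le> \<bar>a - b\<bar>"
proof -
  have slope: "\<bar>- 2 * z * exp (- z\<^sup>2)\<bar> \<le> 1" for z :: real
  proof -
    have "2 * \<bar>z\<bar> \<le> 1 + z\<^sup>2" using zero_le_power2[of "\<bar>z\<bar> - 1"] by (simp add: power2_diff)
    also have "\<dots> \<le> exp (z\<^sup>2)" by (rule exp_ge_add_one_self)
    finally show ?thesis by (simp add: abs_mult exp_minus field_simps)
  qed
  have "norm (exp (- a\<^sup>2) - exp (- b\<^sup>2)) \<le> 1 * norm (a - b)"
  proof (rule field_differentiable_bound[of UNIV "\<lambda>z. exp (- z\<^sup>2)" "\<lambda>z. - 2 * z * exp (- z\<^sup>2)"])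
    show "((\<lambda>z. exp (- z\<^sup>2)) has_field_derivative - 2 * z * exp (- z\<^sup>2)) (at z within UNIV)" for z :: real
      by (auto intro!: derivative_eq_intros)
  qed (use slope in auto)
  then show ?thesis by simp
qed

text \<open>
  The first two limits give the sum of the squared weights of the observations; the last two say
  that each single weight, and the scaled squared error of each sample mean, is negligible.
\<close>

lemma two_sample_weights_tendsto:
  fixes n m :: "nat \<Rightarrow> nat"
  assumes n: "filterlim n at_top sequentially" and m: "filterlim m at_top sequentially"
    and \<rho>: "(\<lambda>N. real (n N) / real (n N + m N)) \<longlonglongrightarrow> \<rho>" "0 < \<rho>" "\<rho> < 1"
  shows "(\<lambda>N. real (n N + m N) / real (n N)) \<longlonglongrightarrow> 1 / \<rho>"
    and "(\<lambda>N. real (n N + m N) / real (m N)) \<longlonglongrightarrow> 1 / (1 - \<rho>)"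
    and "(\<lambda>N. sqrt (real (n N + m N)) / real (n N)) \<longlonglongrightarrow> 0"
    and "(\<lambda>N. sqrt (real (n N + m N)) / real (m N)) \<longlonglongrightarrow> 0"
proof -
  have n0: "\<forall>\<^sub>F N in sequentially. n N > 0"
    using n[unfolded filterlim_at_top, rule_format, of 1] by eventually_elim simp
  have "(\<lambda>N. 1 / (real (n N) / real (n N + m N))) \<longlonglongrightarrow> 1 / \<rho>"
    using \<rho> by (intro tendsto_intros) auto
  then show a: "(\<lambda>N. real (n N + m N) / real (n N)) \<longlonglongrightarrow> 1 / \<rho>" by simp
  have "(\<lambda>N. 1 / (1 - real (n N) / real (n N + m N))) \<longlonglongrightarrow> 1 / (1 - \<rho>)"
    using \<rho> by (intro tendsto_intros) auto
  moreover have "\<forall>\<^sub>F N in sequentially. 1 / (1 - real (n N) / real (n N + m N)) = real (n N + m N) / real (m N)"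
    using n0 by eventually_elim (simp add: field_simps)
  ultimately show b: "(\<lambda>N. real (n N + m N) / real (m N)) \<longlonglongrightarrow> 1 / (1 - \<rho>)"
    using tendsto_cong by fastforce
  have root: "(\<lambda>N. sqrt (real (n N + m N)) / real (p N)) \<longlonglongrightarrow> 0"
    if p: "filterlim p at_top sequentially" and lim: "(\<lambda>N. real (n N + m N) / real (p N)) \<longlonglongrightarrow> c" for p :: "nat \<Rightarrow> nat" and c
  proof -
    have "filterlim (\<lambda>N. real (p N)) at_top sequentially"
      by (rule filterlim_compose[OF filterlim_real_sequentially p])
    then have "filterlim (\<lambda>N. sqrt (real (p N))) at_top sequentially"
      by (rule filterlim_compose[OF sqrt_at_top])
    then have "(\<lambda>N. sqrt (real (n N + m N) / real (p N)) / sqrt (real (p N))) \<longlonglongrightarrow> 0"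
      by (intro tendsto_divide_0[OF tendsto_real_sqrt[OF lim]] filterlim_at_top_imp_at_infinity)
    moreover have "sqrt (real (n N + m N) / real (p N)) / sqrt (real (p N)) = sqrt (real (n N + m N)) / real (p N)" for N
      by (simp add: real_sqrt_divide)
    ultimately show ?thesis by simp
  qed
  show "(\<lambda>N. sqrt (real (n N + m N)) / real (n N)) \<longlonglongrightarrow> 0" by (rule root[OF n a])
  show "(\<lambda>N. sqrt (real (n N + m N)) / real (m N)) \<longlonglongrightarrow> 0" by (rule root[OF m b])
qed

text \<open>
  The moment bound rests on \<open>\<parallel>k(\<cdot>, x)\<parallel>\<^sup>2 = k(x, x)\<close>.
\<close>

lemma centred_feature_map:
  fixes k :: "'h \<Rightarrow> 'h \<Rightarrow> real" and emb :: "'f::{real_inner,banach} \<Rightarrow> 'h \<Rightarrow> real"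
  assumes rk: "rkhs k emb" and k: "(\<lambda>(x, y). k x y) \<in> borel_measurable (P \<Otimes>\<^sub>M P)"
    and P: "prob_space P" and bo: "bochner_integrable P (kernel_section k emb)"
    and k2: "integrable P (\<lambda>x. (k x x)\<^sup>2)"
  obtains \<phi> where "strongly_measurable P \<phi>" "integrable P (\<lambda>x. (norm (\<phi> x)) ^ 4)"
    "\<And>v. (\<integral>x. \<phi> x \<bullet> v \<partial>P) = 0"
    "AE x in P. kernel_section k emb x = \<phi> x + mean_embedding k emb P"
proof -
  interpret prob_space P by fact
  let ?h = "kernel_section k emb" and ?\<mu> = "mean_embedding k emb P"
  obtain E where E [measurable]: "E \<in> sets P" and AE_E: "AE x in P. x \<in> E"
    and sm: "strongly_measurable P (\<lambda>x. indicator E x *\<^sub>R ?h x)"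
    using bochner_integrable_strongly_measurable_version[OF bo] by blast
  obtain I where I: "has_bochner P ?h I" using bo by (auto simp: bochner_integrable_def)
  then have I\<mu>: "I = ?\<mu>" by (simp add: mean_embedding_def bochner_integral_eqI)
  have hE: "AE x in P. ?h x = indicator E x *\<^sub>R ?h x" using AE_E by eventually_elim simp
  note b = has_bochner_cong_AE[OF hE I[unfolded I\<mu>]]
  define \<phi> where "\<phi> x = indicator E x *\<^sub>R ?h x - ?\<mu>" for x
  have \<phi>: "strongly_measurable P \<phi>" unfolding \<phi>_def by (intro strongly_measurable_diff sm strongly_measurable_const)
  have [measurable]: "(\<lambda>x. norm (\<phi> x)) \<in> borel_measurable P" by (rule measurable_norm_strongly[OF \<phi>])
  have [measurable]: "(\<lambda>x. k x x) \<in> borel_measurable P"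
    using measurable_compose[OF measurable_Pair[OF measurable_ident measurable_ident] k] by simp
  show thesis
  proof (rule that[OF \<phi>])
    show "integrable P (\<lambda>x. (norm (\<phi> x)) ^ 4)"
    proof (rule Bochner_Integration.integrable_bound)
      show "integrable P (\<lambda>x. 8 * (k x x)\<^sup>2 + 8 * (norm ?\<mu>) ^ 4)" using k2 by simp
      show "AE x in P. norm ((norm (\<phi> x)) ^ 4) \<le> norm (8 * (k x x)\<^sup>2 + 8 * (norm ?\<mu>) ^ 4)"
      proof (rule AE_I2)
        fix x
        have kx: "(norm (?h x))\<^sup>2 = k x x" by (simp add: power2_norm_eq_inner inner_kernel_section[OF rk])
        have "(norm (indicator E x *\<^sub>R ?h x))\<^sup>2 \<le> k x x"
          unfolding kx[symmetric] by (auto simp: indicator_def)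
        then have "(norm (\<phi> x))\<^sup>2 \<le> 2 * k x x + 2 * (norm ?\<mu>)\<^sup>2"
          using power2_norm_diff_le[of "indicator E x *\<^sub>R ?h x" ?\<mu>] by (simp add: \<phi>_def)
        then have "((norm (\<phi> x))\<^sup>2)\<^sup>2 \<le> (2 * k x x + 2 * (norm ?\<mu>)\<^sup>2)\<^sup>2" by (intro power_mono) auto
        also have "\<dots> \<le> 2 * (2 * k x x)\<^sup>2 + 2 * (2 * (norm ?\<mu>)\<^sup>2)\<^sup>2"
          using zero_le_power2[of "2 * k x x - 2 * (norm ?\<mu>)\<^sup>2"] by (simp add: power2_sum power2_diff)
        also have "\<dots> = 8 * (k x x)\<^sup>2 + 8 * (norm ?\<mu>) ^ 4" by (simp add: power_mult_distrib)
        finally show "norm ((norm (\<phi> x)) ^ 4) \<le> norm (8 * (k x x)\<^sup>2 + 8 * (norm ?\<mu>) ^ 4)" by simp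
      qed
    qed measurable
    show "(\<integral>x. \<phi> x \<bullet> v \<partial>P) = 0" for v
      using has_bochner_functional[OF sm b bounded_linear_inner_left[of v]]
      by (simp add: \<phi>_def inner_diff_left prob_space)
    show "AE x in P. ?h x = \<phi> x + ?\<mu>" using AE_E by eventually_elim (simp add: \<phi>_def)
  qed
qed

text \<open>
  The mean of \<open>n\<close> centred variables has squared norm of order \<open>1 / n\<close>. The injection \<open>e\<close> selects one
  of the samples inside the joint family.
\<close>

lemma mean_tensor_square_L1:
  fixes F :: "'a \<Rightarrow> 'g::{real_inner,banach}" and \<zeta> :: "'i \<Rightarrow> 'w \<Rightarrow> 'a"
  assumes "prob_space M" "prob_space.indep_vars M (\<lambda>_. S) \<zeta> UNIV" "\<And>i. distr M S (\<zeta> i) = P"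
    "strongly_measurable P F" "integrable P (\<lambda>x. (norm (F x))\<^sup>2)" "\<And>v. (\<integral>x. F x \<bullet> v \<partial>P) = 0"
    and e: "inj e"
  shows "integrable M (\<lambda>\<omega>. norm (tensor_square ((1 / real n) *\<^sub>R (\<Sum>i<n. F (\<zeta> (e i) \<omega>)))))"
    and "(\<integral>\<omega>. norm (tensor_square ((1 / real n) *\<^sub>R (\<Sum>i<n. F (\<zeta> (e i) \<omega>)))) \<partial>M)
      = (\<integral>x. (norm (F x))\<^sup>2 \<partial>P) / real n"
proof -
  have ie: "inj_on e {..<n}" using e by (rule inj_on_subset) simp
  have *: "norm (tensor_square ((1 / real n) *\<^sub>R (\<Sum>i<n. F (\<zeta> (e i) \<omega>))))
      = (norm (\<Sum>i\<in>e ` {..<n}. (1 / real n) *\<^sub>R F (\<zeta> i \<omega>)))\<^sup>2" for \<omega>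
    by (simp add: norm_tensor_square sum.reindex[OF ie] scaleR_sum_right)
  note w = norm_weighted_iid_sum[OF assms(1-6), of "e ` {..<n}" "\<lambda>_. 1 / real n"]
  show "integrable M (\<lambda>\<omega>. norm (tensor_square ((1 / real n) *\<^sub>R (\<Sum>i<n. F (\<zeta> (e i) \<omega>)))))"
    unfolding * by (rule w(1)) simp
  show "(\<integral>\<omega>. norm (tensor_square ((1 / real n) *\<^sub>R (\<Sum>i<n. F (\<zeta> (e i) \<omega>)))) \<partial>M)
      = (\<integral>x. (norm (F x))\<^sup>2 \<partial>P) / real n"
    unfolding * by (subst w(2)) (simp_all add: card_image[OF ie] power2_eq_square)
qed

section \<open>Convergence under the null hypothesis\<close>

theorem theorem1:
  fixes \<A> :: "'h::{real_inner, banach, second_countable_topology} set set"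
    and k :: "'h \<Rightarrow> 'h \<Rightarrow> real"
    and emb :: "'f::{real_inner, banach} \<Rightarrow> 'h \<Rightarrow> real"
    and P Q :: "'h measure"
    and M :: "'w measure" and X Y :: "nat \<Rightarrow> 'w \<Rightarrow> 'h"
    and n m :: "nat \<Rightarrow> nat" and \<rho> :: real
    and L :: "'v measure" and Z :: "nat \<Rightarrow> 'v \<Rightarrow> real"
    and lam :: "nat \<Rightarrow> real"
  assumes "sigma_algebra UNIV \<A>"
    and "positive_definite_kernel k" and "rkhs k emb" and "characteristic \<A> k emb"
    and "(\<lambda>(x, y). k x y) \<in> borel_measurable (sigma UNIV \<A> \<Otimes>\<^sub>M sigma UNIV \<A>)"
    and "prob_space P" and "sets P = \<A>" and "bochner_integrable P (kernel_section k emb)"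
    and "prob_space Q" and "sets Q = \<A>" and "bochner_integrable Q (kernel_section k emb)"
    and "integrable P (\<lambda>x. (k x x)\<^sup>2)" and "integrable Q (\<lambda>y. (k y y)\<^sup>2)"
    and "prob_space M"
    and "\<And>i. distr M (sigma UNIV \<A>) (X i) = P"
    and "\<And>j. distr M (sigma UNIV \<A>) (Y j) = Q"
    and "prob_space.indep_vars M (\<lambda>_. sigma UNIV \<A>) (case_sum X Y) UNIV"
    and "filterlim n at_top sequentially" and "filterlim m at_top sequentially"
    and "(\<lambda>N. real (n N) / real (n N + m N)) \<longlonglongrightarrow> \<rho>" and "0 < \<rho>" and "\<rho> < 1"
    and "P = Q"
    and "prob_space L" and "prob_space.indep_vars L (\<lambda>_. borel) Z UNIV"
    and "\<And>l. distributed L lborel (Z l) std_normal_density"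
    and "eigenvalue_sequence (covariance_operator k emb P) lam"
  shows "weak_conv_m
    (\<lambda>N. distr M borel (\<lambda>\<omega>. real (n N + m N) *
        test_statistic k emb (n N) (m N) (\<lambda>i. X i \<omega>) (\<lambda>j. Y j \<omega>)))
    (distr L borel (\<lambda>\<omega>. 1 / (\<rho> * (1 - \<rho>)) * (\<Sum>l. lam l * (Z l \<omega>)\<^sup>2)))"
proof -
  note rk = assms(3) and M = assms(14) and P = assms(6) and L = assms(24) and Z = assms(26)
  interpret M: prob_space M by (rule M)
  interpret P: prob_space P by (rule P)
  interpret L: prob_space L by (rule L)
  define S where "S = sigma UNIV \<A>"
  define \<zeta> where "\<zeta> = case_sum X Y"
  have indep: "M.indep_vars (\<lambda>_. S) \<zeta> UNIV" using assms(17) by (simp add: S_def \<zeta>_def)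
  have dist: "distr M S (\<zeta> i) = P" for i
    using assms(15,16,23) by (cases i) (simp_all add: S_def \<zeta>_def)
  have \<zeta> [measurable]: "\<zeta> i \<in> M \<rightarrow>\<^sub>M S" for i using indep by (simp add: M.indep_vars_def)
  have X [measurable]: "X i \<in> M \<rightarrow>\<^sub>M S" and Y [measurable]: "Y i \<in> M \<rightarrow>\<^sub>M S" for i
    using \<zeta>[of "Inl i"] \<zeta>[of "Inr i"] by (simp_all add: \<zeta>_def)
  have sP: "sets P = sets S" using dist[of undefined] by auto
  have \<zeta>P: "\<zeta> i \<in> M \<rightarrow>\<^sub>M P" for i using \<zeta> sP measurable_cong_sets by blast
  have kS: "(\<lambda>(x, y). k x y) \<in> borel_measurable (S \<Otimes>\<^sub>M S)" using assms(5) by (simp add: S_def)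
  have "sets (P \<Otimes>\<^sub>M P) = sets (S \<Otimes>\<^sub>M S)" by (intro sets_pair_measure_cong sP)
  then have kP: "(\<lambda>(x, y). k x y) \<in> borel_measurable (P \<Otimes>\<^sub>M P)" using kS measurable_cong_sets by blast
  have [measurable]: "Z l \<in> borel_measurable L" for l using assms(25) by (simp add: L.indep_vars_def)

  let ?\<mu> = "mean_embedding k emb P"
  obtain \<phi> where \<phi>: "strongly_measurable P \<phi>" and \<phi>4: "integrable P (\<lambda>x. (norm (\<phi> x)) ^ 4)"
    and \<phi>0: "\<And>v. (\<integral>x. \<phi> x \<bullet> v \<partial>P) = 0" and \<phi>h: "AE x in P. kernel_section k emb x = \<phi> x + ?\<mu>"
    using centred_feature_map[OF rk kP P assms(8,12)] by blast
  have [measurable]: "(\<lambda>x. norm (\<phi> x)) \<in> borel_measurable P" by (rule measurable_norm_strongly[OF \<phi>])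
  have \<phi>2: "integrable P (\<lambda>x. (norm (\<phi> x))\<^sup>2)"
    by (rule P.square_integrable_imp_integrable) (use \<phi>4 in auto)
  define C where "C = bochner_integral P (\<lambda>x. tensor_square (\<phi> x))"
  define W where "W x = tensor_square (\<phi> x) - C" for x
  define T where "T = bochner_integral P (\<lambda>x. tensor_square (W x))"
  note W = tensor_square_fluctuation_moments[OF P \<phi> \<phi>4, folded C_def, folded W_def, folded T_def]
  have "covariance_embedding k emb P = C" unfolding covariance_embedding_def C_def
    by (rule bochner_integral_cong_AE) (use \<phi>h in eventually_elim, simp)
  then have "covariance_operator k emb P = T" unfolding covariance_operator_def T_def W_def
    by (intro bochner_integral_cong_AE) (use \<phi>h in eventually_elim, simp)
  then have lam: "eigenvalue_sequence T lam" using assms(27) by simp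

  \<comment> \<open>Both samples form one independent family over the disjoint union of the index sets. The weights
     make \<open>G\<close> below the scaled difference of the two sample means of \<open>W\<close>.\<close>
  define r where "r N = sqrt (real (n N + m N))" for N
  define I where "I N = {..<n N} <+> {..<m N}" for N
  define a where "a N = case_sum (\<lambda>_::nat. r N / real (n N)) (\<lambda>_::nat. - r N / real (m N))" for N
  note lims = two_sample_weights_tendsto[OF assms(18-22), folded r_def]
  have pos: "\<forall>\<^sub>F N in sequentially. n N > 0 \<and> m N > 0"
    using assms(18,19)[unfolded filterlim_at_top, rule_format, of 1] by eventually_elim simp
  have fin: "finite (I N)" for N by (simp add: I_def)
  have small: "\<forall>\<^sub>F N in sequentially. \<forall>i\<in>I N. \<bar>a N i\<bar> \<le> \<delta>" if "\<delta> > 0" for \<delta>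
    using order_tendstoD(2)[OF lims(3) that] order_tendstoD(2)[OF lims(4) that]
    by eventually_elim (auto simp: I_def a_def r_def)
  have sum_I: "(\<Sum>i\<in>I N. f i) = (\<Sum>i<n N. f (Inl i)) + (\<Sum>j<m N. f (Inr j))" for f :: "nat + nat \<Rightarrow> 'b::comm_monoid_add" and N
    by (simp add: I_def sum.Plus comp_def)
  have sq: "(\<lambda>N. \<Sum>i\<in>I N. (a N i)\<^sup>2) \<longlonglongrightarrow> 1 / (\<rho> * (1 - \<rho>))"
  proof -
    have "(\<lambda>N. real (n N + m N) / real (n N) + real (n N + m N) / real (m N)) \<longlonglongrightarrow> 1 / \<rho> + 1 / (1 - \<rho>)"
      by (intro tendsto_add lims(1,2))
    moreover have "1 / \<rho> + 1 / (1 - \<rho>) = 1 / (\<rho> * (1 - \<rho>))" using assms(21,22) by (simp add: field_simps)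
    moreover have "\<forall>\<^sub>F N in sequentially. real (n N + m N) / real (n N) + real (n N + m N) / real (m N) = (\<Sum>i\<in>I N. (a N i)\<^sup>2)"
      using pos by eventually_elim (simp add: sum_I a_def r_def power_divide power2_eq_square field_simps)
    ultimately show ?thesis using tendsto_cong by fastforce
  qed

  define stat where
    "stat = (\<lambda>N \<omega>. real (n N + m N) * test_statistic k emb (n N) (m N) (\<lambda>i. X i \<omega>) (\<lambda>j. Y j \<omega>))"
  let ?Y = "\<lambda>v. 1 / (\<rho> * (1 - \<rho>)) * (\<Sum>l. lam l * (Z l v)\<^sup>2)"
  have Xm [measurable]: "stat N \<in> borel_measurable M" for N
    unfolding stat_def by (intro borel_measurable_times borel_measurable_const measurable_test_statistic[OF rk kS X Y])
  have X0: "0 \<le> stat N \<omega>" for N \<omega> by (simp add: stat_def test_statistic_def)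
  have Y0: "AE v in L. 0 \<le> ?Y v"
  proof -
    have lam0: "lam l \<ge> 0" and lamS: "summable lam" for l
      using covariance_eigenexpansion[OF P W(1,2,4) lam] by metis+
    from AE_summable_weighted_squares[of L Z lam, OF L Z lam0 lamS] show ?thesis
      by eventually_elim (use lam0 assms(21,22) in \<open>auto intro!: divide_nonneg_nonneg suminf_nonneg\<close>)
  qed

  define G where "G N \<omega> = (\<Sum>i\<in>I N. a N i *\<^sub>R W (\<zeta> i \<omega>))" for N \<omega>
  define mX where "mX N \<omega> = tensor_square ((1 / real (n N)) *\<^sub>R (\<Sum>i<n N. \<phi> (\<zeta> (Inl i) \<omega>)))" for N \<omega>
  define mY where "mY N \<omega> = tensor_square ((1 / real (m N)) *\<^sub>R (\<Sum>j<m N. \<phi> (\<zeta> (Inr j) \<omega>)))" for N \<omega>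
  define \<tau> where "\<tau> = (\<integral>x. (norm (\<phi> x))\<^sup>2 \<partial>P)"
  have G: "strongly_measurable M (G N)" for N unfolding G_def
    by (intro strongly_measurable_sum strongly_measurable_scaleR strongly_measurable_comp[OF W(1) \<zeta>P])
  have [measurable]: "(\<lambda>\<omega>. norm (G N \<omega>)) \<in> borel_measurable M" for N by (rule measurable_norm_strongly[OF G])
  have mX: "integrable M (\<lambda>\<omega>. norm (mX N \<omega>))" "(\<integral>\<omega>. norm (mX N \<omega>) \<partial>M) = \<tau> / real (n N)" for N
    unfolding mX_def \<tau>_def by (rule mean_tensor_square_L1[OF M indep dist \<phi> \<phi>2 \<phi>0 inj_Inl])+
  have mY: "integrable M (\<lambda>\<omega>. norm (mY N \<omega>))" "(\<integral>\<omega>. norm (mY N \<omega>) \<partial>M) = \<tau> / real (m N)" for N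
    unfolding mY_def \<tau>_def by (rule mean_tensor_square_L1[OF M indep dist \<phi> \<phi>2 \<phi>0 inj_Inr])+
  \<comment> \<open>There are only countably many observations, so almost surely all of them avoid the null set on
     which \<open>\<phi>\<close> is not the centred feature map.\<close>
  have AE\<zeta>: "AE \<omega> in M. \<forall>i. kernel_section k emb (\<zeta> i \<omega>) = \<phi> (\<zeta> i \<omega>) + ?\<mu>"
    unfolding AE_all_countable by (intro allI AE_distrD[OF \<zeta>], subst dist) (rule \<phi>h)
  \<comment> \<open>Centring at the empirical means perturbs \<open>G\<close> by \<open>r (mY - mX)\<close>, whose expected norm tends to \<open>0\<close>.\<close>
  have close: "\<bar>(\<integral>\<omega>. exp (- (real j * stat N \<omega>)) \<partial>M) - (\<integral>\<omega>. exp (- (real j * (norm (G N \<omega>))\<^sup>2)) \<partial>M)\<bar>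
      \<le> sqrt (real j) * (r N / real (n N) * \<tau> + r N / real (m N) * \<tau>)" if nm: "n N > 0" "m N > 0" for N j
  proof -
    have ie: "integrable M (\<lambda>\<omega>. exp (- (real j * stat N \<omega>)))"
      using X0 by (intro M.integrable_const_bound[where B = 1]) auto
    have ie': "integrable M (\<lambda>\<omega>. exp (- (real j * (norm (G N \<omega>))\<^sup>2)))"
      by (intro M.integrable_const_bound[where B = 1]) auto
    have bound: "AE \<omega> in M. \<bar>exp (- (real j * stat N \<omega>)) - exp (- (real j * (norm (G N \<omega>))\<^sup>2))\<bar>
        \<le> sqrt (real j) * (r N * (norm (mX N \<omega>) + norm (mY N \<omega>)))"
      using AE\<zeta>
    proof eventually_elim
      case (elim \<omega>)
      let ?CX = "empirical_covariance k emb (n N) (\<lambda>i. X i \<omega>)"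
      let ?CY = "empirical_covariance k emb (m N) (\<lambda>j. Y j \<omega>)"
      have CX: "?CX = C + (1 / real (n N)) *\<^sub>R (\<Sum>i<n N. W (\<zeta> (Inl i) \<omega>)) - mX N \<omega>"
        unfolding W_def mX_def
        by (rule empirical_covariance_centred[OF nm(1)]) (use elim[THEN spec, of "Inl _"] in \<open>simp add: \<zeta>_def\<close>)
      have CY: "?CY = C + (1 / real (m N)) *\<^sub>R (\<Sum>i<m N. W (\<zeta> (Inr i) \<omega>)) - mY N \<omega>"
        unfolding W_def mY_def
        by (rule empirical_covariance_centred[OF nm(2)]) (use elim[THEN spec, of "Inr _"] in \<open>simp add: \<zeta>_def\<close>)
      have GW: "G N \<omega> = (r N / real (n N)) *\<^sub>R (\<Sum>i<n N. W (\<zeta> (Inl i) \<omega>))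
          - (r N / real (m N)) *\<^sub>R (\<Sum>j<m N. W (\<zeta> (Inr j) \<omega>))"
        by (simp add: G_def sum_I a_def scaleR_sum_right sum_negf)
      have GR: "r N *\<^sub>R (?CX - ?CY) = G N \<omega> + r N *\<^sub>R (mY N \<omega> - mX N \<omega>)"
        by (simp add: CX CY GW scaleR_diff_right scaleR_add_right divide_inverse)
      have "stat N \<omega> = (norm (r N *\<^sub>R (?CX - ?CY)))\<^sup>2"
        by (simp add: stat_def test_statistic_def r_def power_mult_distrib)
      then have "real j * stat N \<omega> = (sqrt (real j) * norm (r N *\<^sub>R (?CX - ?CY)))\<^sup>2"
        by (simp add: power_mult_distrib)
      moreover have "real j * (norm (G N \<omega>))\<^sup>2 = (sqrt (real j) * norm (G N \<omega>))\<^sup>2"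
        by (simp add: power_mult_distrib)
      ultimately have "\<bar>exp (- (real j * stat N \<omega>)) - exp (- (real j * (norm (G N \<omega>))\<^sup>2))\<bar>
          \<le> \<bar>sqrt (real j) * norm (r N *\<^sub>R (?CX - ?CY)) - sqrt (real j) * norm (G N \<omega>)\<bar>"
        using abs_gauss_diff_le by simp
      also have "\<dots> = sqrt (real j) * \<bar>norm (r N *\<^sub>R (?CX - ?CY)) - norm (G N \<omega>)\<bar>"
        by (simp add: abs_mult flip: right_diff_distrib)
      also have "\<dots> \<le> sqrt (real j) * norm (r N *\<^sub>R (mY N \<omega> - mX N \<omega>))"
        using norm_triangle_ineq3[of "r N *\<^sub>R (?CX - ?CY)" "G N \<omega>"] by (intro mult_left_mono) (simp_all add: GR)
      also have "\<dots> \<le> sqrt (real j) * (r N * (norm (mX N \<omega>) + norm (mY N \<omega>)))"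
        using norm_triangle_ineq4[of "mY N \<omega>" "mX N \<omega>"]
        by (intro mult_left_mono) (simp_all add: r_def mult_left_mono add.commute)
      finally show ?case .
    qed
    have "\<bar>(\<integral>\<omega>. exp (- (real j * stat N \<omega>)) \<partial>M) - (\<integral>\<omega>. exp (- (real j * (norm (G N \<omega>))\<^sup>2)) \<partial>M)\<bar>
        = \<bar>\<integral>\<omega>. exp (- (real j * stat N \<omega>)) - exp (- (real j * (norm (G N \<omega>))\<^sup>2)) \<partial>M\<bar>"
      using ie ie' by simp
    also have "\<dots> \<le> (\<integral>\<omega>. \<bar>exp (- (real j * stat N \<omega>)) - exp (- (real j * (norm (G N \<omega>))\<^sup>2))\<bar> \<partial>M)"
      by (rule integral_abs_bound)
    also have "\<dots> \<le> (\<integral>\<omega>. sqrt (real j) * (r N * (norm (mX N \<omega>) + norm (mY N \<omega>))) \<partial>M)"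
      by (rule integral_mono_AE[OF _ _ bound]) (use ie ie' mX(1) mY(1) in auto)
    also have "\<dots> = sqrt (real j) * (r N / real (n N) * \<tau> + r N / real (m N) * \<tau>)"
      using mX mY by (simp add: algebra_simps)
    finally show ?thesis .
  qed
  have "weak_conv_m (\<lambda>N. distr M borel (stat N)) (distr L borel ?Y)"
  proof (rule weak_conv_if_laplace_conv[OF M L Xm _ _ Y0])
    show "?Y \<in> borel_measurable L" by measurable
    show "AE \<omega> in M. 0 \<le> stat N \<omega>" for N using X0 by simp
    fix j :: nat
    have main: "(\<lambda>N. \<integral>\<omega>. exp (- (real j * (norm (G N \<omega>))\<^sup>2)) \<partial>M) \<longlonglongrightarrow> (\<integral>v. exp (- (real j * ?Y v)) \<partial>L)"
      unfolding G_def
      by (rule laplace_norm_weighted_iid_sum_tendsto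
          [OF M indep dist W(1-4) lam fin small sq L assms(25) Z]) auto
    have "(\<lambda>N. sqrt (real j) * (r N / real (n N) * \<tau> + r N / real (m N) * \<tau>)) \<longlonglongrightarrow> sqrt (real j) * (0 * \<tau> + 0 * \<tau>)"
      by (intro tendsto_intros lims(3,4))
    then have "(\<lambda>N. sqrt (real j) * (r N / real (n N) * \<tau> + r N / real (m N) * \<tau>)) \<longlonglongrightarrow> 0" by simp
    then have "(\<lambda>N. (\<integral>\<omega>. exp (- (real j * stat N \<omega>)) \<partial>M) - (\<integral>\<omega>. exp (- (real j * (norm (G N \<omega>))\<^sup>2)) \<partial>M)) \<longlonglongrightarrow> 0"
      by (rule Lim_null_comparison[rotated]) (use pos close in \<open>auto elim!: eventually_mono\<close>)
    from tendsto_add[OF this main] show "(\<lambda>N. \<integral>\<omega>. exp (- (real j * stat N \<omega>)) \<partial>M) \<longlonglongrightarrow> (\<integral>v. exp (- (real j * ?Y v)) \<partial>L)"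
      by simp
  qed
  then show ?thesis unfolding stat_def .
qed

end
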